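(* (Generalized transversality condition.) Assume that $\alpha\in\mathcal A_{t_*,T}$ is an optimal control for $(t_*,w_* )\in\mathbb G$, let $x(\cdot)=x(\cdot\,|\,t_*,w_*,\alpha)$, and assume that $g$ is Fr\'echet differentiable at $(x(T),x_T)$. Define $D(s)=s-\tau(s,x(s))$, $s\in[t_*,T]$, let $\gamma:[D(t_* ),D(T)]\to[t_*,T]$ be its inverse, and let $p:[t_*,T]\to\mathbb R^n$ solve $$\begin{aligned}\dot p(s)=&-f_z(s,x(s),x(D(s)),\alpha(s))^\top p(s)-L_z(s,x(s),x(D(s)),\alpha(s))\\&+\tau_z(s,x(s))\bigl[\dot x(D(s))\cdot f_y(s,x(s),x(D(s)),\alpha(s))^\top p(s)\bigr]\\&+\tau_z(s,x(s))\bigl[\dot x(D(s))\cdot L_y(s,x(s),x(D(s)),\alpha(s))\bigr]\\&-\mathbf 1_{[t_*,D(T)]}(s)\,\dot\gamma(s)\,f_y(\gamma(s),x(\gamma(s)),x(s),\alpha(\gamma(s)))^\top p(\gamma(s))\\&-\mathbf 1_{[t_*,D(T)]}(s)\,\dot\gamma(s)\,L_y(\gamma(s),x(\gamma(s)),x(s),\alpha(\gamma(s)))\\&-\mathbf 1_{[T-\bar\tau,T]}(s)\,g_w(x(T),x_T)(s-T),\qquad\text{a.e. }s\in(t_*,T),\end{aligned}$$ with $p(T)=g_z(x(T),x_T)$. Then for any $t\in(t_*,T)$ at which $\alpha$ is continuous, $$\bigl(-H(t,x(t),x(D(t)),p(t)),\,p(t)\bigr)\in\partial^{\mathrm{dela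y}}_+\rho(t,x_t).$$
   Context: Setting. Let $t_0<T$, $I=[t_0,T]$, $n,m\ge 1$; $A\subset\mathbb R^m$ is nonempty, convex and compact. $\|\cdot\|$ is the Euclidean norm on $\mathbb R^n$; $\|\cdot\|_1,\|\cdot\|_\infty$ are the usual $L^1,L^\infty$ norms for functions on $[-\bar\tau,0]$ (with $\bar\tau$ introduced in (7) below). $\mathbb G:=I\times\operatorname{Lip}([-\bar\tau,0];\mathbb R^n)$. For $t_0\le t<s\le T$, $\mathcal A_{t,s}$ is the set of measurable functions $\alpha:(t,s)\to A$. For $R>0$: $P(R)=\{w\in\operatorname{Lip}([-\bar\tau,0];\mathbb R^n):\|w\|_\infty\le R\}$, $B_R=\{x\in\mathbb R^n:\|x\|\le R\}$. $\mathcal X=\{(z,w):w\in\operatorname{Lip}([-\bar\tau,0];\mathbb R^n),\ z=w(0)\}$ with norm $\|(z,w)\|_{\mathcal X}=\|z\|+\|w\|_1$. Standing assumptions. (1) $f:I\times\mathbb R^n\times\mathbb R^n\times A\to\mathbb R^n$ and $L:I\times\mathbb R^n\times\mathbb R^n\times A\to\mathbb R$ (arguments $(t,z,y,a)$) are continuous. (2) There is $\lambda_f>0$ with $\|f(t,z,y,a)-f(t,z',y',a)\|\le\lambda_f(\|z-z'\|+\|y-y'\|)$ for all arguments, and hence $\|f(t,z,y,a)\|\le C_f(1+\|z\|+\|y\|)$ for some $C_f>0$. (3) For every $(t,z,y)$ the set $\{(f(t,z,y,a),\ell)\in\mathbb R^n\times\mathbb R:a\in A,\ \ell\ge L(t,z,y,a)\}$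 is convex. (4) For every $R>0$ there is $\lambda_L(R)>0$ with $|L(t,z,y,a)-L(t,z',y',a)|\le\lambda_L(R)(\|z-z'\|+\|y-y'\|)$ for $t\in I$, $a\in A$, $z,y,z',y'\in B_R$. (5) There is $C_L>0$ with $|L(t,z,y,a)|\le C_L(1+\|z\|+\|y\|)$ for all arguments. (6) $g:\mathcal X\to\mathbb R$ and for every $R>0$ there is $\lambda_g(R)>0$ with $|g(z_1,w_1)-g(z_2,w_2)|\le\lambda_g(R)\|(z_1,w_1)-(z_2,w_2)\|_{\mathcal X}$ for all $(z_i,w_i)\in\mathcal X$ with $w_i\in P(R)$. (7) $\tau:I\times\mathbb R^n\to[0,\infty)$ is $C^1$ with supremum $\bar\tau<\infty$, and there is $\lambda_\tau>0$ with $|\tau(t,z)-\tau(t,y)|\le\lambda_\tau\|z-y\|$ for all $t\in I$, $z,y\in\mathbb R^n$. State equation. For $(t,w)\in\mathbb G$ and $\alpha\in\mathcal A_{t,T}$, $x(\cdot\,|\,t,w,\alpha)$ denotes the unique Lipschitz $x:[t-\bar\tau,T]\to\mathbb R^n$ with $\dot x(s)=f(s,x(s),x(s-\tau(s,x(s))),\alpha(s))$ for a.e. $s\in(t,T)$ and $x(t+\theta)=w(\theta)$ for $\theta\in[-\bar\tau,0]$ (it exists and is unique under (1)-(7)). Write $x_s(\theta)=x(s+\theta)$, $\theta\in[-\bar\tau,0]$. (8) (Monotone delay) For every $r>0$ there is $d(r)>0$ such that for every such solution with $t\in I$, $w\in P(r)$, $\alpha\in\mathcal A_{t,T}$: $1-\tau_t(s,x(s))-\tau_z(s,x(s))\cdot\dot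 x(s)\ge d(r)$ for a.e. $s\in[t,T]$. (So $s\mapsto s-\tau(s,x(s))$ is strictly increasing and invertible onto its image.) (9) In addition, $f$ and $L$ are $C^1$ in $(z,y)$ uniformly with respect to $(t,a)$. $f_z,f_y$ are the Jacobian matrices of $f$ in $z$ and $y$; $L_z,L_y,\tau_z$ are gradients; vectors are column vectors. Cost and value. $J(t,w,\alpha)=\int_t^TL(s,x(s),x(s-\tau(s,x(s))),\alpha(s))\,ds+g(x(T),x_T)$ with $x=x(\cdot\,|\,t,w,\alpha)$, $\rho(t,w)=\inf_{\alpha\in\mathcal A_{t,T}}J(t,w,\alpha)$ (and $\rho(T,w)=g(w(0),w)$); $\alpha$ is an optimal control for $(t,w)$ if $J(t,w,\alpha)=\rho(t,w)$. Hamiltonian. $H(t,z,y,p)=\min_{a\in A}\{f(t,z,y,a)\cdot p+L(t,z,y,a)\}$. Fr\'echet differentiability of $g$ at $(z,w)\in\mathcal X$: there exist $g_z(z,w)\in\mathbb R^n$ and $g_w(z,w)\in L^\infty([-\bar\tau,0];\mathbb R^n)$ with $g(z+\delta z,w+\delta w)-g(z,w)=g_z(z,w)\cdot\delta z+\int_{-\bar\tau}^0g_w(z,w)(\theta)\cdot\delta w(\theta)\,d\theta+o(\|(\delta z,\delta w)\|_{\mathcal X})$ for all $(\delta z,\delta w)\in\mathcal X$. Solutions of the adjoint equation are understood as Lipschitz functions satisfying the equation a.e. (terms carrying an indicator are $0$ where the indicator vanishes, and $[t_*,D(T)]=\emptyset$ if $D(T)<t_*$). Polygonal extension. For $(t,w)\in\mathbb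 G$, $z=w(0)$, $s\in(t,T]$, $x\in\mathbb R^n$, $\Lambda_0(t,w;s,x)=\{v\}$ where $v(\xi)=w(\xi-t)$ for $\xi\in[t-\bar\tau,t)$, $v(\xi)=z+\frac{x-z}{s-t}(\xi-t)$ for $\xi\in[t,s]$, $v(\xi)=x$ for $\xi>s$; $v_s(\theta)=v(s+\theta)$. Delay superdifferential. For $\varphi:\mathbb G\to\mathbb R$, $(t,w)\in\mathbb G$ with $t<T$, $z=w(0)$, $\ell>0$, $\theta\in\mathbb R^n$: $\partial^+\varphi(t,w)(\ell,\theta)=\limsup_{h\downarrow0}\frac{\varphi(t+h\ell,v_{t+h\ell})-\varphi(t,w)}{h}$, where $v\in\Lambda_0(t,w;t+h\ell,z+h\theta)$; and $\partial^{\mathrm{delay}}_+\varphi(t,w)=\{(q,p)\in\mathbb R\times\mathbb R^n:\partial^+\varphi(t,w)(\ell,\theta)\le q\ell+p\cdot\theta\ \ \forall(\ell,\theta)\in(0,\infty)\times\mathbb R^n\}$. *)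

theory Defs
  imports "HOL-Analysis.Analysis"
begin

section \<open>History functions\<close>

text \<open>
  Functions on an interval \<open>[-b, 0]\<close> are represented by total functions on the reals of which only
  the restriction to \<open>[-b, 0]\<close> is relevant. Throughout, \<open>b\<close> is the maximal delay, and
  \<open>I = {t0..T}\<close>.
\<close>

definition max_delay :: "real \<Rightarrow> real \<Rightarrow> (real \<Rightarrow> real^'n \<Rightarrow> real) \<Rightarrow> real" where
  "max_delay t0 T \<tau> = (SUP (t, z) \<in> {t0..T} \<times> UNIV. \<tau> t z)"

definition Lip :: "real \<Rightarrow> (real \<Rightarrow> real^'n) set" where
  "Lip b = {w. \<exists>C. C-lipschitz_on {-b..0} w}"

definition Lip_ball :: "real \<Rightarrow> real \<Rightarrow> (real \<Rightarrow> real^'n) set" where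
  "Lip_ball b R = {w \<in> Lip b. \<forall>\<theta>\<in>{-b..0}. norm (w \<theta>) \<le> R}"

definition state_space :: "real \<Rightarrow> ((real^'n) \<times> (real \<Rightarrow> real^'n)) set" where
  "state_space b = {(z, w). w \<in> Lip b \<and> z = w 0}"

definition state_norm :: "real \<Rightarrow> real^'n \<Rightarrow> (real \<Rightarrow> real^'n) \<Rightarrow> real" where
  "state_norm b z w = norm z + (LINT \<theta>|lebesgue_on {-b..0}. norm (w \<theta>))"

definition segment :: "(real \<Rightarrow> real^'n) \<Rightarrow> real \<Rightarrow> real \<Rightarrow> real^'n" where
  "segment x s = (\<lambda>\<theta>. x (s + \<theta>))"

text \<open>
  \<open>gz\<close> and \<open>gw\<close> are the two components of the Frechet derivative of \<open>g\<close> at \<open>(z, w)\<close>;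
  \<open>gw\<close> is a representative of an element of \<open>L\<^sup>\<infinity>\<close>.
\<close>

definition has_state_derivative ::
  "real \<Rightarrow> (real^'n \<Rightarrow> (real \<Rightarrow> real^'n) \<Rightarrow> real) \<Rightarrow> real^'n \<Rightarrow> (real \<Rightarrow> real^'n) \<Rightarrow>
   real^'n \<Rightarrow> (real \<Rightarrow> real^'n) \<Rightarrow> bool" where
  "has_state_derivative b g z w gz gw \<longleftrightarrow>
     gw \<in> borel_measurable (lebesgue_on {-b..0}) \<and>
     (\<exists>C. AE \<theta> in lebesgue_on {-b..0}. norm (gw \<theta>) \<le> C) \<and>
     (\<forall>\<epsilon>>0. \<exists>\<delta>>0. \<forall>(dz, dw) \<in> state_space b. state_norm b dz dw < \<delta> \<longrightarrow>
        \<bar>g (z + dz) (\<lambda>\<theta>. w \<theta> + dw \<theta>) - g z w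
          - (gz \<bullet> dz + (LINT \<theta>|lebesgue_on {-b..0}. gw \<theta> \<bullet> dw \<theta>))\<bar>
        \<le> \<epsilon> * state_norm b dz dw)"


section \<open>Partial derivatives\<close>

definition gradient :: "(real^'n \<Rightarrow> real) \<Rightarrow> real^'n \<Rightarrow> real^'n" where
  "gradient \<phi> z = (THE D. GDERIV \<phi> z :> D)"

definition f\<^sub>z where
  "f\<^sub>z f t z y a = jacobian (\<lambda>z'. f t z' y a) (at z)"
  for f :: "real \<Rightarrow> real^'n \<Rightarrow> real^'n \<Rightarrow> real^'m \<Rightarrow> real^'n"

definition f\<^sub>y where
  "f\<^sub>y f t z y a = jacobian (\<lambda>y'. f t z y' a) (at y)"
  for f :: "real \<Rightarrow> real^'n \<Rightarrow> real^'n \<Rightarrow> real^'m \<Rightarrow> real^'n"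

definition L\<^sub>z where
  "L\<^sub>z L t z y a = gradient (\<lambda>z'. L t z' y a) z"
  for L :: "real \<Rightarrow> real^'n \<Rightarrow> real^'n \<Rightarrow> real^'m \<Rightarrow> real"

definition L\<^sub>y where
  "L\<^sub>y L t z y a = gradient (\<lambda>y'. L t z y' a) y"
  for L :: "real \<Rightarrow> real^'n \<Rightarrow> real^'n \<Rightarrow> real^'m \<Rightarrow> real"

text \<open>The time derivative is one-sided at the end points of \<open>I\<close>.\<close>

definition \<tau>\<^sub>t :: "real \<Rightarrow> real \<Rightarrow> (real \<Rightarrow> real^'n \<Rightarrow> real) \<Rightarrow> real \<Rightarrow> real^'n \<Rightarrow> real" where
  "\<tau>\<^sub>t t0 T \<tau> t z = vector_derivative (\<lambda>s. \<tau> s z) (at t within {t0..T})"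

definition \<tau>\<^sub>z :: "(real \<Rightarrow> real^'n \<Rightarrow> real) \<Rightarrow> real \<Rightarrow> real^'n \<Rightarrow> real^'n" where
  "\<tau>\<^sub>z \<tau> t z = gradient (\<tau> t) z"

text \<open>
  \<open>F\<close> is continuously differentiable in \<open>(z, y)\<close> uniformly with respect to \<open>(t, a)\<close>: the modulus of
  continuity of the derivative at each \<open>(z, y)\<close> does not depend on \<open>(t, a)\<close>. By the mean value
  inequality the first-order remainder at \<open>(z, y)\<close> is then uniform in \<open>(t, a)\<close> as well.
\<close>

definition C1_uniformly ::
  "real set \<Rightarrow> (real^'m) set \<Rightarrow>
   (real \<Rightarrow> real^'n \<Rightarrow> real^'n \<Rightarrow> real^'m \<Rightarrow> 'b::real_normed_vector) \<Rightarrow> bool" where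
  "C1_uniformly I A F \<longleftrightarrow>
     (\<forall>t\<in>I. \<forall>a\<in>A. \<forall>u. (\<lambda>(z, y). F t z y a) differentiable (at u)) \<and>
     (\<forall>u. \<forall>\<epsilon>>0. \<exists>\<delta>>0. \<forall>t\<in>I. \<forall>a\<in>A. \<forall>u'. dist u' u < \<delta> \<longrightarrow>
        onorm (\<lambda>h. frechet_derivative (\<lambda>(z, y). F t z y a) (at u') h
                   - frechet_derivative (\<lambda>(z, y). F t z y a) (at u) h) < \<epsilon>)"


section \<open>Controlled delay equation, cost and value function\<close>

definition controls :: "(real^'m) set \<Rightarrow> real \<Rightarrow> real \<Rightarrow> (real \<Rightarrow> real^'m) set" where
  "controls A t s =
     {\<alpha>. \<alpha> \<in> borel_measurable (lebesgue_on {t<..<s}) \<and> (\<forall>r\<in>{t<..<s}. \<alpha> r \<in> A)}"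

definition is_trajectory ::
  "real \<Rightarrow> real \<Rightarrow> (real \<Rightarrow> real^'n \<Rightarrow> real^'n \<Rightarrow> real^'m \<Rightarrow> real^'n) \<Rightarrow> (real \<Rightarrow> real^'n \<Rightarrow> real) \<Rightarrow>
   real \<Rightarrow> (real \<Rightarrow> real^'n) \<Rightarrow> (real \<Rightarrow> real^'m) \<Rightarrow> (real \<Rightarrow> real^'n) \<Rightarrow> bool" where
  "is_trajectory b T f \<tau> t w \<alpha> x \<longleftrightarrow>
     (\<exists>C. C-lipschitz_on {t - b..T} x) \<and>
     (AE s in lebesgue_on {t<..<T}.
        (x has_vector_derivative f s (x s) (x (s - \<tau> s (x s))) (\<alpha> s)) (at s)) \<and>
     (\<forall>\<theta>\<in>{-b..0}. x (t + \<theta>) = w \<theta>)"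

text \<open>
  The solution is unique on \<open>[t - b, T]\<close>; \<open>extensional\<close> fixes its irrelevant values elsewhere.
\<close>

definition trajectory ::
  "real \<Rightarrow> real \<Rightarrow> (real \<Rightarrow> real^'n \<Rightarrow> real^'n \<Rightarrow> real^'m \<Rightarrow> real^'n) \<Rightarrow> (real \<Rightarrow> real^'n \<Rightarrow> real) \<Rightarrow>
   real \<Rightarrow> (real \<Rightarrow> real^'n) \<Rightarrow> (real \<Rightarrow> real^'m) \<Rightarrow> (real \<Rightarrow> real^'n)" where
  "trajectory b T f \<tau> t w \<alpha> =
     (THE x. x \<in> extensional {t - b..T} \<and> is_trajectory b T f \<tau> t w \<alpha> x)"

definition cost ::
  "real \<Rightarrow> real \<Rightarrow> (real \<Rightarrow> real^'n \<Rightarrow> real^'n \<Rightarrow> real^'m \<Rightarrow> real^'n) \<Rightarrow>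
   (real \<Rightarrow> real^'n \<Rightarrow> real^'n \<Rightarrow> real^'m \<Rightarrow> real) \<Rightarrow>
   (real^'n \<Rightarrow> (real \<Rightarrow> real^'n) \<Rightarrow> real) \<Rightarrow> (real \<Rightarrow> real^'n \<Rightarrow> real) \<Rightarrow>
   real \<Rightarrow> (real \<Rightarrow> real^'n) \<Rightarrow> (real \<Rightarrow> real^'m) \<Rightarrow> real" where
  "cost b T f L g \<tau> t w \<alpha> =
     (let x = trajectory b T f \<tau> t w \<alpha> in
      (LINT s|lebesgue_on {t<..<T}. L s (x s) (x (s - \<tau> s (x s))) (\<alpha> s)) + g (x T) (segment x T))"

definition value_function ::
  "real \<Rightarrow> real \<Rightarrow> (real^'m) set \<Rightarrow> (real \<Rightarrow> real^'n \<Rightarrow> real^'n \<Rightarrow> real^'m \<Rightarrow> real^'n) \<Rightarrow>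
   (real \<Rightarrow> real^'n \<Rightarrow> real^'n \<Rightarrow> real^'m \<Rightarrow> real) \<Rightarrow>
   (real^'n \<Rightarrow> (real \<Rightarrow> real^'n) \<Rightarrow> real) \<Rightarrow> (real \<Rightarrow> real^'n \<Rightarrow> real) \<Rightarrow>
   real \<Rightarrow> (real \<Rightarrow> real^'n) \<Rightarrow> real" where
  "value_function b T A f L g \<tau> t w =
     (if t = T then g (w 0) w else (INF \<alpha> \<in> controls A t T. cost b T f L g \<tau> t w \<alpha>))"

definition optimal_control ::
  "real \<Rightarrow> real \<Rightarrow> (real^'m) set \<Rightarrow> (real \<Rightarrow> real^'n \<Rightarrow> real^'n \<Rightarrow> real^'m \<Rightarrow> real^'n) \<Rightarrow>
   (real \<Rightarrow> real^'n \<Rightarrow> real^'n \<Rightarrow> real^'m \<Rightarrow> real) \<Rightarrow>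
   (real^'n \<Rightarrow> (real \<Rightarrow> real^'n) \<Rightarrow> real) \<Rightarrow> (real \<Rightarrow> real^'n \<Rightarrow> real) \<Rightarrow>
   real \<Rightarrow> (real \<Rightarrow> real^'n) \<Rightarrow> (real \<Rightarrow> real^'m) \<Rightarrow> bool" where
  "optimal_control b T A f L g \<tau> t w \<alpha> \<longleftrightarrow>
     \<alpha> \<in> controls A t T \<and> cost b T f L g \<tau> t w \<alpha> = value_function b T A f L g \<tau> t w"

text \<open>The infimum is a minimum when \<open>A\<close> is compact and nonempty and \<open>f\<close>, \<open>L\<close> are continuous.\<close>

definition hamiltonian ::
  "(real^'m) set \<Rightarrow> (real \<Rightarrow> real^'n \<Rightarrow> real^'n \<Rightarrow> real^'m \<Rightarrow> real^'n) \<Rightarrow>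
   (real \<Rightarrow> real^'n \<Rightarrow> real^'n \<Rightarrow> real^'m \<Rightarrow> real) \<Rightarrow>
   real \<Rightarrow> real^'n \<Rightarrow> real^'n \<Rightarrow> real^'n \<Rightarrow> real" where
  "hamiltonian A f L t z y p = (INF a\<in>A. f t z y a \<bullet> p + L t z y a)"


section \<open>Delay superdifferential\<close>

definition polygonal_extension ::
  "real \<Rightarrow> (real \<Rightarrow> real^'n) \<Rightarrow> real \<Rightarrow> real^'n \<Rightarrow> real \<Rightarrow> real^'n" where
  "polygonal_extension t w s x \<xi> =
     (if \<xi> < t then w (\<xi> - t)
      else if \<xi> \<le> s then w 0 + ((\<xi> - t) / (s - t)) *\<^sub>R (x - w 0)
      else x)"

definition upper_delay_derivative ::
  "(real \<Rightarrow> (real \<Rightarrow> real^'n) \<Rightarrow> real) \<Rightarrow> real \<Rightarrow> (real \<Rightarrow> real^'n) \<Rightarrow> real \<Rightarrow> real^'n \<Rightarrow> ereal" where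
  "upper_delay_derivative \<phi> t w l \<theta> =
     Limsup (at_right 0) (\<lambda>h.
       let v = polygonal_extension t w (t + h * l) (w 0 + h *\<^sub>R \<theta>)
       in ereal ((\<phi> (t + h * l) (segment v (t + h * l)) - \<phi> t w) / h))"

definition delay_superdifferential ::
  "(real \<Rightarrow> (real \<Rightarrow> real^'n) \<Rightarrow> real) \<Rightarrow> real \<Rightarrow> (real \<Rightarrow> real^'n) \<Rightarrow> (real \<times> (real^'n)) set" where
  "delay_superdifferential \<phi> t w =
     {(q, p). \<forall>l>0. \<forall>\<theta>. upper_delay_derivative \<phi> t w l \<theta> \<le> ereal (q * l + p \<bullet> \<theta>)}"


section \<open>Standing assumptions\<close>

text \<open>
  The linear growth of \<open>f\<close> in \<open>(z, y)\<close> is not listed: it follows from \<open>f_cont\<close> and \<open>f_lipschitz\<close>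
  because \<open>{t0..T} \<times> A\<close> is compact.
\<close>

locale delay_control_problem =
  fixes t0 T :: real
    and A :: "(real^'m) set"
    and f :: "real \<Rightarrow> real^'n \<Rightarrow> real^'n \<Rightarrow> real^'m \<Rightarrow> real^'n"
    and L :: "real \<Rightarrow> real^'n \<Rightarrow> real^'n \<Rightarrow> real^'m \<Rightarrow> real"
    and g :: "real^'n \<Rightarrow> (real \<Rightarrow> real^'n) \<Rightarrow> real"
    and \<tau> :: "real \<Rightarrow> real^'n \<Rightarrow> real"
  assumes time: "t0 < T"
    and A_nonempty: "A \<noteq> {}" and A_convex: "convex A" and A_compact: "compact A"
    and f_cont: "continuous_on ({t0..T} \<times> UNIV \<times> UNIV \<times> A) (\<lambda>(t, z, y, a). f t z y a)"
    and L_cont: "continuous_on ({t0..T} \<times> UNIV \<times> UNIV \<times> A) (\<lambda>(t, z, y, a). L t z y a)"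
    and f_lipschitz: "\<exists>lf>0. \<forall>t\<in>{t0..T}. \<forall>a\<in>A. \<forall>z y z' y'.
          norm (f t z y a - f t z' y' a) \<le> lf * (norm (z - z') + norm (y - y'))"
    and epigraph_convex: "\<forall>t\<in>{t0..T}. \<forall>z y. convex {(f t z y a, l) | a l. a \<in> A \<and> l \<ge> L t z y a}"
    and L_lipschitz: "\<forall>R>0. \<exists>lL>0. \<forall>t\<in>{t0..T}. \<forall>a\<in>A.
          \<forall>z\<in>cball 0 R. \<forall>y\<in>cball 0 R. \<forall>z'\<in>cball 0 R. \<forall>y'\<in>cball 0 R.
          \<bar>L t z y a - L t z' y' a\<bar> \<le> lL * (norm (z - z') + norm (y - y'))"
    and L_growth: "\<exists>C>0. \<forall>t\<in>{t0..T}. \<forall>a\<in>A. \<forall>z y. \<bar>L t z y a\<bar> \<le> C * (1 + norm z + norm y)"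
    and \<tau>_nonneg: "\<forall>t\<in>{t0..T}. \<forall>z. 0 \<le> \<tau> t z"
    and \<tau>_differentiable: "\<forall>u\<in>{t0..T} \<times> UNIV.
          (\<lambda>(t, z). \<tau> t z) differentiable (at u within {t0..T} \<times> UNIV)"
    and \<tau>\<^sub>t_cont: "continuous_on ({t0..T} \<times> UNIV) (\<lambda>(t, z). \<tau>\<^sub>t t0 T \<tau> t z)"
    and \<tau>\<^sub>z_cont: "continuous_on ({t0..T} \<times> UNIV) (\<lambda>(t, z). \<tau>\<^sub>z \<tau> t z)"
    and \<tau>_bounded: "bdd_above ((\<lambda>(t, z). \<tau> t z) ` ({t0..T} \<times> UNIV))"
    and \<tau>_lipschitz: "\<exists>l\<tau>>0. \<forall>t\<in>{t0..T}. \<forall>z y. \<bar>\<tau> t z - \<tau> t y\<bar> \<le> l\<tau> * norm (z - y)"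
    and g_lipschitz: "\<forall>R>0. \<exists>lg>0.
          \<forall>(z1, w1) \<in> state_space (max_delay t0 T \<tau>). \<forall>(z2, w2) \<in> state_space (max_delay t0 T \<tau>).
            w1 \<in> Lip_ball (max_delay t0 T \<tau>) R \<longrightarrow> w2 \<in> Lip_ball (max_delay t0 T \<tau>) R \<longrightarrow>
            \<bar>g z1 w1 - g z2 w2\<bar>
              \<le> lg * state_norm (max_delay t0 T \<tau>) (z1 - z2) (\<lambda>\<theta>. w1 \<theta> - w2 \<theta>)"
    and monotone_delay: "\<forall>r>0. \<exists>d>0. \<forall>t\<in>{t0..<T}. \<forall>w \<in> Lip_ball (max_delay t0 T \<tau>) r.
          \<forall>\<alpha> \<in> controls A t T. \<forall>x. is_trajectory (max_delay t0 T \<tau>) T f \<tau> t w \<alpha> x \<longrightarrow>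
            (AE s in lebesgue_on {t..T}.
               1 - \<tau>\<^sub>t t0 T \<tau> s (x s) - \<tau>\<^sub>z \<tau> s (x s) \<bullet> vector_derivative x (at s) \<ge> d)"
    and f_C1: "C1_uniformly {t0..T} A f"
    and L_C1: "C1_uniformly {t0..T} A L"

end

theory Submission
  imports Defs
begin

text \<open>
  Fix \<open>l > 0\<close> and \<open>\<theta>\<close>. For small \<open>h > 0\<close> follow the polygonal extension of \<open>x\<^sub>t\<close> up to time
  \<open>e = t + h * l\<close> and from there on the trajectory \<open>Y\<close> generated by the same control \<open>\<alpha>\<close>. By dynamic
  programming \<open>\<alpha>\<close> stays optimal for \<open>(t, x\<^sub>t)\<close>, so the increment of the value function is at most the
  difference of the two costs. The deviation \<open>\<delta> = Y - x\<close> vanishes before \<open>t\<close> and is of order \<open>h\<close>.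
  Writing \<open>p T \<bullet> \<delta> T\<close> as the integral of \<open>(p \<bullet> \<delta>)'\<close>, inserting the adjoint equation, and turning
  the term with the advanced argument back into one with the delayed argument by the substitution
  \<open>r = D s\<close>, all first-order terms on \<open>(e, T)\<close> cancel: the integrand, divided by \<open>h\<close>, is bounded
  and tends to \<open>0\<close> almost everywhere. What is left is the integral of
  \<open>p \<bullet> \<theta> / l - f \<bullet> p - L\<close> over \<open>[t, e]\<close>, which is
  \<open>h * (p t \<bullet> \<theta> - l * (f \<bullet> p + L)) + o(h)\<close> by continuity of \<open>\<alpha>\<close> at \<open>t\<close>, and
  \<open>f \<bullet> p + L\<close> at \<open>\<alpha> t\<close> is at least the Hamiltonian.

  The a.e. differentiability of Lipschitz functions of one real variable is needed twice: to solve
  the state equation with a measurable control, and to differentiate \<open>x\<close> at \<open>D s\<close>, which may lie in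
  the initial history.
\<close>

section \<open>Lipschitz functions of one variable are differentiable almost everywhere\<close>

text \<open>The delay depends on the state, so \<open>Y\<close> and \<open>x\<close> are delayed to
  different times. Moving \<open>x\<close> from one delayed time to the other costs its derivative
  at \<open>D s\<close>, which accounts for the terms with \<open>\<tau>\<^sub>z\<close> in the
  adjoint equation. Moving \<open>\<delta>\<close> must cost only o(h): it does, because
  \<open>\<delta>\<close> vanishes before \<open>t\<close> and beyond \<open>e\<close> is Lipschitz
  with a constant that is itself of order h. Between \<open>t\<close> and \<open>e\<close> the slope
  of \<open>\<delta>\<close> is of order one, but almost every \<open>s\<close> has
  \<open>D s \<noteq> t\<close>, so its delayed times avoid this short interval once h is small.
  Bounds uniform in h come from stability estimates that use the Lipschitz constant of
  \<open>x\<close> and never that of \<open>Y\<close>. The null sets off which the derivatives exist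
  change with h. Limits are therefore taken along sequences, where countably many null sets can be
  discarded together.\<close>

lemma sum_increments_le:
  fixes H :: "real \<Rightarrow> real"
  assumes "finite F" and mono: "\<And>x y. x \<le> y \<Longrightarrow> H x \<le> H y"
    and "\<And>i. i \<in> F \<Longrightarrow> u \<le> c i \<and> c i \<le> d i \<and> d i \<le> v"
    and "pairwise (\<lambda>i j. disjnt {c i..d i} {c j..d j}) F" and "u \<le> v"
  shows "(\<Sum>i\<in>F. H (d i) - H (c i)) \<le> H v - H u"
  using assms(1,3-)
\<comment> \<open>The induction inserts the interval with the largest left end point. By
  disjointness all others end before it, so the induction hypothesis applies with \<open>v\<close>
  replaced by \<open>c i\<close>. The rule does not make the inserted index new, hence the case
  \<open>i \<in> F\<close>.\<close>
proof (induction F arbitrary: v rule: finite_ranking_induct[where f = c])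
  case empty
  then show ?case using mono by simp
next
  case (insert i F)
  have i: "u \<le> c i" "c i \<le> d i" "d i \<le> v" using insert.prems by auto
  show ?case
  proof (cases "i \<in> F")
    case True
    then show ?thesis using insert by (simp add: insert_absorb)
  next
    case False
    have "d j \<le> c i" if "j \<in> F" for j
    proof (rule ccontr)
      assume "\<not> d j \<le> c i"
      then have "c i \<in> {c i..d i} \<inter> {c j..d j}" using insert.hyps(2)[OF that] i by auto
      moreover have "disjnt {c i..d i} {c j..d j}"
        using insert.prems(2) that False by (auto simp: pairwise_insert)
      ultimately show False by (auto simp: disjnt_def)
    qed
    then have "(\<Sum>i\<in>F. H (d i) - H (c i)) \<le> H (c i) - H u"
      using insert.prems i by (intro insert.IH) (auto simp: pairwise_insert)
    then show ?thesis
      using False insert.hyps(1) mono[OF i(3)] by simp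
  qed
qed

text \<open>The covering theorem yields countably many disjoint balls exhausting \<open>E\<close> up
  to a null set; finitely many of them already capture all but \<open>e\<close> of its measure. The
  predicate \<open>P\<close> travels with centre and radius, so that a slope condition can be
  imposed on the selected intervals.\<close>

lemma Vitali_covering_finite:
  fixes E U :: "real set"
  assumes E: "E \<in> lmeasurable" and U: "open U" "E \<subseteq> U" and "e > 0"
    and fine: "\<And>x d. x \<in> E \<Longrightarrow> 0 < d \<Longrightarrow> \<exists>c r. 0 < r \<and> r < d \<and> x \<in> cball c r \<and> P c r"
  obtains F where "finite F" "\<And>i. i \<in> F \<Longrightarrow> 0 < snd i \<and> cball (fst i) (snd i) \<subseteq> U \<and> P (fst i) (snd i)"
    "pairwise (\<lambda>i j. disjnt (cball (fst i) (snd i)) (cball (fst j) (snd j))) F"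
    "measure lebesgue (E \<inter> (\<Union>i\<in>F. cball (fst i) (snd i))) > measure lebesgue E - e"
proof -
  let ?K = "{i. 0 < snd i \<and> cball (fst i) (snd i) \<subseteq> U \<and> P (fst i) (snd i)}"
  have fine': "\<exists>i. i \<in> ?K \<and> x \<in> cball (fst i) (snd i) \<and> snd i < d" if x: "x \<in> E" and d: "0 < d" for x d
  proof -
    obtain k where k: "k > 0" "cball x k \<subseteq> U"
      using U x by (meson open_contains_cball subsetD)
    \<comment> \<open>\<open>x\<close> need not be the centre: a ball of radius below
      \<open>k/2\<close> that contains \<open>x\<close> has diameter below \<open>k\<close> and
      stays in \<open>cball x k\<close>.\<close>
    obtain c r where cr: "0 < r" "r < min d (k/2)" "x \<in> cball c r" "P c r"
      using fine[OF x, of "min d (k/2)"] d k by auto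
    have "cball c r \<subseteq> cball x k"
      using cr by (auto simp: dist_real_def)
    then show ?thesis using cr k by (intro exI[of _ "(c,r)"]) auto
  qed
  obtain C where C: "countable C" "C \<subseteq> ?K"
     "pairwise (\<lambda>i j. disjnt (cball (fst i) (snd i)) (cball (fst j) (snd j))) C"
     "negligible (E - (\<Union>i\<in>C. cball (fst i) (snd i)))"
    using Vitali_covering_theorem_cballs[where K = ?K and r = snd and S = E and a = fst, OF _ fine'] by (metis (lifting) mem_Collect_eq)
  let ?D = "(\<lambda>i. E \<inter> cball (fst i) (snd i)) ` C"
  obtain D' where D': "D' \<subseteq> ?D" "finite D'"
    "measure lebesgue (\<Union>?D) - e < measure lebesgue (\<Union>D')"
  proof (rule measure_countable_Union_approachable[of ?D e "measure lebesgue E"])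
    show "measure lebesgue (\<Union>D') \<le> measure lebesgue E" if "D' \<subseteq> ?D" "finite D'" for D'
      using that by (intro measure_mono_fmeasurable E fmeasurableD)
        (auto intro!: fmeasurable.finite_Union  fmeasurable_Int_fmeasurable E)
  qed (use C E \<open>e > 0\<close> in \<open>auto intro!: fmeasurable_Int_fmeasurable\<close>)
  obtain F where F: "F \<subseteq> C" "finite F" "D' = (\<lambda>i. E \<inter> cball (fst i) (snd i)) ` F"
    using finite_subset_image[OF D'(2,1)] by auto
  have "measure lebesgue (\<Union>?D) = measure lebesgue E"
  proof (rule measure_negligible_symdiff)
    show "negligible (E - \<Union>?D \<union> (\<Union>?D - E))"
      using C(4) by (rule negligible_subset) auto
  qed (use E in auto)
  then have "measure lebesgue (\<Union>D') > measure lebesgue E - e" using D' by simp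
  moreover have "\<Union>D' = E \<inter> (\<Union>i\<in>F. cball (fst i) (snd i))" using F by auto
  ultimately show thesis
    using F C by (intro that[of F]) (auto intro: pairwise_subset)
qed

text \<open>
  A Vitali cover by intervals of slope less than \<open>- \<eta>\<close> contains, up to small measure, a Vitali cover by
  intervals of slope greater than \<open>\<eta>\<close>; the Lipschitz bound controls what is left over.
\<close>

lemma negligible_oscillating_slopes:
  fixes G :: "real \<Rightarrow> real"
  assumes lip: "K-lipschitz_on UNIV G" and "\<eta> > 0"
  shows "negligible {x. (\<forall>d>0. \<exists>h. 0 < \<bar>h\<bar> \<and> \<bar>h\<bar> < d \<and> (G (x + h) - G x) / h < - \<eta>) \<and>
                        (\<forall>d>0. \<exists>h. 0 < \<bar>h\<bar> \<and> \<bar>h\<bar> < d \<and> (G (x + h) - G x) / h > \<eta>)}"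
    (is "negligible ?E")
proof -
  have K: "K \<ge> 0" using lip by (rule lipschitz_on_nonneg)
  have cont: "continuous_on UNIV G" using lip by (rule lipschitz_on_continuous_on)
  have cont': "continuous_on UNIV (\<lambda>x. (G (x + h) - G x) / h)" for h
  proof -
    have "continuous_on UNIV (\<lambda>x. G (x + h))"
      by (rule continuous_on_compose2[OF cont]) (auto intro!: continuous_intros)
    then show ?thesis unfolding divide_inverse by (intro continuous_intros cont)
  qed
  let ?h = "\<lambda>n::nat. {h::real. 0 < \<bar>h\<bar> \<and> \<bar>h\<bar> < 1 / Suc n}"
  \<comment> \<open>Scales \<open>1 / Suc n\<close> suffice, and for fixed \<open>h\<close> the
    slope condition is open in \<open>x\<close>. The set is thus a countable intersection of open
    sets, hence Borel.\<close>
  have eqE: "?E = (\<Inter>n. (\<Union>h\<in>?h n. {x. (G (x + h) - G x) / h < - \<eta>}) \<inter>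
                     (\<Union>h\<in>?h n. {x. \<eta> < (G (x + h) - G x) / h}))" (is "_ = ?R")
  proof
    show "?R \<subseteq> ?E"
    proof
      fix x assume x: "x \<in> ?R"
      show "x \<in> ?E"
      proof (simp, intro conjI allI impI)
        fix d :: real assume "d > 0"
        then obtain n where n: "1 / Suc n < d" using nat_approx_posE by blast
        have "x \<in> (\<Union>h\<in>?h n. {x. (G (x + h) - G x) / h < - \<eta>}) \<inter>
                     (\<Union>h\<in>?h n. {x. \<eta> < (G (x + h) - G x) / h})" using x by blast
        then have "(\<exists>h\<in>?h n. (G (x + h) - G x) / h < - \<eta>) \<and> (\<exists>h\<in>?h n. \<eta> < (G (x + h) - G x) / h)"
          by blast
        moreover have "h \<in> ?h n \<Longrightarrow> h \<noteq> 0 \<and> \<bar>h\<bar> < d" for h using n by auto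
        ultimately show "\<exists>h. h \<noteq> 0 \<and> \<bar>h\<bar> < d \<and> (G (x + h) - G x) / h < - \<eta>"
          "\<exists>h. h \<noteq> 0 \<and> \<bar>h\<bar> < d \<and> (G (x + h) - G x) / h > \<eta>"
          by blast+
      qed
    qed
    show "?E \<subseteq> ?R"
    proof (rule subsetI, rule INT_I)
      fix x n assume x: "x \<in> ?E"
      have "1 / real (Suc n) > 0" by simp
      then show "x \<in> (\<Union>h\<in>?h n. {x. (G (x + h) - G x) / h < - \<eta>}) \<inter>
                     (\<Union>h\<in>?h n. {x. \<eta> < (G (x + h) - G x) / h})"
        using x by blast
    qed
  qed
  have op: "open (\<Union>h\<in>?h n. {x. (G (x + h) - G x) / h < - \<eta>})"
    "open (\<Union>h\<in>?h n. {x. \<eta> < (G (x + h) - G x) / h})" for n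
    using cont' by (auto intro!: open_Collect_less continuous_on_const)
  have "?E \<in> sets borel" unfolding eqE
  proof (rule sets.countable_INT'')
    show "(\<Union>h\<in>?h n. {x. (G (x + h) - G x) / h < - \<eta>}) \<inter>
                     (\<Union>h\<in>?h n. {x. \<eta> < (G (x + h) - G x) / h}) \<in> sets borel" for n
      by (intro sets.Int borel_open op)
  qed simp_all
  then have Eb: "?E \<in> sets lebesgue" by (intro sets_completionI_sets) (simp only: sets_lborel)
  show ?thesis
  proof (subst negligible_on_intervals, intro allI, rule ccontr)
    fix a b :: real
    define E where "E = ?E \<inter> cbox a b"
    assume nn: "\<not> negligible (?E \<inter> cbox a b)"
    have Em: "E \<in> lmeasurable" unfolding E_def
      by (subst Int_commute, rule fmeasurable_Int_fmeasurable[OF lmeasurable_cbox Eb])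
    define m where "m = measure lebesgue E"
    have m: "m > 0" using nn Em unfolding E_def[symmetric] m_def
      by (simp add: negligible_iff_measure zero_less_measure_iff)
    \<comment> \<open>Chosen so that the estimate reached at the end,
      \<open>2 * (\<eta> * m) \<le> e * (3 * K + 3 * \<eta>)\<close>, reads
      \<open>2 * (\<eta> * m) \<le> \<eta> * m\<close>.\<close>
    define e where "e = \<eta> * m / (3 * K + 3 * \<eta>)"
    have e: "e > 0" using m K \<open>\<eta> > 0\<close> by (simp add: e_def)
    obtain U where U: "open U" "E \<subseteq> U" "U - E \<in> lmeasurable" "emeasure lebesgue (U - E) < ennreal e"
      using sets_lebesgue_outer_open[OF fmeasurableD[OF Em] e] by blast
    have Um: "U \<in> lmeasurable"
      using fmeasurable.Un[OF U(3) Em] U(2) by (simp add: Un_absorb2)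
    have mU: "measure lebesgue U \<le> m + e"
    proof -
      have "measure lebesgue U = measure lebesgue (U - E) + m"
        unfolding m_def using measure_Un2[OF Em Um] U(2)
        by (simp add: Un_absorb1)
      moreover have "measure lebesgue (U - E) < e"
        using U(3,4) by (simp add: emeasure_eq_measure2 e ennreal_less_iff)
      ultimately show ?thesis by simp
    qed
    \<comment> \<open>The interval between \<open>x\<close> and \<open>x + h\<close>, for either
      sign of \<open>h\<close>, rewritten as a centred ball, the form that the covering lemma
      needs.\<close>
    have ex_ball: "\<exists>c r. 0 < r \<and> r < d \<and> x \<in> cball c r \<and> 2 * r = \<bar>h\<bar> \<and> G (c + r) - G (c - r) = 2 * r * ((G (x + h) - G x) / h)"
      if "0 < \<bar>h\<bar>" "\<bar>h\<bar> < d" for x h d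
    proof (cases "h > 0")
      case True
      then show ?thesis using that
        by - (rule exI[of _ "x + h/2"], rule exI[of _ "h/2"], auto simp: dist_real_def add_divide_distrib[symmetric] add.commute)
    next
      case False
      then show ?thesis using that
        by - (rule exI[of _ "x + h/2"], rule exI[of _ "-h/2"], auto simp: dist_real_def add.commute)
    qed
    let ?P = "\<lambda>c r. G (c + r) - G (c - r) < - \<eta> * (2 * r)"
    have fineP: "\<exists>c r. 0 < r \<and> r < d \<and> x \<in> cball c r \<and> ?P c r" if x: "x \<in> E" "0 < d" for x d
    proof -
      obtain h where h: "0 < \<bar>h\<bar>" "\<bar>h\<bar> < d" "(G (x + h) - G x) / h < - \<eta>"
        using x unfolding E_def by blast
      obtain c r where cr: "0 < r" "r < d" "x \<in> cball c r" "2 * r = \<bar>h\<bar>"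
        "G (c + r) - G (c - r) = 2 * r * ((G (x + h) - G x) / h)"
        using ex_ball[OF h(1,2)] by blast
      have "2 * r * ((G (x + h) - G x) / h) < 2 * r * (- \<eta>)"
        using cr(1) h(3) by (intro mult_strict_left_mono) auto
      then have "?P c r" unfolding cr(5) by (simp add: mult.commute)
      then show ?thesis using cr by blast
    qed
    obtain F1 where F1: "finite F1"
      "\<And>i. i \<in> F1 \<Longrightarrow> 0 < snd i \<and> cball (fst i) (snd i) \<subseteq> U \<and> ?P (fst i) (snd i)"
      "pairwise (\<lambda>i j. disjnt (cball (fst i) (snd i)) (cball (fst j) (snd j))) F1"
      "measure lebesgue (E \<inter> (\<Union>i\<in>F1. cball (fst i) (snd i))) > measure lebesgue E - e"
      using Vitali_covering_finite[of E U e ?P, OF Em U(1,2) e fineP] by blast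
    \<comment> \<open>Open balls, so that every point of \<open>W\<close> has room around it for the
      second, finer cover; the spheres left out are null.\<close>
    define W where "W = (\<Union>i\<in>F1. ball (fst i) (snd i))"
    have E2m: "E \<inter> W \<in> lmeasurable" unfolding W_def
      by (intro fmeasurable_Int_fmeasurable Em sets.finite_UN F1) auto
    have mE2: "measure lebesgue (E \<inter> W) > m - e"
    proof -
      have "measure lebesgue (E \<inter> W) = measure lebesgue (E \<inter> (\<Union>i\<in>F1. cball (fst i) (snd i)))"
      proof (rule measure_negligible_symdiff)
        have "negligible (\<Union>i\<in>F1. sphere (fst i) (snd i))"
          by (intro negligible_Union finite_imageI F1(1)) (auto simp: negligible_sphere)
        then show "negligible (E \<inter> (\<Union>i\<in>F1. cball (fst i) (snd i)) - E \<inter> W \<union>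
           (E \<inter> W - E \<inter> (\<Union>i\<in>F1. cball (fst i) (snd i))))"
          by (rule negligible_subset) (force simp: W_def)
        show "E \<inter> (\<Union>i\<in>F1. cball (fst i) (snd i)) \<in> lmeasurable"
          by (intro fmeasurable_Int_fmeasurable Em sets.finite_UN F1) auto
      qed
      then show ?thesis using F1(4) by (simp add: m_def)
    qed
    let ?Q = "\<lambda>c r. G (c + r) - G (c - r) > \<eta> * (2 * r) \<and> (\<exists>i\<in>F1. cball c r \<subseteq> cball (fst i) (snd i))"
    have fineQ: "\<exists>c r. 0 < r \<and> r < d \<and> x \<in> cball c r \<and> ?Q c r" if x: "x \<in> E \<inter> W" "0 < d" for x d
    proof -
      obtain i where i: "i \<in> F1" "x \<in> ball (fst i) (snd i)" using x unfolding W_def by auto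
      obtain k where k: "k > 0" "cball x k \<subseteq> ball (fst i) (snd i)"
        using i(2) open_contains_cball[of "ball (fst i) (snd i)"] open_ball by blast
      obtain h where h: "0 < \<bar>h\<bar>" "\<bar>h\<bar> < min d k" "(G (x + h) - G x) / h > \<eta>"
      proof -
        have "min d k > 0" using x k by simp
        then show ?thesis using x that unfolding E_def by blast
      qed
      obtain c r where cr: "0 < r" "r < min d k" "x \<in> cball c r" "2 * r = \<bar>h\<bar>"
        "G (c + r) - G (c - r) = 2 * r * ((G (x + h) - G x) / h)"
        using ex_ball[OF h(1,2)] by blast
      have "2 * r * ((G (x + h) - G x) / h) > 2 * r * \<eta>"
        using cr(1) h(3) by (intro mult_strict_left_mono) auto
      moreover have "cball c r \<subseteq> cball x k" using cr h by (auto simp: dist_real_def)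
      then have "cball c r \<subseteq> cball (fst i) (snd i)" using k by (meson ball_subset_cball order_trans)
      ultimately have "?Q c r" unfolding cr(5) using i by (auto simp: mult.commute)
      moreover have "r < d" using cr by simp
      ultimately show ?thesis using cr(1,3) by blast
    qed
    have openW: "open W" unfolding W_def by auto
    obtain F2 where F2: "finite F2"
      "\<And>i. i \<in> F2 \<Longrightarrow> 0 < snd i \<and> cball (fst i) (snd i) \<subseteq> W \<and> ?Q (fst i) (snd i)"
      "pairwise (\<lambda>i j. disjnt (cball (fst i) (snd i)) (cball (fst j) (snd j))) F2"
      "measure lebesgue (E \<inter> W \<inter> (\<Union>i\<in>F2. cball (fst i) (snd i))) > measure lebesgue (E \<inter> W) - e"
      using Vitali_covering_finite[of "E \<inter> W" W e ?Q, OF E2m openW _ e fineQ] by blast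
    have meas_F: "measure lebesgue (\<Union>i\<in>F. cball (fst i) (snd i)) = (\<Sum>i\<in>F. 2 * snd i)"
      if "finite F" "\<And>i. i \<in> F \<Longrightarrow> 0 < snd i"
        "pairwise (\<lambda>i j. disjnt (cball (fst i) (snd i)) (cball (fst j) (snd j))) F"
      for F :: "(real \<times> real) set"
    proof -
      have "measure lebesgue (\<Union>i\<in>F. cball (fst i) (snd i)) = (\<Sum>i\<in>F. measure lebesgue (cball (fst i) (snd i)))"
        using that by (intro measure_UNION') auto
      also have "\<dots> = (\<Sum>i\<in>F. 2 * snd i)"
        using that by (intro sum.cong) (auto simp: cball_eq_atLeastAtMost dest: less_imp_le)
      finally show ?thesis .
    qed
    have lmF: "(\<Union>i\<in>F. cball (fst i) (snd i)) \<in> lmeasurable" if "finite F" for F :: "(real \<times> real) set"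
      using that by (intro fmeasurable.finite_UN) auto
    define S1 where "S1 = (\<Sum>i\<in>F1. 2 * snd i)"
    define S2 where "S2 = (\<Sum>i\<in>F2. 2 * snd i)"
    have S1: "S1 = measure lebesgue (\<Union>i\<in>F1. cball (fst i) (snd i))"
      unfolding S1_def using F1 meas_F[of F1] by simp
    have S2: "S2 = measure lebesgue (\<Union>i\<in>F2. cball (fst i) (snd i))"
      unfolding S2_def using F2 meas_F[of F2] by simp
    have "S1 \<le> measure lebesgue U" unfolding S1
      using F1(2) by (intro measure_mono_fmeasurable Um fmeasurableD lmF F1(1)) auto
    then have S1_le: "S1 \<le> m + e" using mU by simp
    have "m - e < measure lebesgue (E \<inter> (\<Union>i\<in>F1. cball (fst i) (snd i)))"
      using F1(4) by (simp add: m_def)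
    also have "\<dots> \<le> S1" unfolding S1
      by (intro measure_mono_fmeasurable lmF F1 fmeasurableD fmeasurable_Int_fmeasurable Em) auto
    finally have S1_ge: "S1 \<ge> m - e" by simp
    have "m - 2 * e < measure lebesgue (E \<inter> W \<inter> (\<Union>i\<in>F2. cball (fst i) (snd i)))"
      using F2(4) mE2 by (simp add: m_def)
    also have "\<dots> \<le> S2" unfolding S2
      by (intro measure_mono_fmeasurable lmF F2 fmeasurableD fmeasurable_Int_fmeasurable E2m) auto
    finally have S2_ge: "S2 \<ge> m - 2 * e" by simp
    \<comment> \<open>Assigns to each ball of the second family one ball of the first that contains
      it.\<close>
    define \<phi> where "\<phi> j = (SOME i. i \<in> F1 \<and> cball (fst j) (snd j) \<subseteq> cball (fst i) (snd i))" for j :: "real \<times> real"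
    have \<phi>: "\<phi> j \<in> F1 \<and> cball (fst j) (snd j) \<subseteq> cball (fst (\<phi> j)) (snd (\<phi> j))" if "j \<in> F2" for j
      unfolding \<phi>_def by (rule someI_ex) (use F2(2)[OF that] in blast)
    \<comment> \<open>Adding \<open>K * x\<close> makes \<open>G\<close> nondecreasing, so the
      increments over disjoint subintervals add up to at most the increment over the interval
      containing them.\<close>
    define H where "H x = G x + K * x" for x
    have H_mono: "H x \<le> H y" if "x \<le> y" for x y
    proof -
      have "\<bar>G x - G y\<bar> \<le> K * \<bar>x - y\<bar>" using lip by (auto simp: lipschitz_on_def dist_real_def)
      then show ?thesis using that by (auto simp: H_def algebra_simps abs_le_iff abs_if split: if_splits)
    qed
    have group: "(\<Sum>j\<in>{j\<in>F2. \<phi> j = i}. H (fst j + snd j) - H (fst j - snd j)) \<le> H (fst i + snd i) - H (fst i - snd i)"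
      if "i \<in> F1" for i
    proof (rule sum_increments_le[where H = H and c = "\<lambda>j. fst j - snd j" and d = "\<lambda>j. fst j + snd j"])
      have *: "0 < snd j \<and> cball (fst j) (snd j) \<subseteq> cball (fst i) (snd i)" if "j \<in> {j\<in>F2. \<phi> j = i}" for j
        using F2(2)[of j] \<phi>[of j] that by blast
      show "fst i - snd i \<le> fst j - snd j \<and> fst j - snd j \<le> fst j + snd j \<and> fst j + snd j \<le> fst i + snd i"
        if "j \<in> {j\<in>F2. \<phi> j = i}" for j
        using *[OF that] unfolding cball_eq_atLeastAtMost by auto
      show "pairwise (\<lambda>i j. disjnt {fst i - snd i..fst i + snd i} {fst j - snd j..fst j + snd j}) {j\<in>F2. \<phi> j = i}"
        using F2(3) by (auto simp: cball_eq_atLeastAtMost pairwise_def)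
      show "fst i - snd i \<le> fst i + snd i" using F1(2)[OF that] by auto
    qed (use F2(1) H_mono in auto)
    \<comment> \<open>On the second family \<open>H\<close> rises with slope above
      \<open>\<eta> + K\<close>, on the first with slope below \<open>K - \<eta>\<close>. Both total
      lengths are close to \<open>m\<close>, which is incompatible.\<close>
    have "(\<eta> + K) * S2 \<le> (\<Sum>j\<in>F2. H (fst j + snd j) - H (fst j - snd j))"
      unfolding S2_def sum_distrib_left
    proof (rule sum_mono)
      fix j assume "j \<in> F2"
      then show "(\<eta> + K) * (2 * snd j) \<le> H (fst j + snd j) - H (fst j - snd j)"
        using F2(2)[of j] by (simp add: H_def algebra_simps)
    qed
    also have "\<dots> = (\<Sum>i\<in>F1. \<Sum>j\<in>{j\<in>F2. \<phi> j = i}. H (fst j + snd j) - H (fst j - snd j))"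
      using \<phi> by (intro sum.group[symmetric] F1 F2) auto
    also have "\<dots> \<le> (\<Sum>i\<in>F1. H (fst i + snd i) - H (fst i - snd i))"
      by (intro sum_mono group)
    also have "\<dots> \<le> (K - \<eta>) * S1"
      unfolding S1_def sum_distrib_left
    proof (rule sum_mono)
      fix j assume "j \<in> F1"
      then show "H (fst j + snd j) - H (fst j - snd j) \<le> (K - \<eta>) * (2 * snd j)"
        using F1(2)[of j] by (simp add: H_def algebra_simps)
    qed
    finally have "(\<eta> + K) * S2 \<le> (K - \<eta>) * S1" .
    moreover have "(\<eta> + K) * S2 \<ge> (\<eta> + K) * (m - 2 * e)" using S2_ge K \<open>\<eta> > 0\<close> by (intro mult_left_mono) auto
    moreover have "K * S1 \<le> K * (m + e)" using S1_le K by (intro mult_left_mono) auto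
    moreover have "\<eta> * S1 \<ge> \<eta> * (m - e)" using S1_ge \<open>\<eta> > 0\<close> by (intro mult_left_mono) auto
    ultimately have "2 * (\<eta> * m) \<le> e * (3 * K + 3 * \<eta>)" by (simp add: algebra_simps)
    also have "\<dots> = \<eta> * m" using K \<open>\<eta> > 0\<close> by (simp add: e_def)
    finally show False using m \<open>\<eta> > 0\<close> by (simp add: mult_le_0_iff)
  qed
qed

text \<open>Where \<open>F\<close> is not differentiable, the lower and the upper limit of the
  difference quotient differ, both being finite by the Lipschitz bound. Two rationals between them
  give a slope \<open>c\<close> and a half gap \<open>\<eta>\<close> such that \<open>F\<close>
  minus the line of slope \<open>c\<close> oscillates beyond \<open>\<eta>\<close> in both
  directions. Countably many pairs cover all cases.\<close>

lemma lipschitz_UNIV_differentiable_ae: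
  fixes F :: "real \<Rightarrow> real"
  assumes lip: "K-lipschitz_on UNIV F"
  shows "negligible {x. \<not> F differentiable (at x)}"
proof -
  define E where "E c \<eta> = {x. (\<forall>d>0. \<exists>h. 0 < \<bar>h\<bar> \<and> \<bar>h\<bar> < d \<and> ((F (x + h) - c * (x + h)) - (F x - c * x)) / h < - \<eta>) \<and>
        (\<forall>d>0. \<exists>h. 0 < \<bar>h\<bar> \<and> \<bar>h\<bar> < d \<and> ((F (x + h) - c * (x + h)) - (F x - c * x)) / h > \<eta>)}" for c \<eta> :: real
  have neg: "negligible (E c \<eta>)" if "\<eta> > 0" for c \<eta>
    unfolding E_def
  proof (rule negligible_oscillating_slopes[OF _ that])
    have "\<bar>c\<bar>-lipschitz_on UNIV (\<lambda>x. c * x)"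
      by (auto simp: lipschitz_on_def dist_real_def abs_mult right_diff_distrib[symmetric])
    then show "(K + \<bar>c\<bar>)-lipschitz_on UNIV (\<lambda>x. F x - c * x)"
      using lip by (rule lipschitz_on_diff[rotated])
  qed
  let ?I = "(\<lambda>(c, \<eta>). E (of_rat c) (of_rat \<eta>)) ` {(c::rat, \<eta>::rat). \<eta> > 0}"
  have "negligible (\<Union>?I)"
    by (rule negligible_countable_Union) (auto intro!: neg)
  moreover have "{x. \<not> F differentiable (at x)} \<subseteq> \<Union>?I"
  proof (rule subsetI, rule ccontr)
    fix x assume x: "x \<in> {x. \<not> F differentiable (at x)}" "x \<notin> \<Union>?I"
    define q where "q h = (F (x + h) - F x) / h" for h
    have q: "\<bar>q h\<bar> \<le> K" if "h \<noteq> 0" for h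
    proof -
      have "\<bar>F (x + h) - F x\<bar> \<le> K * \<bar>h\<bar>" using lip[unfolded lipschitz_on_def dist_real_def] by (metis UNIV_I add_diff_cancel_left')
      then show ?thesis using that by (simp add: q_def divide_le_eq)
    qed
    have ev: "eventually (\<lambda>h. \<bar>q h\<bar> \<le> K) (at 0)"
      using q by (auto simp: eventually_at_filter)
    define l u where "l = Liminf (at 0) (\<lambda>h. ereal (q h))" and "u = Limsup (at 0) (\<lambda>h. ereal (q h))"
    have "l \<le> u" unfolding l_def u_def by (rule Liminf_le_Limsup) simp
    have "ereal (-K) \<le> l" unfolding l_def
      by (rule Liminf_bounded) (use ev in \<open>auto elim: eventually_mono\<close>)
    moreover have "u \<le> ereal K" unfolding u_def
      by (rule Limsup_bounded) (use ev in \<open>auto elim: eventually_mono\<close>)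
    ultimately obtain l' u' where lu: "l = ereal l'" "u = ereal u'"
      using \<open>l \<le> u\<close> by (cases l; cases u) auto
    have "\<not> l < u"
    proof
      assume "l < u"
      then have "l' < u'" by (simp add: lu)
      then obtain a1 where a1: "l' < of_rat a1" "of_rat a1 < u'" using of_rat_dense by blast
      then obtain a2 where a2: "of_rat a1 < (of_rat a2 :: real)" "of_rat a2 < u'" using of_rat_dense by blast
      \<comment> \<open>Quotients below \<open>a1 = c - \<eta>\<close> and above
        \<open>a2 = c + \<eta>\<close> become slopes below \<open>- \<eta>\<close> and above
        \<open>\<eta>\<close> once the line is subtracted.\<close>
      define c where "c = (a1 + a2) / 2"
      define \<eta> where "\<eta> = (a2 - a1) / 2"
      have "\<eta> > 0" using a2 by (simp add: \<eta>_def of_rat_less)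
      have 1: "of_rat c - of_rat \<eta> = (of_rat a1 :: real)" "of_rat c + of_rat \<eta> = (of_rat a2 :: real)"
      proof -
        have "c - \<eta> = a1" "c + \<eta> = a2" by (simp_all add: c_def \<eta>_def field_simps)
        then show "of_rat c - of_rat \<eta> = (of_rat a1 :: real)" "of_rat c + of_rat \<eta> = (of_rat a2 :: real)"
          by (metis of_rat_diff, metis of_rat_add)
      qed
      have f1: "frequently (\<lambda>h. q h < of_rat a1) (at 0)"
      proof (rule ccontr)
        assume "\<not> ?thesis"
        then have "eventually (\<lambda>h. ereal (of_rat a1) \<le> ereal (q h)) (at 0)"
          by (simp add: not_frequently not_less)
        then have "ereal (of_rat a1) \<le> l" unfolding l_def by (rule Liminf_bounded)
        then show False using a1 lu by simp
      qed
      have f2: "frequently (\<lambda>h. q h > of_rat a2) (at 0)"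
      proof (rule ccontr)
        assume "\<not> ?thesis"
        then have "eventually (\<lambda>h. ereal (of_rat a2) \<ge> ereal (q h)) (at 0)"
          by (simp add: not_frequently not_less)
        then have "ereal (of_rat a2) \<ge> u" unfolding u_def by (rule Limsup_bounded)
        then show False using a2 lu by simp
      qed
      have eq: "((F (x + h) - of_rat c * (x + h)) - (F x - of_rat c * x)) / h = q h - of_rat c" if "0 < \<bar>h\<bar>" for h
        using that by (simp add: q_def field_simps)
      have "x \<in> E (of_rat c) (of_rat \<eta>)"
        unfolding E_def
      proof (simp only: mem_Collect_eq, intro conjI allI impI)
        fix d :: real assume "d > 0"
        obtain h where "0 < \<bar>h\<bar>" "\<bar>h\<bar> < d" "q h < of_rat a1"
          using f1 \<open>d > 0\<close> unfolding frequently_def eventually_at by (auto simp: dist_real_def)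
        then show "\<exists>h. 0 < \<bar>h\<bar> \<and> \<bar>h\<bar> < d \<and> ((F (x + h) - of_rat c * (x + h)) - (F x - of_rat c * x)) / h < - of_rat \<eta>"
          using eq[of h] 1 by (intro exI[of _ h]) auto
        obtain h where "0 < \<bar>h\<bar>" "\<bar>h\<bar> < d" "q h > of_rat a2"
          using f2 \<open>d > 0\<close> unfolding frequently_def eventually_at by (auto simp: dist_real_def)
        then show "\<exists>h. 0 < \<bar>h\<bar> \<and> \<bar>h\<bar> < d \<and> ((F (x + h) - of_rat c * (x + h)) - (F x - of_rat c * x)) / h > of_rat \<eta>"
          using eq[of h] 1 by (intro exI[of _ h]) auto
      qed
      then show False using x(2) \<open>\<eta> > 0\<close> by auto
    qed
    then have "l = u" using \<open>l \<le> u\<close> by auto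
    then have "((\<lambda>h. ereal (q h)) \<longlongrightarrow> ereal l') (at 0)"
      using lu unfolding l_def u_def by (intro Liminf_eq_Limsup) auto
    then have "(q \<longlongrightarrow> l') (at 0)" by simp
    then have "(F has_field_derivative l') (at x)" unfolding DERIV_def q_def .
    then show False using x(1) by (auto simp: real_differentiable_def)
  qed
  ultimately show ?thesis by (rule negligible_subset)
qed

section \<open>Lipschitz functions and indefinite integrals\<close>

lemma has_vector_derivative_quotient:
  assumes "(x has_vector_derivative v) (at s)"
  shows "((\<lambda>h. (x (s + h) - x s) /\<^sub>R h) \<longlongrightarrow> v) (at 0)"
proof -
  have "((\<lambda>h. norm (x (s + h) - x s - h *\<^sub>R v) / norm h) \<longlongrightarrow> 0) (at 0)"
    using assms by (simp add: has_vector_derivative_def has_derivative_at)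
  then have "((\<lambda>h. norm ((x (s + h) - x s) /\<^sub>R h - v)) \<longlongrightarrow> 0) (at 0)"
  proof (rule tendsto_cong[THEN iffD1, rotated])
    have "norm (x (s + h) - x s - h *\<^sub>R v) / norm h = norm ((x (s + h) - x s) /\<^sub>R h - v)" if "h \<noteq> 0" for h
    proof -
      have "(x (s + h) - x s) /\<^sub>R h - v = (x (s + h) - x s - h *\<^sub>R v) /\<^sub>R h"
        using that by (simp add: algebra_simps)
      then show ?thesis by (simp add: divide_inverse mult.commute)
    qed
    then show "\<forall>\<^sub>F h in at 0. norm (x (s + h) - x s - h *\<^sub>R v) / norm h = norm ((x (s + h) - x s) /\<^sub>R h - v)"
      by (auto simp: eventually_at_filter)
  qed
  then show ?thesis by (simp add: tendsto_norm_zero_iff LIM_zero_iff)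
qed

lemma lipschitz_on_derivative_bound:
  fixes x :: "real \<Rightarrow> 'a::real_normed_vector"
  assumes lip: "C-lipschitz_on {a..b} x" and s: "s \<in> {a<..<b}" and "(x has_vector_derivative v) (at s)"
  shows "norm v \<le> C"
proof (rule tendsto_upperbound)
  show "((\<lambda>h. norm ((x (s + h) - x s) /\<^sub>R h)) \<longlongrightarrow> norm v) (at 0)"
    using assms(3) by (intro tendsto_norm has_vector_derivative_quotient)
  have "\<forall>\<^sub>F h in at 0. h \<noteq> 0 \<and> s + h \<in> {a<..<b}"
  proof (rule eventually_conj)
    have "((\<lambda>h. s + h) \<longlongrightarrow> s + 0) (at (0::real))" by (intro tendsto_intros)
    then show "\<forall>\<^sub>F h in at 0. s + h \<in> {a<..<b}"
      using s by (intro topological_tendstoD) auto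
  qed (simp add: eventually_at_filter)
  then show "\<forall>\<^sub>F h in at 0. norm ((x (s + h) - x s) /\<^sub>R h) \<le> C"
  proof (rule eventually_mono)
    fix h assume h: "h \<noteq> 0 \<and> s + h \<in> {a<..<b}"
    have "norm (x (s + h) - x s) \<le> C * \<bar>h\<bar>"
      using lipschitz_onD[OF lip, of "s + h" s] h s by (simp add: dist_norm)
    then show "norm ((x (s + h) - x s) /\<^sub>R h) \<le> C"
      using h by (simp add: divide_inverse_commute[symmetric] divide_le_eq mult.commute)
  qed
qed simp

text \<open>Constant continuation beyond both end points keeps the Lipschitz constant; it carries
  results for functions on the whole line over to intervals.\<close>

lemma lipschitz_on_clamp_real:
  fixes x :: "real \<Rightarrow> 'a::metric_space"
  assumes "C-lipschitz_on {a..b} x" "a \<le> b"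
  shows "C-lipschitz_on UNIV (\<lambda>s. x (max a (min b s)))"
proof (rule lipschitz_onI)
  fix s r :: real
  have "dist (x (max a (min b s))) (x (max a (min b r))) \<le> C * dist (max a (min b s)) (max a (min b r))"
    using assms by (intro lipschitz_onD) auto
  also have "\<dots> \<le> C * dist s r"
    using lipschitz_on_nonneg[OF assms(1)] by (intro mult_left_mono) (auto simp: dist_real_def)
  finally show "dist (x (max a (min b s))) (x (max a (min b r))) \<le> C * dist s r" .
qed (use assms lipschitz_on_nonneg in auto)

lemma lipschitz_on_differentiable_ae:
  fixes x :: "real \<Rightarrow> 'a::euclidean_space"
  assumes lip: "C-lipschitz_on {a..b} x"
  shows "negligible {s \<in> {a<..<b}. \<not> x differentiable (at s)}"
proof (cases "a \<le> b")
  case False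
  then show ?thesis by simp
next
  case True
  define X where "X s = x (max a (min b s))" for s
  have X: "C-lipschitz_on UNIV X"
    unfolding X_def using lipschitz_on_clamp_real[OF lip True] .
  have "negligible {s. \<not> (\<lambda>s. X s \<bullet> i) differentiable (at s)}" if "i \<in> Basis" for i
  proof (rule lipschitz_UNIV_differentiable_ae)
    show "C-lipschitz_on UNIV (\<lambda>s. X s \<bullet> i)"
    proof (rule lipschitz_onI)
      fix s r :: real
      have "dist (X s \<bullet> i) (X r \<bullet> i) \<le> dist (X s) (X r)"
        unfolding dist_norm real_norm_def inner_diff_left[symmetric] by (rule Basis_le_norm[OF that])
      also have "\<dots> \<le> C * dist s r" using X by (rule lipschitz_onD) auto
      finally show "dist (X s \<bullet> i) (X r \<bullet> i) \<le> C * dist s r" .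
    qed (rule lipschitz_on_nonneg[OF lip])
  qed
  then have "negligible (\<Union>i\<in>Basis. {s. \<not> (\<lambda>s. X s \<bullet> i) differentiable (at s)})"
    by (intro negligible_Union) auto
  then show ?thesis
  proof (rule negligible_subset, intro subsetI)
    fix s assume s: "s \<in> {s \<in> {a<..<b}. \<not> x differentiable (at s)}"
    have "\<not> X differentiable (at s)"
    proof
      assume "X differentiable (at s)"
      then obtain D where "(X has_derivative D) (at s)" by (auto simp: differentiable_def)
      then have "(x has_derivative D) (at s)"
        by (rule has_derivative_transform_within_open[of _ _ _ _ "{a<..<b}"]) (use s in \<open>auto simp: X_def\<close>)
      then show False using s by (auto simp: differentiable_def)
    qed
    then show "s \<in> (\<Union>i\<in>Basis. {s. \<not> (\<lambda>s. X s \<bullet> i) differentiable (at s)})"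
      by (auto simp: differentiable_componentwise_within[of X])
  qed
qed

text \<open>The integral of the difference quotient \<open>D n\<close> is a difference of two
  averages of \<open>X\<close>, next to \<open>b\<close> and next to \<open>a\<close>, which tend to
  the end point values. Dominated convergence with the Lipschitz constant as bound sends the same
  integrals to the integral of \<open>k\<close>.\<close>

lemma lipschitz_on_has_integral:
  fixes x :: "real \<Rightarrow> 'a::euclidean_space"
  assumes lip: "C-lipschitz_on {a..b} x" and "a \<le> b" and N: "negligible N"
    and der: "\<And>s. s \<in> {a<..<b} - N \<Longrightarrow> (x has_vector_derivative k s) (at s)"
  shows "(k has_integral (x b - x a)) {a..b}"
proof -
  define X where "X s = x (max a (min b s))" for s
  have X: "C-lipschitz_on UNIV X"
    unfolding X_def using lipschitz_on_clamp_real[OF lip \<open>a \<le> b\<close>] .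
  have contX: "continuous_on S X" for S
    using lipschitz_on_continuous_on[OF X] continuous_on_subset by blast
  have C: "C \<ge> 0" using X by (rule lipschitz_on_nonneg)
  \<comment> \<open>The primitive starts left of \<open>a\<close> so that it is differentiable at
    \<open>a\<close> itself; its derivative is computed up to \<open>b + 3\<close>, so that shifts
    by \<open>e n \<le> 1\<close> stay inside.\<close>
  define \<Phi> where "\<Phi> u = integral {a - 1..u} X" for u
  have \<Phi>': "(\<Phi> has_vector_derivative X u) (at u)" if "u \<in> {a-1<..<b+3}" for u
  proof -
    have "(\<Phi> has_vector_derivative X u) (at u within {a-1..b+3})"
      unfolding \<Phi>_def using that by (intro integral_has_vector_derivative contX) auto
    then show ?thesis using that at_within_Icc_at[of "a-1" u "b+3"] by simp
  qed
  define e where "e n = 1 / real (Suc n)" for n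
  have e: "0 < e n" "e n \<le> 1" for n by (auto simp: e_def)
  have e0: "filterlim e (at 0) sequentially"
    unfolding filterlim_at e_def using LIMSEQ_inverse_real_of_nat by (auto simp: inverse_eq_divide)
  define D where "D n s = (X (s + e n) - X s) /\<^sub>R e n" for n s
  have contD: "continuous_on S (D n)" for n S
    unfolding D_def by (intro continuous_intros continuous_on_compose2[OF contX[of UNIV]]) auto
  have ID: "integral {a..b} (D n) = (\<Phi> (b + e n) - \<Phi> b) /\<^sub>R e n - (\<Phi> (a + e n) - \<Phi> a) /\<^sub>R e n" for n
  proof -
    have "((\<lambda>s. X (s + e n) - X s) has_integral (\<Phi> (b + e n) - \<Phi> b) - (\<Phi> (a + e n) - \<Phi> a)) {a..b}"
    proof (rule fundamental_theorem_of_calculus[OF \<open>a \<le> b\<close>])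
      fix s assume s: "s \<in> {a..b}"
      have "((\<lambda>s. \<Phi> (s + e n)) has_vector_derivative X (s + e n)) (at s)"
      proof -
        have "((\<lambda>s. s + e n) has_vector_derivative 1) (at s)"
          by (auto intro!: derivative_eq_intros)
        then show ?thesis
          using vector_diff_chain_at[of "\<lambda>s. s + e n" 1 s \<Phi> "X (s + e n)"] \<Phi>'[of "s + e n"] s e[of n]
          by (simp add: o_def)
      qed
      then show "((\<lambda>s. \<Phi> (s + e n) - \<Phi> s) has_vector_derivative X (s + e n) - X s) (at s within {a..b})"
        using \<Phi>'[of s] s by (intro has_vector_derivative_at_within[OF has_vector_derivative_diff]) auto
    qed
    then have "(D n has_integral ((\<Phi> (b + e n) - \<Phi> b) - (\<Phi> (a + e n) - \<Phi> a)) /\<^sub>R e n) {a..b}"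
      unfolding D_def by (rule has_integral_cmul)
    then show ?thesis by (simp add: integral_unique scaleR_diff_right)
  qed
  have "(\<lambda>n. (\<Phi> (b + e n) - \<Phi> b) /\<^sub>R e n - (\<Phi> (a + e n) - \<Phi> a) /\<^sub>R e n) \<longlonglongrightarrow> X b - X a"
    using \<open>a \<le> b\<close> by (intro tendsto_diff has_vector_derivative_quotient[THEN filterlim_compose[OF _ e0]] \<Phi>') auto
  then have lim: "(\<lambda>n. integral {a..b} (D n)) \<longlonglongrightarrow> x b - x a"
    unfolding ID using \<open>a \<le> b\<close> by (simp add: X_def)
  let ?S = "{a<..<b} - N"
  have sym: "negligible {s \<in> {a..b} - ?S. f s \<noteq> 0}" "negligible {s \<in> ?S - {a..b}. f s \<noteq> 0}" for f :: "real \<Rightarrow> 'b::zero"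
  proof -
    have "negligible (N \<union> {a,b})" using N by simp
    then show "negligible {s \<in> {a..b} - ?S. f s \<noteq> 0}" by (rule negligible_subset) auto
    have "{s \<in> ?S - {a..b}. f s \<noteq> 0} = {}" by auto
    then show "negligible {s \<in> ?S - {a..b}. f s \<noteq> 0}" by (metis negligible_empty)
  qed
  have conv: "k integrable_on ?S" "(\<lambda>n. integral ?S (D n)) \<longlonglongrightarrow> integral ?S k"
  proof -
    note dc = dominated_convergence[where f = D and h = "\<lambda>_. C" and g = k and S = ?S]
    have 1: "D n integrable_on ?S" for n
      by (rule integrable_spike_set[OF integrable_continuous_interval[OF contD] sym])
    have 2: "(\<lambda>_. C) integrable_on ?S"
      by (rule integrable_spike_set[OF integrable_const_ivl sym])
    have 3: "norm (D n s) \<le> C" for n s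
    proof -
      have "norm (X (s + e n) - X s) \<le> C * e n"
        using lipschitz_onD[OF X, of "s + e n" s] e[of n] by (simp add: dist_norm)
      then show ?thesis using e[of n] by (simp add: D_def divide_inverse_commute[symmetric] divide_le_eq mult.commute)
    qed
    have 4: "(\<lambda>n. D n s) \<longlonglongrightarrow> k s" if s: "s \<in> ?S" for s
    proof -
      have "(X has_vector_derivative k s) (at s)"
        by (rule has_vector_derivative_transform_within_open[OF der[OF s], of "{a<..<b}"]) (use s in \<open>auto simp: X_def\<close>)
      then show ?thesis unfolding D_def
        by (rule has_vector_derivative_quotient[THEN filterlim_compose[OF _ e0]])
    qed
    show "k integrable_on ?S" "(\<lambda>n. integral ?S (D n)) \<longlonglongrightarrow> integral ?S k"
      using dc[OF 1 2 3 4] by auto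
  qed
  have "integral ?S (D n) = integral {a..b} (D n)" for n
    by (rule integral_spike_set[OF sym(2,1)])
  then have "integral ?S k = x b - x a"
    using LIMSEQ_unique[OF conv(2)] lim by simp
  then have "(k has_integral (x b - x a)) ?S" using conv(1) by (simp add: has_integral_iff)
  then show ?thesis using has_integral_spike_set_eq[OF sym(2,1)] by blast
qed

section \<open>Determining a function by its integrals over intervals\<close>

lemma sigma_finite_lebesgue: "sigma_finite_measure (lebesgue :: 'a::euclidean_space measure)"
proof
  obtain A :: "'a set set" where A: "countable A" "A \<subseteq> sets lborel" "\<Union>A = space lborel"
    "\<forall>a\<in>A. emeasure lborel a \<noteq> \<infinity>"
    using lborel.sigma_finite_countable by blast
  show "\<exists>A::'a set set. countable A \<and> A \<subseteq> sets lebesgue \<and> \<Union>A = space lebesgue \<and> (\<forall>a\<in>A. emeasure lebesgue a \<noteq> \<infinity>)"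
    using A by (intro exI[of _ A]) (auto simp: subset_eq)
qed

text \<open>Open intervals form an intersection-stable generator of the Borel sets, and the sets
  over which the integral vanishes are closed under complements and disjoint unions. So the integral
  vanishes over every Borel set, then over every Lebesgue set, which forces the density to be
  zero.\<close>

lemma integral_intervals_zero_imp_ae_zero:
  fixes f :: "real \<Rightarrow> 'a::euclidean_space"
  assumes f: "f absolutely_integrable_on {a..b}"
    and zero: "\<And>u v. a \<le> u \<Longrightarrow> u \<le> v \<Longrightarrow> v \<le> b \<Longrightarrow> integral {u..v} f = 0"
  shows "negligible {s \<in> {a..b}. f s \<noteq> 0}"
proof -
  let ?F = "\<lambda>s. indicator {a..b} s *\<^sub>R f s"
  have F: "integrable lebesgue ?F" using f by (simp add: set_integrable_def)
  have int: "set_integrable lebesgue A ?F" if "A \<in> sets lebesgue" for A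
    unfolding set_integrable_def by (rule integrable_mult_indicator[OF that F])
  have borel: "set_lebesgue_integral lebesgue A ?F = 0" if "A \<in> sets borel" for A
  proof -
    have "Int_stable (range (\<lambda>(u, v). box u v :: real set))"
      by (auto simp: Int_stable_def box_Int_box)
    moreover have "range (\<lambda>(u, v). box u v :: real set) \<subseteq> Pow UNIV" by auto
    moreover have "A \<in> sigma_sets UNIV (range (\<lambda>(u, v). box u v))"
      using that unfolding borel_eq_box by (simp del: box_real)
    ultimately show ?thesis
    proof (induction rule: sigma_sets_induct_disjoint)
      case (basic A)
      then obtain u v where A: "A = box u v" by auto
      have eq: "(\<lambda>s. indicator A s *\<^sub>R ?F s) = (\<lambda>s. indicator ({u<..<v} \<inter> {a..b}) s *\<^sub>R f s)"
        by (auto simp: A indicator_def)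
      have "set_lebesgue_integral lebesgue A ?F = set_lebesgue_integral lebesgue ({u<..<v} \<inter> {a..b}) f"
        unfolding set_lebesgue_integral_def eq ..
      also have "\<dots> = integral ({u<..<v} \<inter> {a..b}) f"
        by (rule set_lebesgue_integral_eq_integral(2), rule set_integrable_subset[OF f]) auto
      also have "\<dots> = integral {max a u..min b v} f"
      proof (rule integral_subset_negligible)
        show "negligible ({max a u..min b v} - {u<..<v} \<inter> {a..b})"
          by (rule negligible_subset[of "{u, v}"]) auto
      qed auto
      also have "\<dots> = 0"
      proof (cases "max a u \<le> min b v")
        case False
        then have "{max a u..min b v} = {}" by auto
        then show ?thesis by (metis integral_empty)
      qed (auto intro!: zero)
      finally show ?case .
    next
      case empty
      then show ?case by (simp add: set_lebesgue_integral_def)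
    next
      case (compl A)
      then have A: "A \<in> sets lebesgue" by (simp add: borel_eq_box)
      have "set_lebesgue_integral lebesgue (A \<union> (UNIV - A)) ?F
          = set_lebesgue_integral lebesgue A ?F + set_lebesgue_integral lebesgue (UNIV - A) ?F"
        using A by (intro set_integral_Un int) auto
      moreover have "set_lebesgue_integral lebesgue (A \<union> (UNIV - A)) ?F = set_lebesgue_integral lebesgue {a..b} f"
        by (simp add: set_lebesgue_integral_def)
      moreover have "set_lebesgue_integral lebesgue {a..b} f = 0"
        using set_lebesgue_integral_eq_integral(2)[OF f] zero[of a b] by (cases "a \<le> b") auto
      ultimately show ?case using compl by simp
    next
      case (union A)
      have A: "A i \<in> sets lebesgue" for i
        using union(2)[THEN subsetD, of "A i"] by (simp add: borel_eq_box del: box_real)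
      have "set_lebesgue_integral lebesgue (\<Union>i. A i) ?F = (\<Sum>i. set_lebesgue_integral lebesgue (A i) ?F)"
        using union(1) A by (intro lebesgue_integral_countable_add int) (auto simp: disjoint_family_on_def)
      then show ?case using union by simp
    qed
  qed
  have "set_lebesgue_integral lebesgue A ?F = 0" if "A \<in> sets lebesgue" for A
  proof -
    obtain S N N' where S: "A = S \<union> N" "N \<subseteq> N'" "N' \<in> null_sets lborel" "S \<in> sets lborel"
      by (rule sets_completionE[OF \<open>A \<in> sets lebesgue\<close>])
    have "AE s in lebesgue. s \<notin> N'"
      using S(3) by (intro AE_not_in null_sets_completionI)
    then have "AE s in lebesgue. indicator A s *\<^sub>R ?F s = indicator S s *\<^sub>R ?F s"
      by (rule AE_mp) (use S in \<open>auto intro!: AE_I2 simp: indicator_def\<close>)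
    then have "set_lebesgue_integral lebesgue A ?F = set_lebesgue_integral lebesgue S ?F"
      unfolding set_lebesgue_integral_def
      using int[OF that] int[of S] S(4) unfolding set_integrable_def
      by (intro integral_cong_AE borel_measurable_integrable) auto
    then show ?thesis using borel S(4) by simp
  qed
  then have "AE s in lebesgue. ?F s = 0" by (rule sigma_finite_measure.density_zero[OF sigma_finite_lebesgue F])
  then obtain N where "negligible N" "{s. ?F s \<noteq> 0} \<subseteq> N"
    unfolding eventually_ae_filter_negligible by auto
  then show ?thesis by (elim negligible_subset) (auto simp: indicator_def)
qed

lemma bounded_measurable_absolutely_integrable:
  fixes k :: "real \<Rightarrow> 'a::euclidean_space"
  assumes "k \<in> borel_measurable (lebesgue_on S)" "S \<in> lmeasurable" "\<And>s. s \<in> S \<Longrightarrow> norm (k s) \<le> C"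
  shows "k absolutely_integrable_on S"
proof (rule measurable_bounded_by_integrable_imp_absolutely_integrable[OF assms(1) _ _ assms(3)])
  show "(\<lambda>_. C) integrable_on S" using integrable_on_const[OF assms(2)] .
qed (use assms in auto)

lemma indefinite_integral_lipschitz:
  fixes k :: "real \<Rightarrow> 'a::euclidean_space"
  assumes k: "k integrable_on {a..b}" and C: "\<And>s. s \<in> {a..b} \<Longrightarrow> norm (k s) \<le> C" "C \<ge> 0"
  shows "C-lipschitz_on {a..b} (\<lambda>s. x0 + integral {a..s} k)"
proof (rule lipschitz_onI)
  have *: "norm (integral {a..s} k - integral {a..r} k) \<le> C * (s - r)" if "r \<in> {a..b}" "s \<in> {a..b}" "r \<le> s" for r s
  proof -
    have "integral {a..r} k + integral {r..s} k = integral {a..s} k"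
      using that by (intro Henstock_Kurzweil_Integration.integral_combine integrable_subinterval_real[OF k]) auto
    then have "integral {a..s} k - integral {a..r} k = integral {r..s} k" by (simp add: algebra_simps)
    moreover have "norm (integral {r..s} k) \<le> integral {r..s} (\<lambda>_. C)"
      using that by (intro integral_norm_bound_integral integrable_subinterval_real[OF k] C) auto
    ultimately show ?thesis using that by (simp add: mult.commute)
  qed
  fix r s assume "r \<in> {a..b}" "s \<in> {a..b}"
  then show "dist (x0 + integral {a..r} k) (x0 + integral {a..s} k) \<le> C * dist r s"
    using *[of r s] *[of s r] by (cases "r \<le> s") (auto simp: dist_norm norm_minus_commute)
qed (rule C)

text \<open>The primitive is Lipschitz, hence differentiable almost everywhere with some derivative
  \<open>k'\<close>. Both \<open>k'\<close> and \<open>k\<close> integrate to the increments of the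
  primitive over every subinterval, so they agree almost everywhere; density points do not
  enter.\<close>

lemma indefinite_integral_derivative_ae:
  fixes k :: "real \<Rightarrow> 'a::euclidean_space"
  assumes k: "k \<in> borel_measurable (lebesgue_on {a..b})" and C: "\<And>s. s \<in> {a..b} \<Longrightarrow> norm (k s) \<le> C"
  shows "negligible {s \<in> {a<..<b}. \<not> ((\<lambda>s. x0 + integral {a..s} k) has_vector_derivative k s) (at s)}"
proof (cases "a < b")
  case False
  then show ?thesis by simp
next
  case ab: True
  define X where "X s = x0 + integral {a..s} k" for s
  have C0: "C \<ge> 0" using order_trans[OF norm_ge_zero C[of a]] ab by simp
  have kai: "k absolutely_integrable_on {a..b}"
    by (rule bounded_measurable_absolutely_integrable[OF k _ C]) auto
  then have ki: "k integrable_on {a..b}" by (rule set_lebesgue_integral_eq_integral(1))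
  have lip: "C-lipschitz_on {a..b} X"
    unfolding X_def using indefinite_integral_lipschitz[OF ki C C0] .
  define N where "N = {s \<in> {a<..<b}. \<not> X differentiable (at s)}"
  have N: "negligible N" unfolding N_def by (rule lipschitz_on_differentiable_ae[OF lip])
  define k' where "k' s = (if s \<in> {a<..<b} - N then vector_derivative X (at s) else 0)" for s
  have der: "(X has_vector_derivative k' s) (at s)" if "s \<in> {a<..<b} - N" for s
    using that unfolding k'_def N_def by (auto simp: vector_derivative_works[symmetric])
  have k'C: "norm (k' s) \<le> C" for s
  proof (cases "s \<in> {a<..<b} - N")
    case True
    then show ?thesis using lipschitz_on_derivative_bound[OF lip _ der[OF True]] by auto
  qed (use C0 in \<open>auto simp: k'_def\<close>)
  have hi: "(k' has_integral (X v - X u)) {u..v}" if "a \<le> u" "u \<le> v" "v \<le> b" for u v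
    using that by (intro lipschitz_on_has_integral[OF lipschitz_on_subset[OF lip] _ N der]) auto
  have hk: "(k has_integral (X v - X u)) {u..v}" if "a \<le> u" "u \<le> v" "v \<le> b" for u v
  proof -
    have "integral {a..u} k + integral {u..v} k = integral {a..v} k"
      using that by (intro Henstock_Kurzweil_Integration.integral_combine integrable_subinterval_real[OF ki]) auto
    moreover have "k integrable_on {u..v}" using that by (intro integrable_subinterval_real[OF ki]) auto
    ultimately show ?thesis by (simp add: X_def has_integral_iff algebra_simps)
  qed
  have "k' absolutely_integrable_on {a..b}"
    by (rule absolutely_integrable_integrable_bound[of _ _ "\<lambda>_. C"])
      (use k'C hi[of a b] ab in \<open>auto simp: has_integral_iff\<close>)
  then have "negligible {s \<in> {a..b}. k' s - k s \<noteq> 0}"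
  proof (intro integral_intervals_zero_imp_ae_zero set_integral_diff(1)[OF _ kai])
    fix u v assume "a \<le> u" "u \<le> v" "v \<le> b"
    then show "integral {u..v} (\<lambda>s. k' s - k s) = 0"
      using has_integral_diff[OF hi[of u v] hk[of u v]] by (simp add: integral_unique)
  qed
  then have "negligible ({s \<in> {a..b}. k' s - k s \<noteq> 0} \<union> N)" using N by simp
  then show ?thesis unfolding X_def[symmetric]
  proof (rule negligible_subset, intro subsetI)
    fix s assume "s \<in> {s \<in> {a<..<b}. \<not> (X has_vector_derivative k s) (at s)}"
    then show "s \<in> {s \<in> {a..b}. k' s - k s \<noteq> 0} \<union> N" using der[of s] by (cases "s \<in> N") auto
  qed
qed

section \<open>The state equation: a priori bounds, stability and uniqueness\<close>

lemma AE_lebesgue_on_iff_negligible: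
  assumes "S \<in> sets lebesgue"
  shows "(AE s in lebesgue_on S. P s) \<longleftrightarrow> negligible {s \<in> S. \<not> P s}"
proof -
  have "(AE s in lebesgue_on S. P s) \<longleftrightarrow> (AE s in lebesgue. s \<in> S \<longrightarrow> P s)"
    using assms by (subst AE_restrict_space_iff) auto
  also have "\<dots> \<longleftrightarrow> negligible {s \<in> S. \<not> P s}"
    unfolding eventually_ae_filter_negligible by (auto intro: negligible_subset)
  finally show ?thesis .
qed

lemma exp_weight_integral:
  fixes K B :: real
  assumes "a \<le> s" "K > 0"
  shows "((\<lambda>r. K * (B * exp (2 * K * (r - a)))) has_integral (B / 2 * exp (2 * K * (s - a)) - B / 2)) {a..s}"
proof -
  have "((\<lambda>r. K * (B * exp (2 * K * (r - a)))) has_integral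
     (B / 2 * exp (2 * K * (s - a)) - B / 2 * exp (2 * K * (a - a)))) {a..s}"
    using assms
    by (intro fundamental_theorem_of_calculus)
      (auto intro!: derivative_eq_intros simp: has_real_derivative_iff_has_vector_derivative[symmetric])
  then show ?thesis by simp
qed

text \<open>The pointwise bound is asked only inside the open interval, since a control is known to
  lie in \<open>A\<close> only there. With \<open>B = 0\<close> this is the plain estimate by a
  constant.\<close>

lemma norm_integral_exp_weight_le:
  fixes f :: "real \<Rightarrow> 'a::euclidean_space"
  assumes f: "(f has_integral I) {a..s}" and "a \<le> s" "K > 0" "B \<ge> 0"
    and le: "\<And>r. r \<in> {a<..<s} \<Longrightarrow> norm (f r) \<le> c + K * (B * exp (2 * K * (r - a)))"
  shows "norm I \<le> c * (s - a) + B / 2 * exp (2 * K * (s - a))"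
proof -
  have "((\<lambda>r. c + K * (B * exp (2 * K * (r - a)))) has_integral
    (c * (s - a) + (B / 2 * exp (2 * K * (s - a)) - B / 2))) {a..s}"
    using has_integral_const_real[of c a s] assms
    by (intro has_integral_add exp_weight_integral) (auto simp: mult.commute)
  then have g: "((\<lambda>r. c + K * (B * exp (2 * K * (r - a)))) has_integral
    (c * (s - a) + (B / 2 * exp (2 * K * (s - a)) - B / 2))) {a<..<s}"
    by (simp add: has_integral_open_interval[where 'a = real, simplified])
  have f': "(f has_integral I) {a<..<s}" using f by (simp add: has_integral_open_interval[where 'a = real, simplified])
  have "norm (integral {a<..<s} f) \<le> integral {a<..<s} (\<lambda>r. c + K * (B * exp (2 * K * (r - a))))"
    using f' g by (intro integral_norm_bound_integral le) (auto simp: has_integral_iff)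
  then show ?thesis using f' g \<open>B \<ge> 0\<close> by (simp add: integral_unique)
qed

text \<open>
  With the weight \<open>exp (2 * K * (s - a))\<close> the integral operator halves the norm, which also covers
  delayed arguments since the weight is increasing.
\<close>

lemma weighted_gronwall:
  fixes u :: "real \<Rightarrow> real"
  assumes "a \<le> e" and cont: "continuous_on {a..e} u" and nonneg: "\<And>s. u s \<ge> 0"
    and step: "\<And>B s. B \<ge> 0 \<Longrightarrow> s \<in> {a..e} \<Longrightarrow> (\<And>r. r \<in> {a..s} \<Longrightarrow> u r \<le> B * exp (2 * K * (r - a)))
       \<Longrightarrow> u s \<le> c + B / 2 * exp (2 * K * (s - a))"
    and "K > 0" "c \<ge> 0" and s: "s \<in> {a..e}"
  shows "u s \<le> 2 * c * exp (2 * K * (e - a))"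
proof -
  let ?v = "\<lambda>s. u s * exp (- (2 * K * (s - a)))"
  have "continuous_on {a..e} ?v" by (intro continuous_intros cont)
  then obtain m where m: "m \<in> {a..e}" "\<And>r. r \<in> {a..e} \<Longrightarrow> ?v r \<le> ?v m"
    using continuous_attains_sup[of "{a..e}" ?v] \<open>a \<le> e\<close> by auto
  \<comment> \<open>\<open>B\<close> is the smallest factor with which the weight dominates
    \<open>u\<close>. At the maximizer, \<open>step\<close> bounds \<open>B\<close> times the weight
    by \<open>c\<close> plus half of the same quantity; as the weight is at least \<open>1\<close>,
    \<open>B \<le> 2 * c\<close> follows.\<close>
  define B where "B = ?v m"
  have B: "B \<ge> 0" unfolding B_def using nonneg by simp
  have uB: "u r \<le> B * exp (2 * K * (r - a))" if "r \<in> {a..e}" for r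
  proof -
    have "u r = ?v r * exp (2 * K * (r - a))" by (simp add: exp_minus mult.assoc)
    also have "\<dots> \<le> B * exp (2 * K * (r - a))"
      unfolding B_def using m(2)[OF that] by (intro mult_right_mono) auto
    finally show ?thesis .
  qed
  have "u m \<le> c + B / 2 * exp (2 * K * (m - a))"
    using m by (intro step B uB) auto
  moreover have "u m = B * exp (2 * K * (m - a))" by (simp add: B_def exp_minus mult.assoc)
  ultimately have "B * exp (2 * K * (m - a)) \<le> 2 * c" by simp
  moreover have "B * 1 \<le> B * exp (2 * K * (m - a))"
    using B m \<open>K > 0\<close> by (intro mult_left_mono) auto
  ultimately have "B \<le> 2 * c" by simp
  have "u s \<le> B * exp (2 * K * (s - a))" by (rule uB[OF s])
  also have "\<dots> \<le> (2 * c) * exp (2 * K * (e - a))"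
    using \<open>B \<le> 2 * c\<close> B s \<open>K > 0\<close> by (intro mult_mono) auto
  finally show ?thesis .
qed

lemma bounded_measurable_integrable_on_Icc:
  fixes k :: "real \<Rightarrow> 'a::euclidean_space"
  assumes "k \<in> borel_measurable (lebesgue_on {a<..<b})" "\<And>s. s \<in> {a<..<b} \<Longrightarrow> norm (k s) \<le> C"
  shows "k integrable_on {a..b}"
proof -
  have "k absolutely_integrable_on {a<..<b}"
    using assms by (intro bounded_measurable_absolutely_integrable[where C = C]) auto
  then have "k integrable_on {a<..<b}" by (rule set_lebesgue_integral_eq_integral(1))
  then show ?thesis by (simp add: integrable_on_open_interval_real)
qed

text \<open>Serves both the dynamics (\<open>\<phi> = f\<close>) and the running cost
  (\<open>\<phi> = L\<close>), so that measurability and locality are proved once; partially applied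
  it is a function of time.\<close>

definition along ::
  "(real \<Rightarrow> real^'n \<Rightarrow> real) \<Rightarrow> (real \<Rightarrow> real^'n \<Rightarrow> real^'n \<Rightarrow> real^'m \<Rightarrow> 'b) \<Rightarrow>
   (real \<Rightarrow> real^'m) \<Rightarrow> (real \<Rightarrow> real^'n) \<Rightarrow> real \<Rightarrow> 'b" where
  "along \<tau> \<phi> \<alpha> x s = \<phi> s (x s) (x (s - \<tau> s (x s))) (\<alpha> s)"

lemma LipE:
  assumes "w \<in> Lip b"
  obtains C where "C \<ge> 0" "C-lipschitz_on {-b..0} w"
  using assms lipschitz_on_nonneg unfolding Lip_def by blast

lemma Lip_bounded:
  assumes "w \<in> Lip b"
  obtains R where "R > 0" "\<And>\<theta>. \<theta> \<in> {-b..0} \<Longrightarrow> norm (w \<theta>) \<le> R"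
proof -
  obtain C where "C-lipschitz_on {-b..0} w" using assms by (rule LipE)
  then have "bounded (w ` {-b..0})"
    by (intro compact_imp_bounded compact_continuous_image lipschitz_on_continuous_on) auto
  then show thesis using that unfolding bounded_pos by auto
qed

context delay_control_problem
begin

section \<open>Named constants and elementary bounds of the data\<close>

abbreviation bd :: real where "bd \<equiv> max_delay t0 T \<tau>"
abbreviation traj where "traj \<equiv> is_trajectory bd T f \<tau>"

text \<open>Choice turns the existential assumptions into named constants, so that later bounds can
  be explicit expressions in them.\<close>

definition lf where "lf = (SOME l. l > 0 \<and> (\<forall>t\<in>{t0..T}. \<forall>a\<in>A. \<forall>z y z' y'.
          norm (f t z y a - f t z' y' a) \<le> l * (norm (z - z') + norm (y - y'))))"
definition l\<tau> where "l\<tau> = (SOME l. l > 0 \<and> (\<forall>t\<in>{t0..T}. \<forall>z y. \<bar>\<tau> t z - \<tau> t y\<bar> \<le> l * norm (z - y)))"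
definition CL where "CL = (SOME C. C > 0 \<and> (\<forall>t\<in>{t0..T}. \<forall>a\<in>A. \<forall>z y. \<bar>L t z y a\<bar> \<le> C * (1 + norm z + norm y)))"

lemma lf: "lf > 0" "\<And>t a z y z' y'. t \<in> {t0..T} \<Longrightarrow> a \<in> A \<Longrightarrow>
    norm (f t z y a - f t z' y' a) \<le> lf * (norm (z - z') + norm (y - y'))"
  using someI_ex[OF f_lipschitz] unfolding lf_def[symmetric] by blast+

lemma l\<tau>: "l\<tau> > 0" "\<And>t z y. t \<in> {t0..T} \<Longrightarrow> \<bar>\<tau> t z - \<tau> t y\<bar> \<le> l\<tau> * norm (z - y)"
  using someI_ex[OF \<tau>_lipschitz] unfolding l\<tau>_def[symmetric] by blast+

lemma CL: "CL > 0" "\<And>t a z y. t \<in> {t0..T} \<Longrightarrow> a \<in> A \<Longrightarrow> \<bar>L t z y a\<bar> \<le> CL * (1 + norm z + norm y)"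
  using someI_ex[OF L_growth] unfolding CL_def[symmetric] by blast+

lemma f_growth_ex: "\<exists>C>0. \<forall>t\<in>{t0..T}. \<forall>a\<in>A. \<forall>z y. norm (f t z y a) \<le> C * (1 + norm z + norm y)"
proof -
  have "continuous_on ({t0..T} \<times> A) (\<lambda>(t, a). f t 0 0 a)"
  proof -
    have "continuous_on ({t0..T} \<times> A) (\<lambda>u. (\<lambda>(t, z, y, a). f t z y a) (fst u, 0, 0, snd u))"
      by (rule continuous_on_compose2[OF f_cont]) (auto intro!: continuous_intros)
    then show ?thesis by (simp add: case_prod_unfold)
  qed
  then have "bounded ((\<lambda>(t, a). f t 0 0 a) ` ({t0..T} \<times> A))"
    by (intro compact_imp_bounded compact_continuous_image compact_Times A_compact) auto
  then obtain C where C: "C > 0" "\<And>t a. t \<in> {t0..T} \<Longrightarrow> a \<in> A \<Longrightarrow> norm (f t 0 0 a) \<le> C"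
    unfolding bounded_pos by force
  have "norm (f t z y a) \<le> (C + lf) * (1 + norm z + norm y)" if "t \<in> {t0..T}" "a \<in> A" for t z y a
  proof -
    have "norm (f t z y a) \<le> norm (f t 0 0 a) + norm (f t z y a - f t 0 0 a)" by norm
    also have "\<dots> \<le> C + lf * (norm z + norm y)"
      using C(2)[OF that] lf(2)[OF that, of z y 0 0] by simp
    also have "\<dots> \<le> C + lf * (norm z + norm y) + (lf + C * (norm z + norm y))"
      using lf(1) C(1) by simp
    also have "\<dots> = (C + lf) * (1 + norm z + norm y)" by (simp add: algebra_simps)
    finally show ?thesis .
  qed
  then show ?thesis using C(1) lf(1) by (intro exI[of _ "C + lf"]) auto
qed

definition Cf where "Cf = (SOME C. C > 0 \<and> (\<forall>t\<in>{t0..T}. \<forall>a\<in>A. \<forall>z y. norm (f t z y a) \<le> C * (1 + norm z + norm y)))"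

lemma Cf: "Cf > 0" "\<And>t a z y. t \<in> {t0..T} \<Longrightarrow> a \<in> A \<Longrightarrow> norm (f t z y a) \<le> Cf * (1 + norm z + norm y)"
  using someI_ex[OF f_growth_ex] unfolding Cf_def[symmetric] by blast+

lemma \<tau>_le: "t \<in> {t0..T} \<Longrightarrow> \<tau> t z \<le> bd"
  unfolding max_delay_def using \<tau>_bounded by (intro cSUP_upper2[where x = "(t, z)"]) auto

lemma bd_nonneg: "bd \<ge> 0"
proof -
  have "0 \<le> \<tau> t0 0" "\<tau> t0 0 \<le> bd" using \<tau>_nonneg \<tau>_le[of t0 0] time by auto
  then show ?thesis by linarith
qed

lemma delayed_in: "t0 \<le> t \<Longrightarrow> s \<in> {t..T} \<Longrightarrow> s - \<tau> s z \<in> {t - bd..s}"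
  using \<tau>_le[of s z] \<tau>_nonneg by auto

lemma \<tau>_cont: "continuous_on ({t0..T} \<times> UNIV) (\<lambda>(t, z). \<tau> t z)"
  using \<tau>_differentiable by (simp add: differentiable_imp_continuous_on differentiable_on_def)

section \<open>Continuity and measurability of the data along a trajectory\<close>

lemma delayed_continuous:
  assumes "t0 \<le> t" "continuous_on {t - bd..T} x"
  shows "continuous_on {t..T} (\<lambda>s. x (s - \<tau> s (x s)))"
proof (rule continuous_on_compose2[OF assms(2)])
  have "continuous_on {t..T} x" using bd_nonneg by (intro continuous_on_subset[OF assms(2)]) auto
  then have "continuous_on {t..T} (\<lambda>s. (\<lambda>(t, z). \<tau> t z) (s, x s))"
    using assms(1) by (intro continuous_on_compose2[OF \<tau>_cont] continuous_intros) auto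
  then show "continuous_on {t..T} (\<lambda>s. s - \<tau> s (x s))" by (intro continuous_intros) simp
  show "(\<lambda>s. s - \<tau> s (x s)) ` {t..T} \<subseteq> {t - bd..T}"
    using delayed_in[OF assms(1)] by fastforce
qed

text \<open>\<open>\<phi>\<close> is continuous only where time lies in \<open>{t0..T}\<close> and
  the control in \<open>A\<close>. The measurable tuple is therefore first placed in the Borel space
  restricted to that set and then composed with \<open>\<phi>\<close>.\<close>

lemma composite_measurable:
  fixes \<phi> :: "real \<Rightarrow> real^'n \<Rightarrow> real^'n \<Rightarrow> real^'m \<Rightarrow> 'b::euclidean_space"
  assumes \<phi>: "continuous_on ({t0..T} \<times> UNIV \<times> UNIV \<times> A) (\<lambda>(t, z, y, a). \<phi> t z y a)"
    and S: "S \<subseteq> {t0..T}" and "S \<in> sets lebesgue"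
    and [measurable]: "u \<in> borel_measurable (lebesgue_on S)" "v \<in> borel_measurable (lebesgue_on S)"
      "\<alpha> \<in> borel_measurable (lebesgue_on S)"
    and \<alpha>A: "\<And>s. s \<in> S \<Longrightarrow> \<alpha> s \<in> A"
  shows "(\<lambda>s. \<phi> s (u s) (v s) (\<alpha> s)) \<in> borel_measurable (lebesgue_on S)"
proof -
  have [measurable]: "(\<lambda>s. s) \<in> borel_measurable (lebesgue_on S)"
    using assms(3) by (intro continuous_imp_measurable_on_sets_lebesgue continuous_intros) auto
  have "(\<lambda>s. (s, u s, v s, \<alpha> s)) \<in> borel_measurable (lebesgue_on S)"
    by (intro borel_measurable_Pair assms) measurable
  then have "(\<lambda>s. (s, u s, v s, \<alpha> s)) \<in> lebesgue_on S \<rightarrow>\<^sub>M restrict_space borel ({t0..T} \<times> UNIV \<times> UNIV \<times> A)"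
    using S \<alpha>A by (intro measurable_restrict_space2) auto
  from measurable_compose[OF this borel_measurable_continuous_on_restrict[OF \<phi>]]
  show ?thesis by simp
qed

lemma along_measurable:
  fixes \<phi> :: "real \<Rightarrow> real^'n \<Rightarrow> real^'n \<Rightarrow> real^'m \<Rightarrow> 'b::euclidean_space"
  assumes \<phi>: "continuous_on ({t0..T} \<times> UNIV \<times> UNIV \<times> A) (\<lambda>(t, z, y, a). \<phi> t z y a)"
    and "t0 \<le> t" and x: "continuous_on {t - bd..T} x"
    and S: "S \<subseteq> {t..T}" "S \<in> sets lebesgue"
    and "\<alpha> \<in> borel_measurable (lebesgue_on S)" "\<And>s. s \<in> S \<Longrightarrow> \<alpha> s \<in> A"
  shows "along \<tau> \<phi> \<alpha> x \<in> borel_measurable (lebesgue_on S)"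
  unfolding along_def
proof (rule composite_measurable[OF \<phi> _ S(2)])
  have "continuous_on S x" using S bd_nonneg by (intro continuous_on_subset[OF x]) auto
  then show "x \<in> borel_measurable (lebesgue_on S)"
    using S(2) by (rule continuous_imp_measurable_on_sets_lebesgue)
  have "continuous_on S (\<lambda>s. x (s - \<tau> s (x s)))"
    using S by (intro continuous_on_subset[OF delayed_continuous[OF assms(2) x]])
  then show "(\<lambda>s. x (s - \<tau> s (x s))) \<in> borel_measurable (lebesgue_on S)"
    using S(2) by (rule continuous_imp_measurable_on_sets_lebesgue)
qed (use assms in auto)

lemma trajD:
  assumes "traj t w \<alpha> x"
  obtains C where "C-lipschitz_on {t - bd..T} x"
    and "negligible {s \<in> {t<..<T}. \<not> (x has_vector_derivative along \<tau> f \<alpha> x s) (at s)}"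
    and "\<And>\<theta>. \<theta> \<in> {-bd..0} \<Longrightarrow> x (t + \<theta>) = w \<theta>"
    and "continuous_on {t - bd..T} x"
proof -
  obtain C where C: "C-lipschitz_on {t - bd..T} x" using assms by (auto simp: is_trajectory_def)
  have n: "negligible {s \<in> {t<..<T}. \<not> (x has_vector_derivative along \<tau> f \<alpha> x s) (at s)}"
    using assms unfolding is_trajectory_def along_def
    by (subst (asm) AE_lebesgue_on_iff_negligible) auto
  show thesis
    by (rule that[OF C n]) (use assms C lipschitz_on_continuous_on in \<open>auto simp: is_trajectory_def\<close>)
qed

lemma traj_has_integral:
  assumes "traj t w \<alpha> x" "t \<le> u" "u \<le> v" "v \<le> T"
  shows "(along \<tau> f \<alpha> x has_integral (x v - x u)) {u..v}"
proof -
  obtain C where C: "C-lipschitz_on {t - bd..T} x"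
    and N: "negligible {s \<in> {t<..<T}. \<not> (x has_vector_derivative along \<tau> f \<alpha> x s) (at s)}"
    using assms(1) by - (erule trajD, blast)
  have "C-lipschitz_on {u..v} x"
    using assms bd_nonneg by (intro lipschitz_on_subset[OF C]) auto
  then show ?thesis
    by (rule lipschitz_on_has_integral[OF _ _ N]) (use assms in auto)
qed

lemma trajI:
  assumes "C-lipschitz_on {t - bd..T} x"
    and "negligible {s \<in> {t<..<T}. \<not> (x has_vector_derivative along \<tau> f \<alpha> x s) (at s)}"
    and "\<And>\<theta>. \<theta> \<in> {-bd..0} \<Longrightarrow> x (t + \<theta>) = w \<theta>"
  shows "traj t w \<alpha> x"
  unfolding is_trajectory_def
  using assms by (auto simp: AE_lebesgue_on_iff_negligible along_def)

text \<open>Causality: the delayed argument lies between \<open>t - bd\<close> and \<open>s\<close>.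
  Concatenation of trajectories rests on this.\<close>

lemma along_cong:
  assumes "t0 \<le> t" "s \<in> {t..T}" "\<And>r. r \<in> {t - bd..s} \<Longrightarrow> x r = y r" "\<alpha> s = \<beta> s"
  shows "along \<tau> \<phi> \<alpha> x s = along \<tau> \<phi> \<beta> y s"
proof -
  have "x s = y s" using assms bd_nonneg by auto
  then show ?thesis
    using assms(3)[OF delayed_in[OF assms(1,2)]] assms(4) by (simp add: along_def)
qed

lemma traj_cong:
  assumes "traj t w \<alpha> x" "t0 \<le> t" "\<And>s. s \<in> {t - bd..T} \<Longrightarrow> y s = x s" "\<And>s. s \<in> {t<..<T} \<Longrightarrow> \<beta> s = \<alpha> s"
    and "t \<le> T"
  shows "traj t w \<beta> y"
proof -
  obtain C where C: "C-lipschitz_on {t - bd..T} x"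
    and N: "negligible {s \<in> {t<..<T}. \<not> (x has_vector_derivative along \<tau> f \<alpha> x s) (at s)}"
    and w: "\<And>\<theta>. \<theta> \<in> {-bd..0} \<Longrightarrow> x (t + \<theta>) = w \<theta>"
    using assms(1) by - (erule trajD, blast)
  show ?thesis
  proof (rule trajI)
    show "C-lipschitz_on {t - bd..T} y"
      using C assms(3) by (rule lipschitz_on_transform)
    show "y (t + \<theta>) = w \<theta>" if "\<theta> \<in> {-bd..0}" for \<theta>
      using w[OF that] that assms(3)[of "t + \<theta>"] \<open>t \<le> T\<close> by auto
    show "negligible {s \<in> {t<..<T}. \<not> (y has_vector_derivative along \<tau> f \<beta> y s) (at s)}"
    proof (rule negligible_subset[OF N], safe)
      fix s assume s: "s \<in> {t<..<T}" and "\<not> (y has_vector_derivative along \<tau> f \<beta> y s) (at s)"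
        "(x has_vector_derivative along \<tau> f \<alpha> x s) (at s)"
      moreover have "along \<tau> f \<beta> y s = along \<tau> f \<alpha> x s"
        using s assms by (intro along_cong) auto
      ultimately show False
        using has_vector_derivative_transform_within_open[of x "along \<tau> f \<alpha> x s" s "{t<..<T}" y] assms(3) bd_nonneg
        by auto
    qed
  qed
qed

text \<open>The outcome of \<open>weighted_gronwall\<close> with rate \<open>2 * Cf\<close>, one
  \<open>Cf\<close> for the current and one for the delayed state. The offset
  \<open>R + Cf * (1 + R) * (T - t0)\<close> holds the initial size and the integrated constant part
  of the growth bound, with \<open>R\<close> for delayed arguments that fall into the
  history.\<close>

definition state_bound where
  "state_bound R = 2 * (R + Cf * (1 + R) * (T - t0)) * exp (2 * (2 * Cf) * (T - t0))"

lemma traj_bound: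
  assumes x: "traj t w \<alpha> x" and t: "t \<in> {t0..T}" and \<alpha>: "\<alpha> \<in> controls A t T"
    and R: "R \<ge> 0" "\<And>\<theta>. \<theta> \<in> {-bd..0} \<Longrightarrow> norm (w \<theta>) \<le> R" and s: "s \<in> {t - bd..T}"
  shows "norm (x s) \<le> state_bound R"
proof -
  obtain C where C: "C-lipschitz_on {t - bd..T} x"
    and w: "\<And>\<theta>. \<theta> \<in> {-bd..0} \<Longrightarrow> x (t + \<theta>) = w \<theta>"
    and cont: "continuous_on {t - bd..T} x"
    using x by - (erule trajD, blast)
  have hist: "norm (x r) \<le> R" if "r \<in> {t - bd..t}" for r
    using w[of "r - t"] R(2)[of "r - t"] that by auto
  let ?c = "R + Cf * (1 + R) * (T - t0)"
  have c: "?c \<ge> 0" using R(1) Cf(1) time by simp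
  show ?thesis
  proof (cases "s \<le> t")
    case True
    have "norm (x s) \<le> R" using hist True s by auto
    also have "R * 1 \<le> (2 * ?c) * exp (2 * (2 * Cf) * (T - t0))"
      using R(1) Cf(1) time by (intro mult_mono) (auto intro: add_increasing2)
    finally show ?thesis by (simp add: state_bound_def)
  next
    case False
    have "norm (x s) \<le> 2 * ?c * exp (2 * (2 * Cf) * (T - t))"
    proof (rule weighted_gronwall[of t T "\<lambda>s. norm (x s)" "2 * Cf" "?c" s])
      show "continuous_on {t..T} (\<lambda>s. norm (x s))"
        using bd_nonneg by (intro continuous_intros continuous_on_subset[OF cont]) auto
      fix B r assume B: "B \<ge> 0" and r: "r \<in> {t..T}"
        and le: "\<And>q. q \<in> {t..r} \<Longrightarrow> norm (x q) \<le> B * exp (2 * (2 * Cf) * (q - t))"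
      have "norm (x r - x t) \<le> Cf * (1 + R) * (r - t) + B / 2 * exp (2 * (2 * Cf) * (r - t))"
      proof (rule norm_integral_exp_weight_le[of "along \<tau> f \<alpha> x"])
        show "(along \<tau> f \<alpha> x has_integral (x r - x t)) {t..r}"
          using r by (intro traj_has_integral[OF x]) auto
        fix q assume q: "q \<in> {t<..<r}"
        let ?d = "q - \<tau> q (x q)"
        have d: "?d \<in> {t - bd..q}" using q r t by (intro delayed_in) auto
        have Be: "0 \<le> B * exp (2 * (2 * Cf) * (q - t))" using B by simp
        have "norm (x ?d) \<le> R + B * exp (2 * (2 * Cf) * (q - t))"
        proof (cases "?d \<le> t")
          case True
          then show ?thesis using hist[of ?d] d Be by auto
        next
          case False
          then have "norm (x ?d) \<le> B * exp (2 * (2 * Cf) * (?d - t))" using d q by (intro le) auto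
          also have "\<dots> \<le> B * exp (2 * (2 * Cf) * (q - t))"
            using d B Cf(1) by (intro mult_left_mono) auto
          finally show ?thesis using R(1) by simp
        qed
        moreover have "norm (x q) \<le> B * exp (2 * (2 * Cf) * (q - t))" using q by (intro le) auto
        moreover have "norm (along \<tau> f \<alpha> x q) \<le> Cf * (1 + norm (x q) + norm (x ?d))"
          unfolding along_def using q r t \<alpha> by (intro Cf) (auto simp: controls_def)
        ultimately have "norm (along \<tau> f \<alpha> x q) \<le> Cf * (1 + B * exp (2 * (2 * Cf) * (q - t)) + (R + B * exp (2 * (2 * Cf) * (q - t))))"
          using Cf(1) by (smt (verit) mult_left_mono)
        then show "norm (along \<tau> f \<alpha> x q) \<le> Cf * (1 + R) + 2 * Cf * (B * exp (2 * (2 * Cf) * (q - t)))"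
          by (simp add: algebra_simps)
      qed (use r B Cf(1) in auto)
      moreover have "Cf * (1 + R) * (r - t) \<le> Cf * (1 + R) * (T - t0)"
        using r t R Cf(1) by (intro mult_left_mono) auto
      moreover have "norm (x t) \<le> R" using hist[of t] bd_nonneg by auto
      moreover have "norm (x r) \<le> norm (x t) + norm (x r - x t)" by norm
      ultimately show "norm (x r) \<le> ?c + B / 2 * exp (2 * (2 * Cf) * (r - t))" by linarith
    qed (use False s t c Cf(1) in auto)
    also have "\<dots> \<le> state_bound R"
      unfolding state_bound_def using c t Cf(1) by (intro mult_left_mono) auto
    finally show ?thesis .
  qed
qed

text \<open>Again from \<open>weighted_gronwall\<close>, now with rate
  \<open>lf * (2 + M * l\<tau>)\<close>: current state, delayed state, and the shift of the delayed
  time along a reference trajectory of Lipschitz constant \<open>M\<close>. The factor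
  \<open>1 + lf * (T - t0)\<close> collects the initial difference and its later effect through the
  delay.\<close>

definition stability_const where
  "stability_const M = 2 * (1 + lf * (T - t0)) * exp (2 * (lf * (2 + M * l\<tau>)) * (T - t0))"

text \<open>Inserting \<open>x\<close> at the delayed time of \<open>y\<close> separates a
  difference of values at one time from a change of time in \<open>x\<close> alone, so no Lipschitz
  constant of \<open>y\<close> enters.\<close>

lemma delayed_diff_le:
  assumes x: "M-lipschitz_on {t - bd..T} x" and "t0 \<le> t" "r \<in> {t..T}"
  shows "norm (y (r - \<tau> r (y r)) - x (r - \<tau> r (x r)))
    \<le> norm (y (r - \<tau> r (y r)) - x (r - \<tau> r (y r))) + M * l\<tau> * norm (y r - x r)"
proof -
  let ?d = "r - \<tau> r (y r)" and ?e = "r - \<tau> r (x r)"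
  have "?d \<in> {t - bd..r}" "?e \<in> {t - bd..r}" using assms by (intro delayed_in; simp)+
  then have "norm (x ?d - x ?e) \<le> M * \<bar>?d - ?e\<bar>"
    using lipschitz_onD[OF x, of ?d ?e] assms(3) by (auto simp: dist_norm)
  also have "\<bar>?d - ?e\<bar> = \<bar>\<tau> r (y r) - \<tau> r (x r)\<bar>" by simp
  also have "M * \<dots> \<le> M * (l\<tau> * norm (y r - x r))"
    using assms l\<tau>(2)[of r "y r" "x r"] lipschitz_on_nonneg[OF x] by (intro mult_left_mono) auto
  finally have "norm (x ?d - x ?e) \<le> M * l\<tau> * norm (y r - x r)" by simp
  moreover have "norm (y ?d - x ?e) \<le> norm (y ?d - x ?d) + norm (x ?d - x ?e)" by norm
  ultimately show ?thesis by simp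
qed

lemma along_diff_le:
  assumes x: "M-lipschitz_on {t - bd..T} x" and t: "t0 \<le> t" and r: "r \<in> {t..T}" and \<alpha>: "\<alpha> r \<in> A"
    and hist: "\<And>q. q \<in> {t - bd..r} \<Longrightarrow> norm (y q - x q) \<le> e"
  shows "norm (along \<tau> f \<alpha> y r - along \<tau> f \<alpha> x r) \<le> lf * (2 + M * l\<tau>) * e"
proof -
  have d: "norm (y (r - \<tau> r (y r)) - x (r - \<tau> r (y r))) \<le> e"
    using delayed_in[OF t r] by (intro hist)
  have e: "norm (y r - x r) \<le> e" using r bd_nonneg by (intro hist) auto
  have M: "M * l\<tau> \<ge> 0" using lipschitz_on_nonneg[OF x] l\<tau>(1) by simp
  have "norm (along \<tau> f \<alpha> y r - along \<tau> f \<alpha> x r)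
      \<le> lf * (norm (y r - x r) + norm (y (r - \<tau> r (y r)) - x (r - \<tau> r (x r))))"
    unfolding along_def using t r \<alpha> by (intro lf) auto
  also have "\<dots> \<le> lf * (e + (e + M * l\<tau> * e))"
    using delayed_diff_le[OF x t r, of y] d e lf(1) mult_left_mono[OF e M] by (intro mult_left_mono) linarith+
  finally show ?thesis by (simp add: algebra_simps)
qed

lemma along_diff_weighted_le:
  assumes x: "M-lipschitz_on {t - bd..T} x" and t: "t0 \<le> t" and q: "q \<in> {t..T}" "\<alpha> q \<in> A"
    and "B \<ge> 0" "c \<ge> 0" and K: "K = lf * (2 + M * l\<tau>)"
    and hist: "\<And>r. r \<in> {t - bd..t} \<Longrightarrow> norm (y r - x r) \<le> c"
    and le: "\<And>r. r \<in> {t..q} \<Longrightarrow> norm (y r - x r) \<le> B * exp (2 * K * (r - t))"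
  shows "norm (along \<tau> f \<alpha> y q - along \<tau> f \<alpha> x q) \<le> lf * c + K * (B * exp (2 * K * (q - t)))"
proof -
  let ?d = "q - \<tau> q (y q)" and ?E = "B * exp (2 * K * (q - t))"
  have M0: "M \<ge> 0" using x by (rule lipschitz_on_nonneg)
  then have K0: "K \<ge> 0" using K lf(1) l\<tau>(1) by simp
  have d: "?d \<in> {t - bd..q}" using q t by (intro delayed_in)
  have "norm (y ?d - x ?d) \<le> c + ?E"
  proof (cases "?d \<le> t")
    case True
    then show ?thesis using hist[of ?d] d \<open>B \<ge> 0\<close> by (auto intro: add_increasing2)
  next
    case False
    then have "norm (y ?d - x ?d) \<le> B * exp (2 * K * (?d - t))" using d by (intro le) auto
    also have "\<dots> \<le> ?E" using d \<open>B \<ge> 0\<close> K0 by (intro mult_left_mono) (auto intro: mult_left_mono)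
    finally show ?thesis using \<open>c \<ge> 0\<close> by simp
  qed
  moreover have qE: "norm (y q - x q) \<le> ?E" using q by (intro le) auto
  moreover have "M * l\<tau> * norm (y q - x q) \<le> M * l\<tau> * ?E"
    using qE M0 l\<tau>(1) by (intro mult_left_mono) auto
  ultimately have "norm (y q - x q) + norm (y ?d - x (q - \<tau> q (x q))) \<le> c + (2 + M * l\<tau>) * ?E"
    using delayed_diff_le[OF x t q(1), of y] by (simp add: algebra_simps)
  then have "lf * (norm (y q - x q) + norm (y ?d - x (q - \<tau> q (x q)))) \<le> lf * (c + (2 + M * l\<tau>) * ?E)"
    using lf(1) by (intro mult_left_mono) auto
  moreover have "norm (along \<tau> f \<alpha> y q - along \<tau> f \<alpha> x q)
      \<le> lf * (norm (y q - x q) + norm (y ?d - x (q - \<tau> q (x q))))"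
    unfolding along_def using q t by (intro lf) auto
  ultimately show ?thesis by (simp add: K algebra_simps)
qed

text \<open>The constant depends on the reference trajectory \<open>x\<close> through
  \<open>M\<close> and not on \<open>y\<close>, which makes the estimate uniform over a family of
  perturbations.\<close>

lemma traj_stability:
  assumes x: "traj t w \<alpha> x" and y: "traj t w' \<alpha> y" and M: "M-lipschitz_on {t - bd..T} x"
    and t: "t \<in> {t0..T}" and \<alpha>: "\<alpha> \<in> controls A t T"
    and c: "c \<ge> 0" "\<And>\<theta>. \<theta> \<in> {-bd..0} \<Longrightarrow> norm (w' \<theta> - w \<theta>) \<le> c" and s: "s \<in> {t - bd..T}"
  shows "norm (y s - x s) \<le> stability_const M * c"
proof -
  obtain C where C: "C-lipschitz_on {t - bd..T} x"
    and w: "\<And>\<theta>. \<theta> \<in> {-bd..0} \<Longrightarrow> x (t + \<theta>) = w \<theta>"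
    and contx: "continuous_on {t - bd..T} x"
    using x by - (erule trajD, blast)
  obtain C' where w': "\<And>\<theta>. \<theta> \<in> {-bd..0} \<Longrightarrow> y (t + \<theta>) = w' \<theta>"
    and conty: "continuous_on {t - bd..T} y"
    using y by - (erule trajD, blast)
  have hist: "norm (y r - x r) \<le> c" if "r \<in> {t - bd..t}" for r
    using w[of "r - t"] w'[of "r - t"] c(2)[of "r - t"] that by auto
  have M0: "M \<ge> 0" using M by (rule lipschitz_on_nonneg)
  define K where "K = lf * (2 + M * l\<tau>)"
  have K: "K > 0" unfolding K_def using lf(1) l\<tau>(1) M0 by (intro mult_pos_pos add_pos_nonneg) auto
  let ?c = "c * (1 + lf * (T - t0))"
  have c0: "?c \<ge> 0" using c(1) lf(1) time by simp
  show ?thesis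
  proof (cases "s \<le> t")
    case True
    have "norm (y s - x s) \<le> c * 1" using hist True s by auto
    also have "\<dots> \<le> c * (2 * (1 + lf * (T - t0)) * exp (2 * K * (T - t0)))"
    proof (rule mult_left_mono[OF _ c(1)])
      have "1 * 1 \<le> (2 * (1 + lf * (T - t0))) * exp (2 * K * (T - t0))"
        using lf(1) K time by (intro mult_mono) auto
      then show "1 \<le> (2 * (1 + lf * (T - t0))) * exp (2 * K * (T - t0))" by simp
    qed
    finally show ?thesis by (simp add: stability_const_def K_def mult.commute)
  next
    case False
    have "norm (y s - x s) \<le> 2 * ?c * exp (2 * K * (T - t))"
    proof (rule weighted_gronwall[of t T "\<lambda>s. norm (y s - x s)" K "?c" s])
      show "continuous_on {t..T} (\<lambda>s. norm (y s - x s))"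
        using bd_nonneg by (intro continuous_intros continuous_on_subset[OF contx] continuous_on_subset[OF conty]) auto
      fix B r assume B: "B \<ge> 0" and r: "r \<in> {t..T}"
        and le: "\<And>q. q \<in> {t..r} \<Longrightarrow> norm (y q - x q) \<le> B * exp (2 * K * (q - t))"
      have "norm ((y r - y t) - (x r - x t)) \<le> lf * c * (r - t) + B / 2 * exp (2 * K * (r - t))"
      proof (rule norm_integral_exp_weight_le[of "\<lambda>s. along \<tau> f \<alpha> y s - along \<tau> f \<alpha> x s"])
        show "((\<lambda>s. along \<tau> f \<alpha> y s - along \<tau> f \<alpha> x s) has_integral ((y r - y t) - (x r - x t))) {t..r}"
          using r by (intro has_integral_diff traj_has_integral[OF x] traj_has_integral[OF y]) auto
        fix q assume q: "q \<in> {t<..<r}"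
        show "norm (along \<tau> f \<alpha> y q - along \<tau> f \<alpha> x q) \<le> lf * c + K * (B * exp (2 * K * (q - t)))"
          by (rule along_diff_weighted_le[OF M _ _ _ B c(1) K_def hist le])
            (use q r t \<alpha> in \<open>auto simp: controls_def\<close>)
      qed (use r B K in auto)
      moreover have "lf * c * (r - t) \<le> lf * c * (T - t0)"
        using r t c lf(1) by (intro mult_left_mono) auto
      moreover have "norm (y t - x t) \<le> c" using hist[of t] bd_nonneg by auto
      moreover have "norm (y r - x r) \<le> norm (y t - x t) + norm ((y r - y t) - (x r - x t))" by norm
      ultimately show "norm (y r - x r) \<le> ?c + B / 2 * exp (2 * K * (r - t))" by (simp add: algebra_simps)
    qed (use False s t c0 K in auto)
    also have "\<dots> \<le> 2 * ?c * exp (2 * K * (T - t0))"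
      using c0 t K by (intro mult_left_mono) auto
    finally show ?thesis by (simp add: stability_const_def K_def mult_ac)
  qed
qed

lemma traj_unique:
  assumes "traj t w \<alpha> x" "traj t w \<alpha> y" "t \<in> {t0..T}" "\<alpha> \<in> controls A t T" "s \<in> {t - bd..T}"
  shows "y s = x s"
proof -
  obtain M where "M-lipschitz_on {t - bd..T} x" using assms(1) by - (erule trajD, blast)
  then have "norm (y s - x s) \<le> stability_const M * 0"
    using assms by (intro traj_stability) auto
  then show ?thesis by simp
qed

end

section \<open>Existence of trajectories and dynamic programming\<close>

text \<open>Integrands built from a control are under control only inside the open interval.
  Continuation by zero to the end points changes no integral and gives access to the results for
  closed intervals.\<close>

lemma indefinite_integral_open_interval:
  fixes k :: "real \<Rightarrow> 'a::euclidean_space"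
  assumes k: "k \<in> borel_measurable (lebesgue_on {a<..<b})" and C: "\<And>s. s \<in> {a<..<b} \<Longrightarrow> norm (k s) \<le> C" "C \<ge> 0"
  shows "k integrable_on {a..b}" "C-lipschitz_on {a..b} (\<lambda>s. x0 + integral {a..s} k)"
    "negligible {s \<in> {a<..<b}. \<not> ((\<lambda>s. x0 + integral {a..s} k) has_vector_derivative k s) (at s)}"
proof -
  show int: "k integrable_on {a..b}" by (rule bounded_measurable_integrable_on_Icc[OF k C(1)])
  define k' where "k' s = (if s \<in> {a<..<b} then k s else 0)" for s
  have eq: "integral {a..s} k' = integral {a..s} k" if "s \<le> b" for s
    by (rule integral_spike[of "{a,b}"]) (use that in \<open>auto simp: k'_def\<close>)
  have k'C: "norm (k' s) \<le> C" for s using C by (auto simp: k'_def)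
  have "k' \<in> borel_measurable lebesgue"
    unfolding k'_def using k by (subst borel_measurable_if) auto
  then have k': "k' \<in> borel_measurable (lebesgue_on {a..b})"
    by (rule measurable_restrict_space1)
  have int': "k' integrable_on {a..b}"
    by (rule integrable_spike[OF int, of "{a,b}"]) (auto simp: k'_def)
  show "C-lipschitz_on {a..b} (\<lambda>s. x0 + integral {a..s} k)"
    using indefinite_integral_lipschitz[OF int' k'C C(2), of x0] by (rule lipschitz_on_transform) (simp add: eq)
  have "negligible {s \<in> {a<..<b}. \<not> ((\<lambda>s. x0 + integral {a..s} k') has_vector_derivative k' s) (at s)}"
    by (rule indefinite_integral_derivative_ae[OF k' k'C])
  then show "negligible {s \<in> {a<..<b}. \<not> ((\<lambda>s. x0 + integral {a..s} k) has_vector_derivative k s) (at s)}"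
  proof (rule negligible_subset, safe)
    fix s assume s: "s \<in> {a<..<b}" "((\<lambda>s. x0 + integral {a..s} k') has_vector_derivative k' s) (at s)"
      and "\<not> ((\<lambda>s. x0 + integral {a..s} k) has_vector_derivative k s) (at s)"
    moreover have "((\<lambda>s. x0 + integral {a..s} k) has_vector_derivative k' s) (at s)"
      by (rule has_vector_derivative_transform_within_open[OF s(2), of "{a<..<b}"]) (use s eq in auto)
    ultimately show False by (simp add: k'_def)
  qed
qed

lemma continuous_state_norm_le:
  assumes "continuous_on {-b..0} w" "\<And>\<theta>. \<theta> \<in> {-b..0} \<Longrightarrow> norm (w \<theta>) \<le> e" "b \<ge> 0"
  shows "state_norm b z w \<le> norm z + e * b"
proof -
  have int: "(\<lambda>\<theta>. norm (w \<theta>)) integrable_on {-b..0}"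
    using assms by (intro integrable_continuous_interval continuous_intros) auto
  have "integrable (lebesgue_on {-b..0}) (\<lambda>\<theta>. norm (w \<theta>))"
    using assms(1) by (intro continuous_imp_integrable_real continuous_intros) auto
  then have "(LINT \<theta>|lebesgue_on {-b..0}. norm (w \<theta>)) = integral {-b..0} (\<lambda>\<theta>. norm (w \<theta>))"
    by (rule lebesgue_integral_eq_integral) auto
  also have "\<dots> \<le> integral {-b..0} (\<lambda>\<theta>. e)"
    using int assms(2) by (intro integral_le) auto
  finally show ?thesis using assms(3) by (simp add: state_norm_def mult.commute)
qed

lemma controls_restrict:
  assumes "\<alpha> \<in> controls A r s" "r \<le> t"
  shows "\<alpha> \<in> controls A t s"
proof -
  have sub: "{t<..<s} \<subseteq> {r<..<s}" using assms(2) by auto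
  have "\<alpha> \<in> borel_measurable (lebesgue_on {t<..<s})"
    by (rule measurable_restrict_mono[OF _ sub]) (use assms(1) in \<open>simp add: controls_def\<close>)
  then show ?thesis using assms(1) sub by (auto simp: controls_def)
qed

lemma controls_concat:
  assumes \<alpha>: "\<alpha> \<in> controls A r s" and \<beta>: "\<beta> \<in> controls A t s" and t: "r < t" "t < s"
  shows "(\<lambda>q. if q \<le> t then \<alpha> q else \<beta> q) \<in> controls A r s"
proof -
  have sub: "{r<..t} \<subseteq> {r<..<s}" using t by auto
  have "\<alpha> \<in> borel_measurable (lebesgue_on {r<..t})"
    by (rule measurable_restrict_mono[OF _ sub]) (use \<alpha> in \<open>simp add: controls_def\<close>)
  then have 1: "(\<lambda>q. if q \<in> {r<..t} then \<alpha> q else 0) \<in> borel_measurable lebesgue"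
    by (subst borel_measurable_if) auto
  have 2: "(\<lambda>q. if q \<in> {t<..<s} then \<beta> q else 0) \<in> borel_measurable lebesgue"
    using \<beta> by (subst borel_measurable_if) (auto simp: controls_def)
  have "(\<lambda>q. if q \<in> {r<..<s} then (if q \<le> t then \<alpha> q else \<beta> q) else 0)
    = (\<lambda>q. (if q \<in> {r<..t} then \<alpha> q else 0) + (if q \<in> {t<..<s} then \<beta> q else 0))"
    using t by auto
  with borel_measurable_add[OF 1 2]
  have "(\<lambda>q. if q \<in> {r<..<s} then (if q \<le> t then \<alpha> q else \<beta> q) else 0) \<in> borel_measurable lebesgue"
    by simp
  then have "(\<lambda>q. if q \<le> t then \<alpha> q else \<beta> q) \<in> borel_measurable (lebesgue_on {r<..<s})"
    by (subst (asm) borel_measurable_if) auto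
  then show ?thesis using \<alpha> \<beta> by (auto simp: controls_def)
qed

lemma segment_Lip:
  assumes "C-lipschitz_on {s - b..s} x"
  shows "segment x s \<in> Lip b"
proof -
  have "C-lipschitz_on {-b..0} (segment x s)"
  proof (rule lipschitz_onI)
    fix \<theta> \<theta>' assume "\<theta> \<in> {-b..0}" "\<theta>' \<in> {-b..0}"
    then show "dist (segment x s \<theta>) (segment x s \<theta>') \<le> C * dist \<theta> \<theta>'"
      using lipschitz_onD[OF assms, of "s + \<theta>" "s + \<theta>'"] by (simp add: segment_def)
  qed (rule lipschitz_on_nonneg[OF assms])
  then show ?thesis by (auto simp: Lip_def)
qed

context delay_control_problem
begin

text \<open>Picard iteration in the weighted norm. Since the delayed time depends on the state, the
  contraction estimate for \<open>\<Psi>\<close> needs a common Lipschitz constant; the class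
  \<open>P\<close> fixes that constant, the history and a growth bound, and \<open>\<Psi>\<close>
  maps it into itself.\<close>

lemma traj_exists:
  assumes w: "w \<in> Lip bd" and t: "t \<in> {t0..<T}" and \<alpha>: "\<alpha> \<in> controls A t T"
  shows "\<exists>x. traj t w \<alpha> x"
proof -
  obtain Cw where Cw: "Cw \<ge> 0" "Cw-lipschitz_on {-bd..0} w" using w by (rule LipE)
  obtain R where R: "R > 0" "\<And>\<theta>. \<theta> \<in> {-bd..0} \<Longrightarrow> norm (w \<theta>) \<le> R" using w by - (erule Lip_bounded, blast)
  \<comment> \<open>The solution of \<open>\<mu>' = Cf * (1 + 2 * \<mu>)\<close> with
    \<open>\<mu> 0 = R\<close>, that is, the growth bound for \<open>f\<close> when current and
    delayed state are both at most \<open>\<mu>\<close>. Hence \<open>\<Psi>\<close> preserves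
    it.\<close>
  define \<mu> where "\<mu> r = (2 * R + 1) / 2 * exp (2 * Cf * r) - 1 / 2" for r :: real
  have \<mu>_mono: "\<mu> r \<le> \<mu> r'" if "r \<le> r'" for r r'
    unfolding \<mu>_def using that R(1) Cf(1) by (intro diff_right_mono mult_left_mono) auto
  have \<mu>0: "\<mu> 0 = R" by (simp add: \<mu>_def field_simps)
  have \<mu>_ge: "\<mu> r \<ge> R" if "r \<ge> 0" for r using \<mu>_mono[OF that] \<mu>0 by simp
  \<comment> \<open>\<open>Cw\<close> serves the history, the second entry bounds the velocity after
    \<open>t\<close> for every function in \<open>P\<close>. The latter comes from
    \<open>\<mu>\<close> alone, so the choice of \<open>M\<close> is not circular.\<close>
  define M where "M = max Cw (Cf * (1 + 2 * \<mu> (T - t)))"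
  have M: "M \<ge> Cw" "M \<ge> Cf * (1 + 2 * \<mu> (T - t))" "M \<ge> 0" using Cw(1) by (auto simp: M_def)
  define K where "K = lf * (2 + M * l\<tau>)"
  have K: "K > 0" unfolding K_def using lf(1) l\<tau>(1) M by (intro mult_pos_pos add_pos_nonneg) auto
  define P where "P x \<longleftrightarrow> M-lipschitz_on {t - bd..T} x \<and> (\<forall>s\<in>{t - bd..t}. x s = w (s - t))
    \<and> (\<forall>s\<in>{t..T}. norm (x s) \<le> \<mu> (s - t))" for x
  define \<Psi> where "\<Psi> x s = (if s \<le> t then w (s - t) else w 0 + integral {t..s} (along \<tau> f \<alpha> x))" for x s
  have hist: "norm (w (s - t)) \<le> R" if "s \<in> {t - bd..t}" for s using R(2) that by auto
  have k_meas: "along \<tau> f \<alpha> x \<in> borel_measurable (lebesgue_on {t<..<T})" if "P x" for x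
    using that t \<alpha> lipschitz_on_continuous_on[of M "{t - bd..T}" x]
    by (intro along_measurable[OF f_cont, of t]) (auto simp: controls_def P_def)
  have k_bound: "norm (along \<tau> f \<alpha> x q) \<le> Cf * (1 + 2 * \<mu> (q - t))" if x: "P x" and q: "q \<in> {t<..<T}" for x q
  proof -
    let ?d = "q - \<tau> q (x q)"
    have d: "?d \<in> {t - bd..q}" using q t by (intro delayed_in) auto
    have "norm (x ?d) \<le> \<mu> (q - t)"
    proof (cases "?d \<le> t")
      case True
      then have "norm (x ?d) \<le> R" using hist[of ?d] d x by (auto simp: P_def)
      then show ?thesis using \<mu>_ge[of "q - t"] q by auto
    next
      case False
      then have "norm (x ?d) \<le> \<mu> (?d - t)" using x d q by (auto simp: P_def)
      then show ?thesis using \<mu>_mono[of "?d - t" "q - t"] d by auto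
    qed
    moreover have "norm (x q) \<le> \<mu> (q - t)" using x q by (auto simp: P_def)
    moreover have "norm (along \<tau> f \<alpha> x q) \<le> Cf * (1 + norm (x q) + norm (x ?d))"
      unfolding along_def using q t \<alpha> by (intro Cf) (auto simp: controls_def)
    ultimately show ?thesis
      using Cf(1) by (smt (verit) mult_left_mono)
  qed
  have k_M: "norm (along \<tau> f \<alpha> x q) \<le> M" if "P x" "q \<in> {t<..<T}" for x q
  proof -
    have "Cf * (1 + 2 * \<mu> (q - t)) \<le> Cf * (1 + 2 * \<mu> (T - t))"
      using that Cf(1) \<mu>_mono[of "q - t" "T - t"] by (intro mult_left_mono) auto
    then show ?thesis using k_bound[OF that] M(2) by linarith
  qed
  note k_int = indefinite_integral_open_interval[OF k_meas k_M M(3)]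
  have P_\<Psi>: "P (\<Psi> x)" if x: "P x" for x
    unfolding P_def
  proof (intro conjI ballI)
    have "Cw-lipschitz_on {t - bd..t} (\<lambda>s. w (s - t))"
    proof (rule lipschitz_onI)
      fix s r assume "s \<in> {t - bd..t}" "r \<in> {t - bd..t}"
      then show "dist (w (s - t)) (w (r - t)) \<le> Cw * dist s r"
        using lipschitz_onD[OF Cw(2), of "s - t" "r - t"] by (simp add: dist_real_def)
    qed (rule Cw)
    then have "M-lipschitz_on {t - bd..t} (\<lambda>s. w (s - t))" using M(1) by (rule lipschitz_on_le)
    then show "M-lipschitz_on {t - bd..T} (\<Psi> x)"
      unfolding \<Psi>_def[abs_def] by (rule lipschitz_on_concat[OF _ k_int(2)[OF x x]]) auto
    show "\<Psi> x s = w (s - t)" if "s \<in> {t - bd..t}" for s using that by (simp add: \<Psi>_def)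
    fix s assume s: "s \<in> {t..T}"
    have "norm (integral {t..s} (along \<tau> f \<alpha> x)) \<le> \<mu> (s - t) - R"
    proof -
      have i1: "((\<lambda>r. Cf * ((2 * R + 1) * exp (2 * Cf * (r - t)))) has_integral (\<mu> (s - t) - R)) {t..s}"
        using exp_weight_integral[of t s Cf "2 * R + 1"] s Cf(1) by (simp add: \<mu>_def field_simps)
      have i2: "along \<tau> f \<alpha> x integrable_on {t..s}"
        using s by (intro integrable_subinterval_real[OF k_int(1)[OF x x]]) auto
      have "norm (integral {t<..<s} (along \<tau> f \<alpha> x)) \<le> integral {t<..<s} (\<lambda>r. Cf * ((2 * R + 1) * exp (2 * Cf * (r - t))))"
      proof (rule integral_norm_bound_integral)
        show "along \<tau> f \<alpha> x integrable_on {t<..<s}" using i2 by (simp add: integrable_on_open_interval_real)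
        show "(\<lambda>r. Cf * ((2 * R + 1) * exp (2 * Cf * (r - t)))) integrable_on {t<..<s}"
          using i1 by (auto simp: integrable_on_open_interval_real has_integral_iff)
        fix r assume "r \<in> {t<..<s}"
        then have "norm (along \<tau> f \<alpha> x r) \<le> Cf * (1 + 2 * \<mu> (r - t))" using s by (intro k_bound x) auto
        also have "\<dots> = Cf * ((2 * R + 1) * exp (2 * Cf * (r - t)))" by (simp add: \<mu>_def algebra_simps)
        finally show "norm (along \<tau> f \<alpha> x r) \<le> Cf * ((2 * R + 1) * exp (2 * Cf * (r - t)))" .
      qed
      then show ?thesis
        unfolding integral_open_interval[where 'a = real, simplified] integral_unique[OF i1] .
    qed
    moreover have "norm (w 0) \<le> R" using hist[of t] bd_nonneg by auto
    moreover have "\<Psi> x s = w 0 + integral {t..s} (along \<tau> f \<alpha> x)"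
      using s by (cases "s = t") (auto simp: \<Psi>_def)
    ultimately show "norm (\<Psi> x s) \<le> \<mu> (s - t)" by (smt (verit) norm_triangle_ineq)
  qed
  have contr: "norm (\<Psi> y s - \<Psi> x s) \<le> B / 2 * exp (2 * K * (s - t))"
    if x: "P x" and y: "P y" and B: "B \<ge> 0" and le: "\<And>r. r \<in> {t..T} \<Longrightarrow> norm (y r - x r) \<le> B * exp (2 * K * (r - t))"
      and s: "s \<in> {t..T}" for x y B s
  proof -
    have sub: "along \<tau> f \<alpha> x integrable_on {t..s}" if "P x" for x
      using s by (intro integrable_subinterval_real[OF k_int(1)[OF that that]]) auto
    have "norm (integral {t..s} (along \<tau> f \<alpha> y) - integral {t..s} (along \<tau> f \<alpha> x)) \<le> 0 * (s - t) + B / 2 * exp (2 * K * (s - t))"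
    proof (rule norm_integral_exp_weight_le)
      show "((\<lambda>r. along \<tau> f \<alpha> y r - along \<tau> f \<alpha> x r) has_integral
        (integral {t..s} (along \<tau> f \<alpha> y) - integral {t..s} (along \<tau> f \<alpha> x))) {t..s}"
        using sub[OF x] sub[OF y] by (intro has_integral_diff) auto
      fix q assume q: "q \<in> {t<..<s}"
      have "norm (along \<tau> f \<alpha> y q - along \<tau> f \<alpha> x q) \<le> lf * 0 + K * (B * exp (2 * K * (q - t)))"
        by (rule along_diff_weighted_le[of M t x q \<alpha> B 0 K y])
          (use q s t \<alpha> x y B le in \<open>auto simp: P_def K_def controls_def\<close>)
      then show "norm (along \<tau> f \<alpha> y q - along \<tau> f \<alpha> x q) \<le> 0 + K * (B * exp (2 * K * (q - t)))"
        by simp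
    qed (use s B K in auto)
    moreover have "\<Psi> y s - \<Psi> x s = integral {t..s} (along \<tau> f \<alpha> y) - integral {t..s} (along \<tau> f \<alpha> x)"
      using s by (cases "s = t") (auto simp: \<Psi>_def)
    ultimately show ?thesis by simp
  qed
  \<comment> \<open>The iteration starts from the history continued by the constant
    \<open>w 0\<close> beyond \<open>t\<close>.\<close>
  define X where "X n = (\<Psi> ^^ n) (\<lambda>s. w (min 0 (s - t)))" for n
  have X_Suc: "X (Suc n) = \<Psi> (X n)" for n by (simp add: X_def)
  have PX: "P (X n)" for n
  proof (induction n)
    case 0
    have "M-lipschitz_on {t - bd..T} (\<lambda>s. w (min 0 (s - t)))"
    proof (rule lipschitz_onI)
      fix s r assume "s \<in> {t - bd..T}" "r \<in> {t - bd..T}"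
      then have "dist (w (min 0 (s - t))) (w (min 0 (r - t))) \<le> Cw * dist (min 0 (s - t)) (min 0 (r - t))"
        using bd_nonneg by (intro lipschitz_onD[OF Cw(2)]) auto
      also have "\<dots> \<le> M * dist s r"
        using M Cw by (intro mult_mono) (auto simp: dist_real_def)
      finally show "dist (w (min 0 (s - t))) (w (min 0 (r - t))) \<le> M * dist s r" .
    qed (rule M)
    moreover have "norm (w (min 0 (s - t))) \<le> \<mu> (s - t)" if "s \<in> {t..T}" for s
      using that R(2)[of "min 0 (s - t)"] \<mu>_ge[of "s - t"] bd_nonneg by auto
    ultimately show ?case by (auto simp: P_def X_def min_absorb2)
  next
    case (Suc n)
    then show ?case unfolding X_Suc by (rule P_\<Psi>)
  qed
  \<comment> \<open>Two functions bounded by \<open>\<mu>\<close> differ by at most this; it starts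
    the geometric decay of successive differences.\<close>
  define B where "B = 2 * \<mu> (T - t)"
  have B: "B \<ge> 0" using \<mu>_ge[of "T - t"] R(1) t by (simp add: B_def)
  have step: "norm (X (Suc n) s - X n s) \<le> B * (1/2) ^ n * exp (2 * K * (s - t))" if "s \<in> {t..T}" for n s
    using that
  proof (induction n arbitrary: s)
    case 0
    have "norm (X m s) \<le> \<mu> (T - t)" for m
      using PX[of m] 0 \<mu>_mono[of "s - t" "T - t"] by (force simp: P_def)
    then have "norm (X (Suc 0) s - X 0 s) \<le> \<mu> (T - t) + \<mu> (T - t)"
      by (meson add_mono norm_triangle_le_diff)
    also have "\<dots> = B * 1" by (simp add: B_def)
    also have "\<dots> \<le> B * exp (2 * K * (s - t))" using 0 K B by (intro mult_left_mono) auto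
    finally show ?case by simp
  next
    case (Suc n)
    have "norm (\<Psi> (X (Suc n)) s - \<Psi> (X n) s) \<le> (B * (1/2) ^ n) / 2 * exp (2 * K * (s - t))"
      using Suc B by (intro contr PX) auto
    then show ?case by (simp add: X_Suc)
  qed
  \<comment> \<open>The geometric series of the step bounds: \<open>B\<close> times the largest
    weight, summed with ratio one half.\<close>
  define c where "c = 2 * B * exp (2 * K * (T - t))"
  have c: "c \<ge> 0" using B by (simp add: c_def)
  have dist_X: "norm (X (n + k) s - X n s) \<le> c * (1/2) ^ n" if s: "s \<in> {t - bd..T}" for n k s
  proof (cases "s \<le> t")
    case True
    then show ?thesis using PX[of n] PX[of "n + k"] s c by (auto simp: P_def)
  next
    case False
    have "norm (X (n + k) s - X n s) \<le> c * ((1/2) ^ n - (1/2) ^ (n + k))"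
    proof (induction k)
      case (Suc k)
      have "norm (X (Suc (n + k)) s - X (n + k) s) \<le> B * (1/2) ^ (n + k) * exp (2 * K * (s - t))"
        using s False by (intro step) auto
      also have "\<dots> \<le> B * (1/2) ^ (n + k) * exp (2 * K * (T - t))"
        using B s K by (intro mult_left_mono) auto
      also have "\<dots> = c * ((1/2) ^ (n + k) - (1/2) ^ (n + Suc k))" by (simp add: c_def)
      finally have "norm (X (Suc (n + k)) s - X (n + k) s) \<le> c * ((1/2) ^ (n + k) - (1/2) ^ (n + Suc k))" .
      moreover have "norm (X (n + Suc k) s - X n s) \<le> norm (X (Suc (n + k)) s - X (n + k) s) + norm (X (n + k) s - X n s)"
        by (simp, norm)
      ultimately show ?case using Suc by (simp add: algebra_simps)
    qed simp
    also have "\<dots> \<le> c * (1/2) ^ n" using c by (intro mult_left_mono) auto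
    finally show ?thesis .
  qed
  have half: "(\<lambda>n. C * (1/2) ^ n) \<longlonglongrightarrow> 0" for C :: real
    by (intro tendsto_mult_right_zero LIMSEQ_realpow_zero) auto
  define Y where "Y s = lim (\<lambda>n. X n s)" for s
  have XY: "(\<lambda>n. X n s) \<longlonglongrightarrow> Y s" if s: "s \<in> {t - bd..T}" for s
  proof -
    have "Cauchy (\<lambda>n. X n s)"
    proof (rule metric_CauchyI)
      fix e :: real assume e: "e > 0"
      then obtain N where N: "c * (1/2) ^ N < e / 2"
        using order_tendstoD(2)[OF half[of c], of "e / 2"] by (auto simp: eventually_sequentially)
      have *: "norm (X m s - X N s) < e / 2" if "m \<ge> N" for m
        using dist_X[OF s, of N "m - N"] that N by simp
      show "\<exists>N. \<forall>m\<ge>N. \<forall>n\<ge>N. dist (X m s) (X n s) < e"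
        using * by (intro exI[of _ N]) (metis dist_norm dist_triangle_half_l)
    qed
    then show ?thesis unfolding Y_def by (simp add: Cauchy_convergent_iff convergent_LIMSEQ_iff)
  qed
  have XYd: "norm (Y s - X n s) \<le> c * (1/2) ^ n" if s: "s \<in> {t - bd..T}" for n s
  proof (rule tendsto_upperbound)
    show "(\<lambda>k. norm (X (k + n) s - X n s)) \<longlonglongrightarrow> norm (Y s - X n s)"
      by (intro tendsto_intros LIMSEQ_ignore_initial_segment[OF XY[OF s]])
    show "\<forall>\<^sub>F k in sequentially. norm (X (k + n) s - X n s) \<le> c * (1/2) ^ n"
      using dist_X[OF s, of n] by (simp add: add.commute)
  qed simp
  have PY: "P Y"
    unfolding P_def
  proof (intro conjI ballI)
    show "M-lipschitz_on {t - bd..T} Y"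
    proof (rule lipschitz_onI[OF _ M(3)])
      fix s r assume sr: "s \<in> {t - bd..T}" "r \<in> {t - bd..T}"
      show "dist (Y s) (Y r) \<le> M * dist s r"
      proof (rule tendsto_upperbound)
        show "(\<lambda>n. dist (X n s) (X n r)) \<longlonglongrightarrow> dist (Y s) (Y r)" by (intro tendsto_intros XY sr)
        show "\<forall>\<^sub>F n in sequentially. dist (X n s) (X n r) \<le> M * dist s r"
          using PX sr by (auto simp: P_def intro!: always_eventually lipschitz_onD)
      qed simp
    qed
    show "Y s = w (s - t)" if "s \<in> {t - bd..t}" for s
    proof -
      have "X n s = w (s - t)" for n using PX[of n] that by (auto simp: P_def)
      moreover have "(\<lambda>n. X n s) \<longlonglongrightarrow> Y s" using that t by (intro XY) auto
      ultimately show ?thesis using LIMSEQ_unique[OF tendsto_const] by force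
    qed
    show "norm (Y s) \<le> \<mu> (s - t)" if "s \<in> {t..T}" for s
    proof (rule tendsto_upperbound)
      show "(\<lambda>n. norm (X n s)) \<longlonglongrightarrow> norm (Y s)" using that bd_nonneg by (intro tendsto_norm XY) auto
      show "\<forall>\<^sub>F n in sequentially. norm (X n s) \<le> \<mu> (s - t)"
        using PX that by (auto simp: P_def)
    qed simp
  qed
  have fix_Y: "\<Psi> Y s = Y s" if s: "s \<in> {t..T}" for s
  proof -
    have s': "s \<in> {t - bd..T}" using s bd_nonneg by auto
    have "norm (\<Psi> (X n) s - \<Psi> Y s) \<le> (c / 2 * exp (2 * K * (s - t))) * (1/2) ^ n" for n
    proof -
      have "norm (\<Psi> Y s - \<Psi> (X n) s) \<le> (c * (1/2) ^ n) / 2 * exp (2 * K * (s - t))"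
      proof (rule contr[OF PX PY _ _ s])
        fix r assume r: "r \<in> {t..T}"
        have "norm (Y r - X n r) \<le> c * (1/2) ^ n * 1" using XYd[of r n] r bd_nonneg by auto
        also have "\<dots> \<le> c * (1/2) ^ n * exp (2 * K * (r - t))"
          using r c K by (intro mult_left_mono) auto
        finally show "norm (Y r - X n r) \<le> c * (1/2) ^ n * exp (2 * K * (r - t))" .
      qed (use c in auto)
      then show ?thesis by (simp add: norm_minus_commute mult_ac)
    qed
    then have "(\<lambda>n. \<Psi> (X n) s - \<Psi> Y s) \<longlonglongrightarrow> 0"
      by (intro Lim_null_comparison[OF always_eventually half]) blast
    then have "(\<lambda>n. X (Suc n) s) \<longlonglongrightarrow> \<Psi> Y s" by (simp add: X_Suc LIM_zero_iff)
    then show ?thesis using LIMSEQ_Suc[OF XY[OF s']] LIMSEQ_unique by blast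
  qed
  have Y_eq: "Y s = w 0 + integral {t..s} (along \<tau> f \<alpha> Y)" if "s \<in> {t..T}" for s
    using fix_Y[OF that] that by (cases "s = t") (auto simp: \<Psi>_def)
  have "traj t w \<alpha> Y"
  proof (rule trajI)
    show "M-lipschitz_on {t - bd..T} Y" using PY by (simp add: P_def)
    show "Y (t + \<theta>) = w \<theta>" if "\<theta> \<in> {-bd..0}" for \<theta> using PY that by (auto simp: P_def)
    show "negligible {s \<in> {t<..<T}. \<not> (Y has_vector_derivative along \<tau> f \<alpha> Y s) (at s)}"
      using k_int(3)[OF PY PY, of "w 0"]
    proof (rule negligible_subset, safe)
      fix s assume s: "s \<in> {t<..<T}"
        "((\<lambda>s. w 0 + integral {t..s} (along \<tau> f \<alpha> Y)) has_vector_derivative along \<tau> f \<alpha> Y s) (at s)"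
        and *: "\<not> (Y has_vector_derivative along \<tau> f \<alpha> Y s) (at s)"
      have "(Y has_vector_derivative along \<tau> f \<alpha> Y s) (at s)"
        by (rule has_vector_derivative_transform_within_open[OF s(2), of "{t<..<T}"]) (use s Y_eq in auto)
      then show False using * by simp
    qed
  qed
  then show ?thesis by blast
qed

section \<open>Trajectory, cost and value as functions of the initial data\<close>

abbreviation trj where "trj \<equiv> trajectory bd T f \<tau>"
abbreviation cst where "cst \<equiv> cost bd T f L g \<tau>"
abbreviation val where "val \<equiv> value_function bd T A f L g \<tau>"

text \<open>The definite description ranges over extensional functions, where
  \<open>traj_unique\<close> yields equality of functions; the restriction of any solution is
  therefore the function described.\<close>

lemma trajectory_eq:
  assumes x: "traj t w \<alpha> x" and t: "t \<in> {t0..T}" and \<alpha>: "\<alpha> \<in> controls A t T" and s: "s \<in> {t - bd..T}"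
  shows "trj t w \<alpha> s = x s"
proof -
  have "trj t w \<alpha> = restrict x {t - bd..T}"
    unfolding trajectory_def
  proof (rule the_equality)
    show "restrict x {t - bd..T} \<in> extensional {t - bd..T} \<and> traj t w \<alpha> (restrict x {t - bd..T})"
      using t by (auto intro!: traj_cong[OF x])
    fix y assume y: "y \<in> extensional {t - bd..T} \<and> traj t w \<alpha> y"
    show "y = restrict x {t - bd..T}"
      using y traj_unique[OF x _ t \<alpha>, of y] by (intro extensionalityI[of _ "{t - bd..T}"]) auto
  qed
  then show ?thesis using s by simp
qed

lemma trajectory_traj:
  assumes "w \<in> Lip bd" "t \<in> {t0..<T}" "\<alpha> \<in> controls A t T"
  shows "traj t w \<alpha> (trj t w \<alpha>)"
proof -
  obtain x where x: "traj t w \<alpha> x" using traj_exists[OF assms] by blast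
  show ?thesis
    using assms trajectory_eq[OF x] by (intro traj_cong[OF x]) auto
qed

lemma traj_segment_Lip:
  assumes "traj t w \<alpha> x" "s \<in> {t..T}"
  shows "segment x s \<in> Lip bd"
proof -
  obtain C where C: "C-lipschitz_on {t - bd..T} x" using assms(1) by - (erule trajD, blast)
  show ?thesis
    by (rule segment_Lip[OF lipschitz_on_subset[OF C]]) (use assms in auto)
qed

text \<open>\<open>g\<close> takes total functions, but its Lipschitz bound is in a norm that sees
  only \<open>[-bd, 0]\<close>, and at distance zero the bound forces equality. Different
  representatives of a history thus have the same terminal cost.\<close>

lemma g_cong:
  assumes w: "w1 \<in> Lip bd" "w2 \<in> Lip bd" and eq: "\<And>\<theta>. \<theta> \<in> {-bd..0} \<Longrightarrow> w1 \<theta> = w2 \<theta>"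
    and z: "z1 = w1 0" "z2 = w2 0"
  shows "g z1 w1 = g z2 w2"
proof -
  obtain R where R: "R > 0" "\<And>\<theta>. \<theta> \<in> {-bd..0} \<Longrightarrow> norm (w1 \<theta>) \<le> R" using w(1) by - (erule Lip_bounded, blast)
  then have "w1 \<in> Lip_ball bd R" "w2 \<in> Lip_ball bd R" using w eq by (auto simp: Lip_ball_def)
  moreover have "(z1, w1) \<in> state_space bd" "(z2, w2) \<in> state_space bd"
    using w z by (auto simp: state_space_def)
  ultimately obtain lg where "\<bar>g z1 w1 - g z2 w2\<bar> \<le> lg * state_norm bd (z1 - z2) (\<lambda>\<theta>. w1 \<theta> - w2 \<theta>)"
    using g_lipschitz R(1) by blast
  moreover have "state_norm bd (z1 - z2) (\<lambda>\<theta>. w1 \<theta> - w2 \<theta>) = 0"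
  proof -
    have "(LINT \<theta>|lebesgue_on {-bd..0}. norm (w1 \<theta> - w2 \<theta>)) = (LINT \<theta>|lebesgue_on {-bd..0}. 0)"
      using eq by (intro Bochner_Integration.integral_cong) auto
    then show ?thesis using z eq[of 0] bd_nonneg by (simp add: state_norm_def)
  qed
  ultimately show ?thesis by simp
qed

lemma along_L_bounds:
  assumes x: "traj t w \<alpha> x" and t: "t \<in> {t0..<T}" and \<alpha>: "\<alpha> \<in> controls A t T"
    and S: "\<And>s. s \<in> {t - bd..T} \<Longrightarrow> norm (x s) \<le> S"
  shows "along \<tau> L \<alpha> x \<in> borel_measurable (lebesgue_on {t<..<T})"
    and "\<And>s. s \<in> {t<..<T} \<Longrightarrow> norm (along \<tau> L \<alpha> x s) \<le> CL * (1 + 2 * S)"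
    and "along \<tau> L \<alpha> x integrable_on {t..T}"
    and "(LINT s|lebesgue_on {t<..<T}. along \<tau> L \<alpha> x s) = integral {t..T} (along \<tau> L \<alpha> x)"
    and "\<bar>integral {t..T} (along \<tau> L \<alpha> x)\<bar> \<le> CL * (1 + 2 * S) * (T - t)"
proof -
  have "continuous_on {t - bd..T} x" using x by - (erule trajD, blast)
  then show m: "along \<tau> L \<alpha> x \<in> borel_measurable (lebesgue_on {t<..<T})"
    using t \<alpha> by (intro along_measurable[OF L_cont, of t]) (auto simp: controls_def)
  show b: "norm (along \<tau> L \<alpha> x s) \<le> CL * (1 + 2 * S)" if s: "s \<in> {t<..<T}" for s
  proof -
    have "s - \<tau> s (x s) \<in> {t - bd..s}" using s t by (intro delayed_in) auto
    then have "norm (x (s - \<tau> s (x s))) \<le> S" "norm (x s) \<le> S" using s bd_nonneg by (auto intro!: S)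
    then have "CL * (1 + norm (x s) + norm (x (s - \<tau> s (x s)))) \<le> CL * (1 + 2 * S)"
      using CL(1) by (intro mult_left_mono) auto
    moreover have "\<bar>along \<tau> L \<alpha> x s\<bar> \<le> CL * (1 + norm (x s) + norm (x (s - \<tau> s (x s))))"
      unfolding along_def using s t \<alpha> by (intro CL) (auto simp: controls_def)
    ultimately show ?thesis by simp
  qed
  have ai: "along \<tau> L \<alpha> x absolutely_integrable_on {t<..<T}"
    by (rule bounded_measurable_absolutely_integrable[OF m _ b]) auto
  show i: "along \<tau> L \<alpha> x integrable_on {t..T}"
    by (rule bounded_measurable_integrable_on_Icc[OF m b])
  have "(LINT s|lebesgue_on {t<..<T}. along \<tau> L \<alpha> x s) = integral {t<..<T} (along \<tau> L \<alpha> x)"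
    using ai by (intro lebesgue_integral_eq_integral) (auto simp: absolutely_integrable_on_def integrable_restrict_space set_integrable_def)
  then show "(LINT s|lebesgue_on {t<..<T}. along \<tau> L \<alpha> x s) = integral {t..T} (along \<tau> L \<alpha> x)"
    by (simp add: integral_open_interval[where 'a = real, simplified])
  have "norm (integral {t<..<T} (along \<tau> L \<alpha> x)) \<le> integral {t<..<T} (\<lambda>_. CL * (1 + 2 * S))"
    using i b by (intro integral_norm_bound_integral) (auto simp: integrable_on_open_interval_real)
  then show "\<bar>integral {t..T} (along \<tau> L \<alpha> x)\<bar> \<le> CL * (1 + 2 * S) * (T - t)"
    using t by (simp add: integral_open_interval[where 'a = real, simplified] mult_ac)
qed

lemma traj_bounded:
  assumes "traj t w \<alpha> x"
  obtains S where "S > 0" "\<And>s. s \<in> {t - bd..T} \<Longrightarrow> norm (x s) \<le> S"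
proof -
  have "continuous_on {t - bd..T} x" using assms by - (erule trajD, blast)
  then have "bounded (x ` {t - bd..T})"
    by (intro compact_imp_bounded compact_continuous_image) auto
  then show thesis using that unfolding bounded_pos by auto
qed

lemma cost_eq:
  assumes x: "traj t w \<alpha> x" and t: "t \<in> {t0..<T}" and \<alpha>: "\<alpha> \<in> controls A t T"
  shows "cst t w \<alpha> = integral {t..T} (along \<tau> L \<alpha> x) + g (x T) (segment x T)"
proof -
  obtain S where S: "\<And>s. s \<in> {t - bd..T} \<Longrightarrow> norm (x s) \<le> S" using x by - (erule traj_bounded, blast)
  have eq: "trj t w \<alpha> s = x s" if "s \<in> {t - bd..T}" for s
    using t that by (intro trajectory_eq[OF x _ \<alpha>]) auto
  have y: "traj t w \<alpha> (trj t w \<alpha>)"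
    using t eq by (intro traj_cong[OF x]) auto
  have "cst t w \<alpha> = (LINT s|lebesgue_on {t<..<T}. along \<tau> L \<alpha> (trj t w \<alpha>) s) + g (trj t w \<alpha> T) (segment (trj t w \<alpha>) T)"
    by (simp add: cost_def along_def Let_def)
  also have "(LINT s|lebesgue_on {t<..<T}. along \<tau> L \<alpha> (trj t w \<alpha>) s) = (LINT s|lebesgue_on {t<..<T}. along \<tau> L \<alpha> x s)"
    using t eq by (intro Bochner_Integration.integral_cong along_cong[of t]) auto
  also have "\<dots> = integral {t..T} (along \<tau> L \<alpha> x)" using along_L_bounds(4)[OF x t \<alpha> S] .
  also have "g (trj t w \<alpha> T) (segment (trj t w \<alpha>) T) = g (x T) (segment x T)"
    using t eq by (intro g_cong traj_segment_Lip[OF x] traj_segment_Lip[OF y]) (auto simp: segment_def)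
  finally show ?thesis .
qed

text \<open>A real infimum is known to be a lower bound only for a set bounded below. The state
  bound is uniform in the control, which bounds the running cost; the terminal cost is compared with
  that of the zero history.\<close>

lemma cost_bdd_below:
  assumes w: "w \<in> Lip bd" and t: "t \<in> {t0..<T}"
  shows "bdd_below (cst t w ` controls A t T)"
proof -
  obtain R where R: "R > 0" "\<And>\<theta>. \<theta> \<in> {-bd..0} \<Longrightarrow> norm (w \<theta>) \<le> R" using w by - (erule Lip_bounded, blast)
  define S where "S = state_bound R"
  have S: "S > 0" unfolding S_def state_bound_def using R(1) Cf(1) time
    by (intro mult_pos_pos add_pos_nonneg) auto
  obtain lg where lg: "lg > 0" "\<And>z1 w1 z2 w2. (z1, w1) \<in> state_space bd \<Longrightarrow> (z2, w2) \<in> state_space bd \<Longrightarrow>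
    w1 \<in> Lip_ball bd S \<Longrightarrow> w2 \<in> Lip_ball bd S \<Longrightarrow> \<bar>g z1 w1 - g z2 w2\<bar> \<le> lg * state_norm bd (z1 - z2) (\<lambda>\<theta>. w1 \<theta> - w2 \<theta>)"
    using g_lipschitz[rule_format, OF S] by (auto simp: case_prod_unfold Ball_def)
  have "- (CL * (1 + 2 * S) * (T - t)) + (g 0 (\<lambda>_. 0) - lg * (S + S * bd)) \<le> cst t w \<alpha>" if \<alpha>: "\<alpha> \<in> controls A t T" for \<alpha>
  proof -
    define x where "x = trj t w \<alpha>"
    have x: "traj t w \<alpha> x" unfolding x_def by (rule trajectory_traj[OF w t \<alpha>])
    have xS: "norm (x s) \<le> S" if "s \<in> {t - bd..T}" for s
      unfolding S_def using t R that by (intro traj_bound[OF x _ \<alpha>]) auto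
    have sL: "segment x T \<in> Lip bd" using t by (intro traj_segment_Lip[OF x]) auto
    have "continuous_on {t - bd..T} x" using x by - (erule trajD, blast)
    then have cont: "continuous_on {-bd..0} (segment x T)"
      unfolding segment_def using t by (elim continuous_on_compose2) (auto intro!: continuous_intros)
    have seg: "norm (segment x T \<theta>) \<le> S" if "\<theta> \<in> {-bd..0}" for \<theta>
      using that t by (auto simp: segment_def intro!: xS)
    have z: "(\<lambda>_. 0) \<in> Lip bd" by (auto simp: Lip_def intro!: exI[of _ 0] lipschitz_intros)
    have "\<bar>g (x T) (segment x T) - g 0 (\<lambda>_. 0)\<bar> \<le> lg * state_norm bd (x T - 0) (\<lambda>\<theta>. segment x T \<theta> - 0)"
      using sL z seg S by (intro lg) (auto simp: state_space_def Lip_ball_def segment_def)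
    also have "\<dots> \<le> lg * (S + S * bd)"
    proof (rule mult_left_mono)
      have "state_norm bd (x T) (segment x T) \<le> norm (x T) + S * bd"
        using cont seg bd_nonneg by (rule continuous_state_norm_le)
      then show "state_norm bd (x T - 0) (\<lambda>\<theta>. segment x T \<theta> - 0) \<le> S + S * bd"
        using xS[of T] t bd_nonneg by auto
    qed (use lg in auto)
    finally show ?thesis
      using along_L_bounds(5)[OF x t \<alpha> xS] cost_eq[OF x t \<alpha>] by linarith
  qed
  then show ?thesis by (rule bdd_belowI2)
qed

lemma value_le_cost:
  assumes "w \<in> Lip bd" "t \<in> {t0..<T}" "\<alpha> \<in> controls A t T"
  shows "val t w \<le> cst t w \<alpha>"
  unfolding value_function_def using assms by (auto intro!: cINF_lower cost_bdd_below)

section \<open>Restriction, concatenation and the principle of optimality\<close>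

lemma traj_restrict:
  assumes x: "traj r w \<alpha> x" and t: "r \<le> t" "t \<le> T"
  shows "traj t (segment x t) \<alpha> x"
proof -
  obtain C where C: "C-lipschitz_on {r - bd..T} x"
    and N: "negligible {s \<in> {r<..<T}. \<not> (x has_vector_derivative along \<tau> f \<alpha> x s) (at s)}"
    using x by - (erule trajD, blast)
  show ?thesis
    by (rule trajI[OF lipschitz_on_subset[OF C] negligible_subset[OF N]])
      (use t in \<open>auto simp: segment_def\<close>)
qed

lemma traj_concat:
  assumes x: "traj r w \<alpha> x" and t: "t0 \<le> r" "r < t" "t < T" and y: "traj t (segment x t) \<beta> y"
  shows "traj r w (\<lambda>q. if q \<le> t then \<alpha> q else \<beta> q) (\<lambda>q. if q \<le> t then x q else y q)" (is "traj r w ?\<gamma> ?z")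
proof -
  obtain C where C: "C-lipschitz_on {r - bd..T} x"
    and Nx: "negligible {s \<in> {r<..<T}. \<not> (x has_vector_derivative along \<tau> f \<alpha> x s) (at s)}"
    and xw: "\<And>\<theta>. \<theta> \<in> {-bd..0} \<Longrightarrow> x (r + \<theta>) = w \<theta>"
    using x by - (erule trajD, blast)
  obtain C' where C': "C'-lipschitz_on {t - bd..T} y"
    and Ny: "negligible {s \<in> {t<..<T}. \<not> (y has_vector_derivative along \<tau> f \<beta> y s) (at s)}"
    and yw: "\<And>\<theta>. \<theta> \<in> {-bd..0} \<Longrightarrow> y (t + \<theta>) = segment x t \<theta>"
    using y by - (erule trajD, blast)
  have xy: "y q = x q" if "q \<in> {t - bd..t}" for q
    using yw[of "q - t"] that by (auto simp: segment_def)
  have zy: "?z q = y q" if "q \<in> {t - bd..T}" for q using xy that by auto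
  show ?thesis
  proof (rule trajI)
    show "(max C C')-lipschitz_on {r - bd..T} ?z"
      using t bd_nonneg xy[of t]
      by (intro lipschitz_on_concat_max lipschitz_on_subset[OF C] lipschitz_on_subset[OF C']) auto
    show "?z (r + \<theta>) = w \<theta>" if "\<theta> \<in> {-bd..0}" for \<theta> using xw that t by auto
    let ?N = "{t} \<union> {s \<in> {r<..<T}. \<not> (x has_vector_derivative along \<tau> f \<alpha> x s) (at s)}
      \<union> {s \<in> {t<..<T}. \<not> (y has_vector_derivative along \<tau> f \<beta> y s) (at s)}"
    have "negligible ?N" using Nx Ny by (simp add: negligible_Un)
    then show "negligible {s \<in> {r<..<T}. \<not> (?z has_vector_derivative along \<tau> f ?\<gamma> ?z s) (at s)}"
    proof (rule negligible_subset, intro subsetI)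
      fix s assume s1: "s \<in> {s \<in> {r<..<T}. \<not> (?z has_vector_derivative along \<tau> f ?\<gamma> ?z s) (at s)}"
      have False if "s \<notin> ?N"
      proof (cases "s < t")
        case True
        then have "(x has_vector_derivative along \<tau> f \<alpha> x s) (at s)" using s1 that by auto
        moreover have "along \<tau> f ?\<gamma> ?z s = along \<tau> f \<alpha> x s"
          using True s1 t by (intro along_cong[of r]) auto
        ultimately have "(?z has_vector_derivative along \<tau> f ?\<gamma> ?z s) (at s)"
          using has_vector_derivative_transform_within_open[of x _ s "{r<..<t}" ?z] True s1 by auto
        then show False using s1 by auto
      next
        case False
        then have st: "s \<in> {t<..<T}" using s1 that by auto
        then have "(y has_vector_derivative along \<tau> f \<beta> y s) (at s)" using that by auto
        moreover have "along \<tau> f ?\<gamma> ?z s = along \<tau> f \<beta> y s"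
          using st t xy by (intro along_cong[of t]) auto
        ultimately have "(?z has_vector_derivative along \<tau> f ?\<gamma> ?z s) (at s)"
          using has_vector_derivative_transform_within_open[of y _ s "{t<..<T}" ?z] st by auto
        then show False using s1 by auto
      qed
      then show "s \<in> ?N" by blast
    qed
  qed
qed

lemma cost_concat:
  assumes x: "traj r w \<alpha> x" and t: "t0 \<le> r" "r < t" "t < T" and y: "traj t (segment x t) \<beta> y"
    and \<alpha>: "\<alpha> \<in> controls A r T" and \<beta>: "\<beta> \<in> controls A t T"
  shows "cst r w (\<lambda>q. if q \<le> t then \<alpha> q else \<beta> q) = integral {r..t} (along \<tau> L \<alpha> x) + cst t (segment x t) \<beta>"
proof -
  let ?\<gamma> = "\<lambda>q. if q \<le> t then \<alpha> q else \<beta> q" and ?z = "\<lambda>q. if q \<le> t then x q else y q"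
  have z: "traj r w ?\<gamma> ?z" by (rule traj_concat[OF x t y])
  have \<gamma>: "?\<gamma> \<in> controls A r T" by (rule controls_concat[OF \<alpha> \<beta> t(2,3)])
  have yw: "y (t + \<theta>) = segment x t \<theta>" if "\<theta> \<in> {-bd..0}" for \<theta>
    using y that by - (erule trajD, blast)
  have zy: "?z q = y q" if "q \<in> {t - bd..T}" for q
    using yw[of "q - t"] that by (auto simp: segment_def)
  obtain S where S: "\<And>s. s \<in> {r - bd..T} \<Longrightarrow> norm (?z s) \<le> S" using z by - (erule traj_bounded, blast)
  have rT: "r \<in> {t0..<T}" and tT: "t \<in> {t0..<T}" using t by auto
  have zi: "along \<tau> L ?\<gamma> ?z integrable_on {r..T}" by (rule along_L_bounds(3)[OF z rT \<gamma> S])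
  have "integral {r..T} (along \<tau> L ?\<gamma> ?z) = integral {r..t} (along \<tau> L ?\<gamma> ?z) + integral {t..T} (along \<tau> L ?\<gamma> ?z)"
    using t zi by (intro Henstock_Kurzweil_Integration.integral_combine[symmetric]) auto
  also have "integral {r..t} (along \<tau> L ?\<gamma> ?z) = integral {r..t} (along \<tau> L \<alpha> x)"
    using t by (intro Henstock_Kurzweil_Integration.integral_cong along_cong[of r]) auto
  also have "integral {t..T} (along \<tau> L ?\<gamma> ?z) = integral {t..T} (along \<tau> L \<beta> y)"
  proof (rule integral_spike[of "{t}"])
    show "along \<tau> L \<beta> y s = along \<tau> L ?\<gamma> ?z s" if "s \<in> {t..T} - {t}" for s
      using that t zy by (intro along_cong[of t]) auto
  qed simp
  finally have "integral {r..T} (along \<tau> L ?\<gamma> ?z) = integral {r..t} (along \<tau> L \<alpha> x) + integral {t..T} (along \<tau> L \<beta> y)" .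
  moreover have "g (?z T) (segment ?z T) = g (y T) (segment y T)"
    using t zy by (intro g_cong traj_segment_Lip[OF z] traj_segment_Lip[OF y]) (auto simp: segment_def)
  ultimately show ?thesis
    using cost_eq[OF z rT \<gamma>] cost_eq[OF y tT \<beta>] by simp
qed

text \<open>Were some \<open>\<beta>\<close> cheaper from \<open>t\<close> on, following
  \<open>\<alpha>\<close> up to \<open>t\<close> and \<open>\<beta>\<close> afterwards would beat
  \<open>\<alpha>\<close> from the start, since the running costs before \<open>t\<close> coincide
  and cancel.\<close>

lemma optimal_cost_le_value:
  assumes opt: "optimal_control bd T A f L g \<tau> r w \<alpha>" and w: "w \<in> Lip bd"
    and x: "traj r w \<alpha> x" and t: "t0 \<le> r" "r < t" "t < T"
  shows "cst t (segment x t) \<alpha> \<le> val t (segment x t)"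
proof -
  have \<alpha>: "\<alpha> \<in> controls A r T" using opt by (simp add: optimal_control_def)
  have seg: "segment x t \<in> Lip bd" using t by (intro traj_segment_Lip[OF x]) auto
  have \<alpha>t: "\<alpha> \<in> controls A t T" using \<alpha> t(2) by (intro controls_restrict[OF \<alpha>]) auto
  have tT: "t \<in> {t0..<T}" "r \<in> {t0..<T}" using t by auto
  have "cst t (segment x t) \<alpha> \<le> cst t (segment x t) \<beta>" if \<beta>: "\<beta> \<in> controls A t T" for \<beta>
  proof -
    let ?\<gamma> = "\<lambda>\<beta> q. if q \<le> t then \<alpha> q else \<beta> q"
    \<comment> \<open>Concatenating \<open>\<alpha>\<close> with itself gives back
      \<open>\<alpha>\<close>, so \<open>cost_concat\<close> splits both costs in the same
      way.\<close>
    have "cst r w (?\<gamma> \<alpha>) = cst r w \<alpha>" by simp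
    also have "\<dots> = val r w" using opt by (simp add: optimal_control_def)
    also have "\<dots> \<le> cst r w (?\<gamma> \<beta>)" using controls_concat[OF \<alpha> \<beta> t(2,3)] by (intro value_le_cost w tT)
    finally have "cst r w (?\<gamma> \<alpha>) \<le> cst r w (?\<gamma> \<beta>)" .
    then show ?thesis
      using cost_concat[OF x t traj_restrict[OF x] \<alpha> \<alpha>t] cost_concat[OF x t trajectory_traj[OF seg tT(1) \<beta>] \<alpha> \<beta>] t
      by simp
  qed
  then show ?thesis
    unfolding value_function_def using t \<alpha>t by (auto intro!: cINF_greatest)
qed

end

section \<open>The delayed time and its inverse\<close>

text \<open>\<open>gradient\<close> is a definite description. The representing vector exists
  because a linear form on a Euclidean space is an inner product, and it is unique because
  derivatives are.\<close>

lemma has_derivative_gradient: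
  fixes \<phi> :: "real^'n \<Rightarrow> real"
  assumes "\<phi> differentiable (at z)"
  shows "(\<phi> has_derivative (\<lambda>h. gradient \<phi> z \<bullet> h)) (at z)"
proof -
  obtain D where D: "(\<phi> has_derivative D) (at z)" using assms by (auto simp: differentiable_def)
  interpret D: bounded_linear D using D by (rule has_derivative_bounded_linear)
  define v where "v = (\<Sum>i\<in>Basis. D i *\<^sub>R i)"
  have "D = (\<lambda>h. h \<bullet> v)"
  proof
    fix h
    have "D h = D (\<Sum>i\<in>Basis. (h \<bullet> i) *\<^sub>R i)" by (simp add: euclidean_representation)
    also have "\<dots> = h \<bullet> v" by (simp add: D.sum D.scaleR v_def inner_sum_right mult.commute)
    finally show "D h = h \<bullet> v" .
  qed
  then have v: "GDERIV \<phi> z :> v" using D by (simp add: gderiv_def)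
  have "GDERIV \<phi> z :> gradient \<phi> z"
    unfolding gradient_def
  proof (rule theI[where P = "\<lambda>D. GDERIV \<phi> z :> D", OF v])
    fix v' assume "GDERIV \<phi> z :> v'"
    then have "(\<lambda>h. h \<bullet> v') = (\<lambda>h. h \<bullet> v)"
      using v unfolding gderiv_def by (rule has_derivative_unique)
    then show "v' = v" by (metis vector_eq_ldot)
  qed
  then show ?thesis by (simp add: gderiv_def inner_commute)
qed

lemma has_derivative_partials:
  assumes \<psi>: "(\<psi> has_derivative \<psi>') (at (z, y))"
    and A: "((\<lambda>z'. \<psi> (z', y)) has_derivative A) (at z)"
    and B: "((\<lambda>y'. \<psi> (z, y')) has_derivative B) (at y)"
  shows "\<psi>' (h, k) = A h + B k"
proof -
  interpret bounded_linear \<psi>' using \<psi> by (rule has_derivative_bounded_linear)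
  have "((\<lambda>z'. \<psi> (z', y)) has_derivative (\<lambda>h. \<psi>' (h, 0))) (at z)"
    by (rule has_derivative_compose[of "\<lambda>z'. (z', y)" "\<lambda>h. (h, 0)" z UNIV \<psi> \<psi>'])
      (auto intro!: derivative_eq_intros \<psi>)
  then have "A = (\<lambda>h. \<psi>' (h, 0))" using A has_derivative_unique by blast
  moreover have "((\<lambda>y'. \<psi> (z, y')) has_derivative (\<lambda>k. \<psi>' (0, k))) (at y)"
    by (rule has_derivative_compose[of "\<lambda>y'. (z, y')" "\<lambda>k. (0, k)" y UNIV \<psi> \<psi>'])
      (auto intro!: derivative_eq_intros \<psi>)
  then have "B = (\<lambda>k. \<psi>' (0, k))" using B has_derivative_unique by blast
  ultimately show ?thesis using add[of "(h, 0)" "(0, k)"] by simp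
qed

lemma negligible_lipschitz_image_real:
  fixes h :: "real \<Rightarrow> real"
  assumes "C-lipschitz_on S h" "negligible S"
  shows "negligible (h ` S)"
proof (rule negligible_locally_Lipschitz_image)
  fix r assume "r \<in> S"
  then show "\<exists>U B. open U \<and> r \<in> U \<and> (\<forall>y\<in>S \<inter> U. norm (h y - h r) \<le> B * norm (y - r))"
    using lipschitz_onD[OF assms(1)] by (intro exI[of _ UNIV] exI[of _ C]) (auto simp: dist_norm)
qed (use assms in auto)

locale controlled_trajectory = delay_control_problem t0 T A f L g \<tau>
  for t0 T :: real and A :: "(real^'m) set" and f L and g :: "real^'n \<Rightarrow> (real \<Rightarrow> real^'n) \<Rightarrow> real" and \<tau> +
  fixes ts :: real and ws :: "real \<Rightarrow> real^'n" and \<alpha> :: "real \<Rightarrow> real^'m" and x :: "real \<Rightarrow> real^'n"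
  assumes ts: "ts \<in> {t0..<T}" and ws: "ws \<in> Lip bd" and \<alpha>: "\<alpha> \<in> controls A ts T" and x: "traj ts ws \<alpha> x"
begin

definition D where "D s = s - \<tau> s (x s)"
definition \<gamma> where "\<gamma> = the_inv_into {ts..T} D"
text \<open>Written with the right-hand side of the state equation in place of the velocity; it
  agrees with the expression in \<open>monotone_delay\<close> wherever the state equation
  holds.\<close>

definition D' where "D' s = 1 - \<tau>\<^sub>t t0 T \<tau> s (x s) - \<tau>\<^sub>z \<tau> s (x s) \<bullet> along \<tau> f \<alpha> x s"
definition xC where "xC = (SOME C. C-lipschitz_on {ts - bd..T} x)"

lemma D_in: "s \<in> {ts..T} \<Longrightarrow> D s \<in> {ts - bd..s}"
  unfolding D_def using ts by (intro delayed_in) auto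

lemma xC: "xC-lipschitz_on {ts - bd..T} x"
proof -
  have "\<exists>C. C-lipschitz_on {ts - bd..T} x" using x by (auto simp: is_trajectory_def)
  then show ?thesis unfolding xC_def by (rule someI_ex)
qed

text \<open>Differentiability is assumed relative to the closed strip, and
  \<open>\<tau>\<^sub>t\<close> is taken within \<open>{t0..T}\<close>. At interior times both are
  unrestricted, and the total derivative splits into its two partial ones.\<close>

lemma \<tau>_partials:
  assumes "s \<in> {t0<..<T}"
  shows "((\<lambda>(s, z). \<tau> s z) has_derivative (\<lambda>(h, k). h * \<tau>\<^sub>t t0 T \<tau> s z + \<tau>\<^sub>z \<tau> s z \<bullet> k)) (at (s, z))"
proof -
  let ?\<tau> = "\<lambda>(s, z). \<tau> s z"
  have "?\<tau> differentiable (at (s, z) within {t0..T} \<times> UNIV)"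
    using \<tau>_differentiable assms by auto
  then have "?\<tau> differentiable (at (s, z) within {t0<..<T} \<times> UNIV)"
    by (rule differentiable_within_subset) auto
  moreover have "open ({t0<..<T} \<times> (UNIV :: (real^'n) set))" by (intro open_Times) auto
  ultimately have "?\<tau> differentiable (at (s, z))"
    using assms by (subst (asm) at_within_open) auto
  then obtain \<tau>' where \<tau>': "(?\<tau> has_derivative \<tau>') (at (s, z))" by (auto simp: differentiable_def)
  have "((\<lambda>s'. ?\<tau> (s', z)) has_derivative (\<lambda>h. \<tau>' (h, 0))) (at s)"
    by (rule has_derivative_compose[of "\<lambda>s'. (s', z)" "\<lambda>h. (h, 0)" s UNIV ?\<tau> \<tau>'])
      (auto intro!: derivative_eq_intros \<tau>')
  then have "(\<lambda>s'. \<tau> s' z) differentiable (at s)" by (auto simp: differentiable_def)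
  then have "((\<lambda>s'. \<tau> s' z) has_vector_derivative vector_derivative (\<lambda>s'. \<tau> s' z) (at s)) (at s)"
    by (simp add: vector_derivative_works)
  moreover have "vector_derivative (\<lambda>s'. \<tau> s' z) (at s) = \<tau>\<^sub>t t0 T \<tau> s z"
    using assms at_within_Icc_at[of t0 s T] by (simp add: \<tau>\<^sub>t_def)
  ultimately have t: "((\<lambda>s'. ?\<tau> (s', z)) has_derivative (\<lambda>h. h * \<tau>\<^sub>t t0 T \<tau> s z)) (at s)"
    by (simp add: has_vector_derivative_def)
  have "((\<lambda>z'. ?\<tau> (s, z')) has_derivative (\<lambda>h. \<tau>' (0, h))) (at z)"
    by (rule has_derivative_compose[of "\<lambda>z'. (s, z')" "\<lambda>k. (0, k)" z UNIV ?\<tau> \<tau>'])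
      (auto intro!: derivative_eq_intros \<tau>')
  then have "(\<tau> s) differentiable (at z)" by (auto simp: differentiable_def)
  then have "((\<lambda>z'. ?\<tau> (s, z')) has_derivative (\<lambda>k. \<tau>\<^sub>z \<tau> s z \<bullet> k)) (at z)"
    unfolding \<tau>\<^sub>z_def using has_derivative_gradient by simp
  from has_derivative_partials[OF \<tau>' t this]
  have "\<tau>' = (\<lambda>(h, k). h * \<tau>\<^sub>t t0 T \<tau> s z + \<tau>\<^sub>z \<tau> s z \<bullet> k)" by auto
  then show ?thesis using \<tau>' by simp
qed

lemma D_has_derivative:
  assumes s: "s \<in> {ts<..<T}" and v: "(x has_vector_derivative along \<tau> f \<alpha> x s) (at s)"
  shows "(D has_field_derivative D' s) (at s)"
proof -
  have "((\<lambda>r. (r, x r)) has_derivative (\<lambda>h. (h, h *\<^sub>R along \<tau> f \<alpha> x s))) (at s)"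
    using v by (auto intro!: derivative_eq_intros simp: has_vector_derivative_def)
  from has_derivative_compose[OF this, of "\<lambda>(s, z). \<tau> s z", OF \<tau>_partials]
  have "((\<lambda>r. \<tau> r (x r)) has_derivative (\<lambda>h. h * \<tau>\<^sub>t t0 T \<tau> s (x s) + \<tau>\<^sub>z \<tau> s (x s) \<bullet> (h *\<^sub>R along \<tau> f \<alpha> x s))) (at s)"
    using s ts by simp
  then have "(D has_derivative (\<lambda>h. h - (h * \<tau>\<^sub>t t0 T \<tau> s (x s) + \<tau>\<^sub>z \<tau> s (x s) \<bullet> (h *\<^sub>R along \<tau> f \<alpha> x s)))) (at s)"
    unfolding D_def[abs_def] by (intro has_derivative_diff has_derivative_ident)
  moreover have "(\<lambda>h. h - (h * \<tau>\<^sub>t t0 T \<tau> s (x s) + \<tau>\<^sub>z \<tau> s (x s) \<bullet> (h *\<^sub>R along \<tau> f \<alpha> x s))) = (*) (D' s)"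
    by (rule ext) (simp add: D'_def algebra_simps)
  ultimately show ?thesis by (simp add: has_field_derivative_def)
qed

lemma slope_ex: "\<exists>d>0. negligible {s \<in> {ts<..<T}. \<not> ((x has_vector_derivative along \<tau> f \<alpha> x s) (at s) \<and> D' s \<ge> d)}"
proof -
  obtain R where R: "R > 0" "\<And>\<theta>. \<theta> \<in> {-bd..0} \<Longrightarrow> norm (ws \<theta>) \<le> R" using ws by - (erule Lip_bounded, blast)
  have "ws \<in> Lip_ball bd R" using ws R by (auto simp: Lip_ball_def)
  moreover obtain d where d0: "d > 0" and "\<forall>t\<in>{t0..<T}. \<forall>w\<in>Lip_ball bd R. \<forall>\<alpha>\<in>controls A t T.
      \<forall>x. traj t w \<alpha> x \<longrightarrow> (AE s in lebesgue_on {t..T}.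
               1 - \<tau>\<^sub>t t0 T \<tau> s (x s) - \<tau>\<^sub>z \<tau> s (x s) \<bullet> vector_derivative x (at s) \<ge> d)"
    using monotone_delay[rule_format, OF R(1)] by blast
  ultimately have d: "AE s in lebesgue_on {ts..T}.
               1 - \<tau>\<^sub>t t0 T \<tau> s (x s) - \<tau>\<^sub>z \<tau> s (x s) \<bullet> vector_derivative x (at s) \<ge> d"
    using ts \<alpha> x by blast
  have n1: "negligible {s \<in> {ts..T}. \<not> 1 - \<tau>\<^sub>t t0 T \<tau> s (x s) - \<tau>\<^sub>z \<tau> s (x s) \<bullet> vector_derivative x (at s) \<ge> d}"
    using d by (subst (asm) AE_lebesgue_on_iff_negligible) auto
  have n2: "negligible {s \<in> {ts<..<T}. \<not> (x has_vector_derivative along \<tau> f \<alpha> x s) (at s)}"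
    using x by - (erule trajD, blast)
  have "negligible {s \<in> {ts<..<T}. \<not> ((x has_vector_derivative along \<tau> f \<alpha> x s) (at s) \<and> D' s \<ge> d)}"
    by (rule negligible_subset[OF negligible_Un[OF n1 n2]]) (auto simp: D'_def dest!: vector_derivative_at)
  then show ?thesis using d0 by blast
qed

section \<open>Regular times, Lipschitz bounds for \<open>D\<close> and its inverse\<close>

definition slope where "slope = (SOME d. d > 0 \<and>
  negligible {s \<in> {ts<..<T}. \<not> ((x has_vector_derivative along \<tau> f \<alpha> x s) (at s) \<and> D' s \<ge> d)})"

definition regular where
  "regular = {s \<in> {ts<..<T}. (x has_vector_derivative along \<tau> f \<alpha> x s) (at s) \<and> D' s \<ge> slope}"

lemma slope: "slope > 0" and negligible_irregular: "negligible ({ts<..<T} - regular)"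
proof -
  note * = someI_ex[OF slope_ex, folded slope_def]
  show "slope > 0" using * by simp
  show "negligible ({ts<..<T} - regular)" using *[THEN conjunct2] by (rule negligible_subset) (auto simp: regular_def)
qed

lemma regularD:
  assumes "s \<in> regular"
  shows "s \<in> {ts<..<T}" "(x has_vector_derivative along \<tau> f \<alpha> x s) (at s)" "D' s \<ge> slope"
    "(D has_field_derivative D' s) (at s)"
  using assms D_has_derivative by (auto simp: regular_def)

text \<open>For \<open>\<tau>\<close> a global Lipschitz bound is given only in the state. In time,
  the bound on \<open>\<tau>\<^sub>t\<close> comes from compactness, since \<open>x\<close> stays in
  a ball.\<close>

lemma D_lipschitz_ex: "\<exists>C. C-lipschitz_on {ts..T} D"
proof -
  obtain R where R: "R > 0" "\<And>s. s \<in> {ts - bd..T} \<Longrightarrow> norm (x s) \<le> R" using x by - (erule traj_bounded, blast)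
  have "compact ({t0..T} \<times> cball (0::real^'n) R)" by (intro compact_Times) auto
  then have "bounded ((\<lambda>(t, z). \<tau>\<^sub>t t0 T \<tau> t z) ` ({t0..T} \<times> cball 0 R))"
    by (intro compact_imp_bounded compact_continuous_image continuous_on_subset[OF \<tau>\<^sub>t_cont]) auto
  then obtain B where B: "B > 0" "\<And>t z. t \<in> {t0..T} \<Longrightarrow> norm z \<le> R \<Longrightarrow> \<bar>\<tau>\<^sub>t t0 T \<tau> t z\<bar> \<le> B"
    unfolding bounded_pos by force
  have time_lip: "\<bar>\<tau> s z - \<tau> r z\<bar> \<le> B * \<bar>s - r\<bar>" if "norm z \<le> R" "s \<in> {t0..T}" "r \<in> {t0..T}" for s r z
  proof -
    have "norm (\<tau> s z - \<tau> r z) \<le> B * norm (s - r)"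
    proof (rule field_differentiable_bound[of "{t0..T}" "\<lambda>s. \<tau> s z" "\<lambda>s. \<tau>\<^sub>t t0 T \<tau> s z"])
      fix q assume q: "q \<in> {t0..T}"
      have "(\<lambda>(t, z). \<tau> t z) differentiable (at (q, z) within {t0..T} \<times> UNIV)"
        using \<tau>_differentiable q by auto
      then obtain \<tau>' where "((\<lambda>(t, z). \<tau> t z) has_derivative \<tau>') (at (q, z) within {t0..T} \<times> UNIV)"
        unfolding differentiable_def by blast
      then have "((\<lambda>(t, z). \<tau> t z) has_derivative \<tau>') (at (q, z) within (\<lambda>s. (s, z)) ` {t0..T})"
        by (rule has_derivative_subset) auto
      then have "((\<lambda>s. (\<lambda>(t, z). \<tau> t z) (s, z)) has_derivative (\<lambda>h. \<tau>' (h, 0))) (at q within {t0..T})"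
        by (rule has_derivative_in_compose[of "\<lambda>s. (s, z)" "\<lambda>h. (h, 0)", rotated])
          (auto intro!: derivative_eq_intros)
      then have "(\<lambda>s. \<tau> s z) differentiable (at q within {t0..T})" by (auto simp: differentiable_def)
      then show "((\<lambda>s. \<tau> s z) has_field_derivative \<tau>\<^sub>t t0 T \<tau> q z) (at q within {t0..T})"
        by (simp add: \<tau>\<^sub>t_def vector_derivative_works has_real_derivative_iff_has_vector_derivative)
      show "norm (\<tau>\<^sub>t t0 T \<tau> q z) \<le> B" using B q that by simp
    qed (use that in auto)
    then show ?thesis by simp
  qed
  have xC0: "xC \<ge> 0" using xC by (rule lipschitz_on_nonneg)
  have "(1 + B + l\<tau> * xC)-lipschitz_on {ts..T} D"
  proof (rule lipschitz_onI)
    fix s r assume sr: "s \<in> {ts..T}" "r \<in> {ts..T}"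
    have "\<bar>\<tau> s (x s) - \<tau> r (x s)\<bar> \<le> B * \<bar>s - r\<bar>"
      using sr ts R bd_nonneg by (intro time_lip) auto
    moreover have "\<bar>\<tau> r (x s) - \<tau> r (x r)\<bar> \<le> l\<tau> * norm (x s - x r)" using sr ts by (intro l\<tau>) auto
    moreover have "norm (x s - x r) \<le> xC * \<bar>s - r\<bar>"
      using lipschitz_onD[OF xC, of s r] sr bd_nonneg by (auto simp: dist_norm)
    then have "l\<tau> * norm (x s - x r) \<le> l\<tau> * (xC * \<bar>s - r\<bar>)" using l\<tau>(1) by (intro mult_left_mono) auto
    ultimately have "\<bar>D s - D r\<bar> \<le> \<bar>s - r\<bar> + B * \<bar>s - r\<bar> + l\<tau> * (xC * \<bar>s - r\<bar>)"
      unfolding D_def by linarith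
    then show "dist (D s) (D r) \<le> (1 + B + l\<tau> * xC) * dist s r" by (simp add: dist_real_def algebra_simps)
  qed (use B xC0 l\<tau>(1) in auto)
  then show ?thesis ..
qed

text \<open>The slope bound holds only almost everywhere; because \<open>D\<close> is Lipschitz, its
  increments are integrals of \<open>D'\<close>, and the bound integrates.\<close>

lemma D_expanding:
  assumes "ts \<le> r" "r \<le> s" "s \<le> T"
  shows "D s - D r \<ge> slope * (s - r)"
proof -
  obtain C where C: "C-lipschitz_on {ts..T} D" using D_lipschitz_ex by blast
  have i: "(D' has_integral (D s - D r)) {r..s}"
  proof (rule lipschitz_on_has_integral[OF lipschitz_on_subset[OF C] _ negligible_irregular])
    fix q assume "q \<in> {r<..<s} - ({ts<..<T} - regular)"
    then have "q \<in> regular" using assms by auto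
    then show "(D has_vector_derivative D' q) (at q)"
      using regularD(4) by (simp add: has_real_derivative_iff_has_vector_derivative)
  qed (use assms in auto)
  have "((\<lambda>q. slope) has_integral slope * (s - r)) {r..s}"
    using has_integral_const_real[of slope r s] assms by (simp add: mult.commute)
  \<comment> \<open>The comparison of integrals asks for the inequality at every point, so the
    constant is replaced by \<open>D'\<close> itself on the exceptional null set.\<close>
  then have "((\<lambda>q. if q \<in> {ts, T} \<union> ({ts<..<T} - regular) then D' q else slope) has_integral slope * (s - r)) {r..s}"
    by (rule has_integral_spike[of "{ts, T} \<union> ({ts<..<T} - regular)", rotated 2]) (use negligible_irregular in auto)
  then show ?thesis
    using i by (rule has_integral_le) (use assms regularD(3) in force)
qed

lemma D_strict_mono: "ts \<le> r \<Longrightarrow> r < s \<Longrightarrow> s \<le> T \<Longrightarrow> D r < D s"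
  using D_expanding[of r s] slope by (smt (verit) mult_pos_pos)

lemma D_inj: "inj_on D {ts..T}"
  by (rule inj_onI) (metis D_strict_mono atLeastAtMost_iff less_irrefl linorder_less_linear)

lemma \<gamma>_D: "s \<in> {ts..T} \<Longrightarrow> \<gamma> (D s) = s"
  unfolding \<gamma>_def by (rule the_inv_into_f_f[OF D_inj])

lemma D_cont: "continuous_on {ts..T} D"
  using D_lipschitz_ex lipschitz_on_continuous_on by blast

lemma D_image: "ts \<le> r \<Longrightarrow> r \<le> s \<Longrightarrow> s \<le> T \<Longrightarrow> D ` {r..s} = {D r..D s}"
proof
  assume *: "ts \<le> r" "r \<le> s" "s \<le> T"
  show "D ` {r..s} \<subseteq> {D r..D s}"
  proof safe
    fix q assume "q \<in> {r..s}"
    then show "D q \<in> {D r..D s}"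
      using * D_strict_mono[of r q] D_strict_mono[of q s] by (cases "q = r"; cases "q = s") auto
  qed
  show "{D r..D s} \<subseteq> D ` {r..s}"
  proof
    fix q assume "q \<in> {D r..D s}"
    then obtain p where "r \<le> p" "p \<le> s" "D p = q"
      using IVT'[of D r q s] * continuous_on_subset[OF D_cont, of "{r..s}"] by auto
    then show "q \<in> D ` {r..s}" by auto
  qed
qed

lemma \<gamma>_lipschitz: "(1 / slope)-lipschitz_on {D ts..D T} \<gamma>"
proof (rule lipschitz_onI)
  have *: "\<bar>s - r\<bar> \<le> (1 / slope) * \<bar>D s - D r\<bar>" if "ts \<le> r" "r \<le> s" "s \<le> T" for r s
    using D_expanding[OF that] slope that by (simp add: field_simps)
  fix q q' assume "q \<in> {D ts..D T}" "q' \<in> {D ts..D T}"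
  moreover have "{D ts..D T} = D ` {ts..T}" using D_image[of ts T] ts by simp
  ultimately obtain s s' where s: "s \<in> {ts..T}" "q = D s" "s' \<in> {ts..T}" "q' = D s'" by auto
  show "dist (\<gamma> q) (\<gamma> q') \<le> (1 / slope) * dist q q'"
    using *[of s s'] *[of s' s] s by (cases "s \<le> s'") (auto simp: \<gamma>_D dist_real_def abs_minus_commute)
qed (use slope in auto)

text \<open>A preimage under \<open>D\<close> is an image under \<open>\<gamma>\<close>, and
  Lipschitz maps preserve null sets. In this way a property of almost every time holds at the
  delayed time \<open>D s\<close> for almost every \<open>s\<close>.\<close>

lemma negligible_D_vimage:
  assumes "negligible N"
  shows "negligible {s \<in> {ts..T}. D s \<in> N}"
proof -
  have "negligible (\<gamma> ` (N \<inter> {D ts..D T}))"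
    using assms by (intro negligible_lipschitz_image_real[OF lipschitz_on_subset[OF \<gamma>_lipschitz]]) (auto simp: negligible_Int)
  then show ?thesis
  proof (rule negligible_subset, safe)
    fix s assume s: "s \<in> {ts..T}" "D s \<in> N"
    have "D s \<in> {D ts..D T}" using s D_image[of ts T] ts by auto
    then show "s \<in> \<gamma> ` (N \<inter> {D ts..D T})" using s \<gamma>_D[of s] by (intro image_eqI[of _ _ "D s"]) auto
  qed
qed

lemma \<gamma>_has_derivative:
  assumes s: "s \<in> regular"
  shows "(\<gamma> has_field_derivative inverse (D' s)) (at (D s))"
proof -
  have s': "s \<in> {ts<..<T}" using s by (rule regularD)
  have lt: "D ts < D s" "D s < D T" using s' by (auto intro!: D_strict_mono)
  show ?thesis
  proof (rule DERIV_inverse_function[where f = D and g = \<gamma> and a = "D ts" and b = "D T"])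
    show "(D has_field_derivative D' s) (at (\<gamma> (D s)))" using regularD(4)[OF s] s' by (simp add: \<gamma>_D)
    show "D' s \<noteq> 0" using regularD(3)[OF s] slope by simp
    show "isCont \<gamma> (D s)"
      using lipschitz_on_continuous_on[OF \<gamma>_lipschitz] lt
      by (intro continuous_on_interior[of "{D ts..D T}"]) auto
    fix q assume "D ts < q" "q < D T"
    then have "q \<in> D ` {ts..T}" using D_image[of ts T] ts by auto
    then obtain r where "r \<in> {ts..T}" "q = D r" by blast
    then show "D (\<gamma> q) = q" by (simp add: \<gamma>_D)
  qed (use lt in auto)
qed

text \<open>\<open>q\<close> has the form in which the adjoint equation presents the advanced term,
  with the indicator of \<open>[ts, D T]\<close>. The substitution at regular times leads to an
  integral over \<open>[D t, D T]\<close>. As \<open>D t \<le> t\<close>, \<open>D T \<le> T\<close>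
  and \<open>\<delta>\<close> vanishes up to \<open>t\<close>, passing to \<open>[t, T]\<close>
  changes nothing.\<close>

lemma delayed_change_of_variables:
  fixes k \<delta> :: "real \<Rightarrow> real^'n"
  assumes t: "t \<in> {ts..T}"
    and kd: "(\<lambda>s. k s \<bullet> \<delta> (D s)) absolutely_integrable_on {t<..<T}"
    and \<delta>0: "\<And>r. r \<le> t \<Longrightarrow> \<delta> r = 0"
  defines "q \<equiv> \<lambda>r. if r \<in> {ts..D T} then vector_derivative \<gamma> (at r) *\<^sub>R (k (\<gamma> r) \<bullet> \<delta> r) else 0"
  shows "q absolutely_integrable_on {t..T}" "integral {t..T} q = integral {t..T} (\<lambda>s. k s \<bullet> \<delta> (D s))"
proof -
  define S where "S = {t<..<T} \<inter> regular"
  let ?h = "\<lambda>s. k s \<bullet> \<delta> (D s)"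
  define q0 where "q0 r = vector_derivative \<gamma> (at r) * (k (\<gamma> r) \<bullet> \<delta> r)" for r
  have neg: "negligible ({t<..<T} - S)"
    by (rule negligible_subset[OF negligible_irregular]) (use t in \<open>auto simp: S_def\<close>)
  have "S = {t<..<T} - ({t<..<T} - S)" by (auto simp: S_def)
  then have Sm: "S \<in> sets lebesgue"
    using neg by (metis fmeasurableD lmeasurable_interval(2) negligible_imp_sets sets.Diff)
  have symS: "negligible {s \<in> {t<..<T} - S. F s \<noteq> 0}" "negligible {s \<in> S - {t<..<T}. F s \<noteq> 0}" for F :: "real \<Rightarrow> real"
  proof -
    show "negligible {s \<in> {t<..<T} - S. F s \<noteq> 0}" by (rule negligible_subset[OF neg]) auto
    show "negligible {s \<in> S - {t<..<T}. F s \<noteq> 0}" by (rule negligible_subset[of "{}"]) (auto simp: S_def)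
  qed
  have hS: "?h absolutely_integrable_on S" "integral S ?h = integral {t..T} ?h"
  proof -
    show "?h absolutely_integrable_on S"
      by (rule set_integrable_subset[OF kd Sm]) (auto simp: S_def)
    have "integral S ?h = integral {t<..<T} ?h" by (rule integral_spike_set[OF symS(2,1)])
    then show "integral S ?h = integral {t..T} ?h"
      by (simp add: integral_open_interval[where 'a = real, simplified])
  qed
  \<comment> \<open>The derivative of \<open>\<gamma>\<close> at \<open>D s\<close> is the inverse
    of \<open>D' s\<close>, so it cancels the Jacobian factor of the substitution.\<close>
  have eq: "\<bar>D' s\<bar> * q0 (D s) = ?h s" if "s \<in> S" for s
  proof -
    have s: "s \<in> regular" using that by (simp add: S_def)
    have "vector_derivative \<gamma> (at (D s)) = inverse (D' s)"
      using \<gamma>_has_derivative[OF s] by (intro vector_derivative_at) (simp add: has_real_derivative_iff_has_vector_derivative)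
    moreover have "D' s > 0" using regularD(3)[OF s] slope by simp
    moreover have "\<gamma> (D s) = s" using regularD(1)[OF s] by (intro \<gamma>_D) auto
    ultimately show ?thesis by (simp add: q0_def)
  qed
  have "(\<lambda>s. \<bar>D' s\<bar> * q0 (D s)) absolutely_integrable_on S \<and> integral S (\<lambda>s. \<bar>D' s\<bar> * q0 (D s)) = integral {t..T} ?h"
  proof
    show "(\<lambda>s. \<bar>D' s\<bar> * q0 (D s)) absolutely_integrable_on S"
      using hS(1) eq by (simp cong: set_integrable_cong)
    show "integral S (\<lambda>s. \<bar>D' s\<bar> * q0 (D s)) = integral {t..T} ?h"
      unfolding hS(2)[symmetric] by (rule Henstock_Kurzweil_Integration.integral_cong) (rule eq)
  qed
  note prem = this
  have cov: "q0 absolutely_integrable_on (D ` S) \<and> integral (D ` S) q0 = integral {t..T} ?h"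
  proof (rule has_absolute_integral_change_of_variables_1'[where S = S and g = D and g' = D' and f = q0, THEN iffD1, OF Sm _ _ prem])
    show "(D has_field_derivative D' s) (at s within S)" if "s \<in> S" for s
      using that regularD(4) by (auto simp: S_def intro: has_field_derivative_at_within)
    show "inj_on D S" by (rule inj_on_subset[OF D_inj]) (use t in \<open>auto simp: S_def\<close>)
  qed
  obtain C where C: "C-lipschitz_on {ts..T} D" using D_lipschitz_ex by blast
  have "{t..T} - S \<subseteq> {t, T} \<union> ({t<..<T} - S)" by auto
  then have "negligible ({t..T} - S)" using neg by (metis negligible_Un negligible_insert negligible_empty negligible_subset)
  then have nD: "negligible (D ` ({t..T} - S))"
    using t by (intro negligible_lipschitz_image_real[OF lipschitz_on_subset[OF C]]) auto
  have img: "D ` {t..T} = {D t..D T}" using t by (intro D_image) auto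
  have symD: "negligible {s \<in> {D t..D T} - D ` S. F s \<noteq> 0}" "negligible {s \<in> D ` S - {D t..D T}. F s \<noteq> 0}" for F :: "real \<Rightarrow> real"
  proof -
    show "negligible {s \<in> {D t..D T} - D ` S. F s \<noteq> 0}"
      by (rule negligible_subset[OF nD]) (use img in blast)
    have "S \<subseteq> {t..T}" by (auto simp: S_def)
    then have "D ` S \<subseteq> {D t..D T}" unfolding img[symmetric] by (rule image_mono)
    then have "{s \<in> D ` S - {D t..D T}. F s \<noteq> 0} = {}" by blast
    then show "negligible {s \<in> D ` S - {D t..D T}. F s \<noteq> 0}" by (metis negligible_empty)
  qed
  have i: "q0 absolutely_integrable_on {D t..D T}"
    using cov absolutely_integrable_spike_set_eq[OF symD(2,1)[of q0]] by blast
  have v: "integral {D t..D T} q0 = integral {t..T} ?h"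
    using cov integral_spike_set[OF symD(2,1)[of q0]] by simp
  have "D t \<le> t" "D T \<le> T" using \<tau>_nonneg t ts by (auto simp: D_def)
  then have ext: "(\<lambda>r. if r \<in> {t..T} then q r else 0) = (\<lambda>r. if r \<in> {D t..D T} then q0 r else 0)"
    using t \<delta>0 by (auto simp: q_def q0_def fun_eq_iff)
  show "integral {t..T} q = integral {t..T} ?h"
    using v ext by (metis integral_restrict_UNIV)
  have "(\<lambda>r. if r \<in> {D t..D T} then q0 r else 0) absolutely_integrable_on UNIV"
    using i by (simp only: absolutely_integrable_restrict_UNIV)
  then show "q absolutely_integrable_on {t..T}"
    unfolding ext[symmetric] by (simp only: absolutely_integrable_restrict_UNIV)
qed

end

section \<open>The adjoint equation\<close>

lemma differentiable_partial_fst: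
  assumes "F differentiable (at (z, y))"
  shows "(\<lambda>z'. F (z', y)) differentiable (at z)"
proof -
  obtain F' where F': "(F has_derivative F') (at (z, y))" using assms by (auto simp: differentiable_def)
  have "((\<lambda>z'. F (z', y)) has_derivative (\<lambda>h. F' (h, 0))) (at z)"
    by (rule has_derivative_compose[of "\<lambda>z'. (z', y)" "\<lambda>h. (h, 0)" z UNIV F F'])
      (auto intro!: derivative_eq_intros F')
  then show ?thesis by (auto simp: differentiable_def)
qed

lemma differentiable_partial_snd:
  assumes "F differentiable (at (z, y))"
  shows "(\<lambda>y'. F (z, y')) differentiable (at y)"
proof -
  obtain F' where F': "(F has_derivative F') (at (z, y))" using assms by (auto simp: differentiable_def)
  have "((\<lambda>y'. F (z, y')) has_derivative (\<lambda>h. F' (0, h))) (at y)"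
    by (rule has_derivative_compose[of "\<lambda>y'. (z, y')" "\<lambda>h. (0, h)" y UNIV F F'])
      (auto intro!: derivative_eq_intros F')
  then show ?thesis by (auto simp: differentiable_def)
qed

lemma has_derivative_jacobian_partials:
  fixes F :: "(real^'n) \<times> (real^'k) \<Rightarrow> real^'j"
  assumes "F differentiable (at (z, y))"
  shows "(F has_derivative (\<lambda>(h, k). jacobian (\<lambda>z'. F (z', y)) (at z) *v h
    + jacobian (\<lambda>y'. F (z, y')) (at y) *v k)) (at (z, y))"
proof -
  obtain F' where F': "(F has_derivative F') (at (z, y))" using assms by (auto simp: differentiable_def)
  have "F' = (\<lambda>(h, k). jacobian (\<lambda>z'. F (z', y)) (at z) *v h + jacobian (\<lambda>y'. F (z, y')) (at y) *v k)"
    using has_derivative_partials[OF F' jacobian_works[THEN iffD1] jacobian_works[THEN iffD1]]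
      differentiable_partial_fst[OF assms] differentiable_partial_snd[OF assms] by auto
  then show ?thesis using F' by simp
qed

lemma has_derivative_gradient_partials:
  fixes F :: "(real^'n) \<times> (real^'k) \<Rightarrow> real"
  assumes "F differentiable (at (z, y))"
  shows "(F has_derivative (\<lambda>(h, k). gradient (\<lambda>z'. F (z', y)) z \<bullet> h
    + gradient (\<lambda>y'. F (z, y')) y \<bullet> k)) (at (z, y))"
proof -
  obtain F' where F': "(F has_derivative F') (at (z, y))" using assms by (auto simp: differentiable_def)
  have "F' = (\<lambda>(h, k). gradient (\<lambda>z'. F (z', y)) z \<bullet> h + gradient (\<lambda>y'. F (z, y')) y \<bullet> k)"
    using has_derivative_partials[OF F' has_derivative_gradient has_derivative_gradient]
      differentiable_partial_fst[OF assms] differentiable_partial_snd[OF assms] by auto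
  then show ?thesis using F' by simp
qed

text \<open>In the direction of \<open>v\<close> itself, \<open>\<phi>\<close> has derivative
  \<open>v \<bullet> v\<close> at \<open>z\<close> and Lipschitz constant \<open>K * norm v\<close>;
  dividing by \<open>norm v\<close> gives the bound.\<close>

lemma gradient_norm_le:
  fixes \<phi> :: "'a::real_inner \<Rightarrow> real"
  assumes der: "(\<phi> has_derivative (\<lambda>h. v \<bullet> h)) (at z)" and "r > 0" "K \<ge> 0"
    and lip: "\<And>z' z''. z' \<in> cball z r \<Longrightarrow> z'' \<in> cball z r \<Longrightarrow> \<bar>\<phi> z' - \<phi> z''\<bar> \<le> K * norm (z' - z'')"
  shows "norm v \<le> K"
proof (cases "v = 0")
  case True
  then show ?thesis using \<open>K \<ge> 0\<close> by simp
next
  case False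
  define d where "d = r / norm v"
  have d: "d > 0" using False \<open>r > 0\<close> by (simp add: d_def)
  have "(K * norm v)-lipschitz_on {-d..d} (\<lambda>q. \<phi> (z + q *\<^sub>R v))"
  proof (rule lipschitz_onI)
    fix q q' assume q: "q \<in> {-d..d}" "q' \<in> {-d..d}"
    have "\<bar>q''\<bar> * norm v \<le> r" if "q'' \<in> {-d..d}" for q''
    proof -
      have "\<bar>q''\<bar> * norm v \<le> d * norm v" using that by (intro mult_right_mono) auto
      then show ?thesis using False by (simp add: d_def)
    qed
    then have "\<bar>\<phi> (z + q *\<^sub>R v) - \<phi> (z + q' *\<^sub>R v)\<bar> \<le> K * norm ((z + q *\<^sub>R v) - (z + q' *\<^sub>R v))"
      using q by (intro lip) (auto simp: dist_norm)
    then show "dist (\<phi> (z + q *\<^sub>R v)) (\<phi> (z + q' *\<^sub>R v)) \<le> K * norm v * dist q q'"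
      by (simp add: dist_real_def scaleR_diff_left[symmetric] mult_ac)
  next
    show "0 \<le> K * norm v"
      using \<open>K \<ge> 0\<close> by simp
  qed
  moreover have "((\<lambda>q. \<phi> (z + q *\<^sub>R v)) has_vector_derivative (v \<bullet> v)) (at 0)"
  proof -
    have "((\<lambda>q. \<phi> (z + q *\<^sub>R v)) has_derivative (\<lambda>h. v \<bullet> (h *\<^sub>R v))) (at 0)"
      by (rule has_derivative_compose[of "\<lambda>q. z + q *\<^sub>R v" "\<lambda>h. h *\<^sub>R v" 0 UNIV \<phi> "\<lambda>h. v \<bullet> h"])
        (auto intro!: derivative_eq_intros der)
    then show ?thesis by (simp add: has_vector_derivative_def)
  qed
  ultimately have "norm (v \<bullet> v) \<le> K * norm v"
    using d by (intro lipschitz_on_derivative_bound[of _ "-d" d]) auto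
  then show ?thesis using False by (simp add: dot_square_norm power2_eq_square)
qed

text \<open>Kept apart from the adjoint equation so that \<open>\<Phi>z\<close> and
  \<open>\<Phi>y\<close> are available for stating it.\<close>

locale costate = controlled_trajectory t0 T A f L g \<tau> ts ws \<alpha> x
  for t0 T :: real and A :: "(real^'m) set" and f L and g :: "real^'n \<Rightarrow> (real \<Rightarrow> real^'n) \<Rightarrow> real" and \<tau> ts ws \<alpha> x +
  fixes p :: "real \<Rightarrow> real^'n"
begin

definition \<Phi>z where "\<Phi>z s = transpose (f\<^sub>z f s (x s) (x (D s)) (\<alpha> s)) *v p s + L\<^sub>z L s (x s) (x (D s)) (\<alpha> s)"
definition \<Phi>y where "\<Phi>y s = transpose (f\<^sub>y f s (x s) (x (D s)) (\<alpha> s)) *v p s + L\<^sub>y L s (x s) (x (D s)) (\<alpha> s)"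
text \<open>The unminimized Hamiltonian with control and costate at time \<open>s\<close> inserted;
  \<open>\<Phi>z\<close> and \<open>\<Phi>y\<close> are its partial gradients at
  \<open>(x s, x (D s))\<close>.\<close>

definition \<psi> where "\<psi> s z y = f s z y (\<alpha> s) \<bullet> p s + L s z y (\<alpha> s)"

end

locale adjoint_trajectory = costate t0 T A f L g \<tau> ts ws \<alpha> x p
  for t0 T :: real and A :: "(real^'m) set" and f L and g :: "real^'n \<Rightarrow> (real \<Rightarrow> real^'n) \<Rightarrow> real" and \<tau> ts ws \<alpha> x p +
  fixes gz :: "real^'n" and gw :: "real \<Rightarrow> real^'n"
  assumes g_diff: "has_state_derivative bd g (x T) (segment x T) gz gw"
    and p_lipschitz: "\<exists>C. C-lipschitz_on {ts..T} p"
    and adjoint: "AE s in lebesgue_on {ts<..<T}. (p has_vector_derivative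
          (- \<Phi>z s + (vector_derivative x (at (D s)) \<bullet> \<Phi>y s) *\<^sub>R \<tau>\<^sub>z \<tau> s (x s)
           - (if s \<in> {ts..D T} then vector_derivative \<gamma> (at s) *\<^sub>R \<Phi>y (\<gamma> s) else 0)
           - (if s \<in> {T - bd..T} then gw (s - T) else 0))) (at s)"
    and terminal: "p T = gz"
begin

lemma \<alpha>_in: "s \<in> {ts<..<T} \<Longrightarrow> \<alpha> s \<in> A" "s \<in> {ts<..<T} \<Longrightarrow> s \<in> {t0..T}"
  using \<alpha> ts by (auto simp: controls_def)

lemma \<psi>_has_derivative:
  assumes s: "s \<in> {ts<..<T}"
  shows "((\<lambda>(z, y). \<psi> s z y) has_derivative (\<lambda>(h, k). \<Phi>z s \<bullet> h + \<Phi>y s \<bullet> k)) (at (x s, x (D s)))"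
proof -
  let ?a = "\<alpha> s" and ?u = "(x s, x (D s))"
  have "(\<lambda>(z, y). f s z y ?a) differentiable (at ?u)" "(\<lambda>(z, y). L s z y ?a) differentiable (at ?u)"
    using f_C1 L_C1 \<alpha>_in[OF s] by (auto simp: C1_uniformly_def)
  from has_derivative_jacobian_partials[OF this(1)] has_derivative_gradient_partials[OF this(2)]
  have f': "((\<lambda>(z, y). f s z y ?a) has_derivative (\<lambda>(h, k). f\<^sub>z f s (x s) (x (D s)) ?a *v h + f\<^sub>y f s (x s) (x (D s)) ?a *v k)) (at ?u)"
    and L': "((\<lambda>(z, y). L s z y ?a) has_derivative (\<lambda>(h, k). L\<^sub>z L s (x s) (x (D s)) ?a \<bullet> h + L\<^sub>y L s (x s) (x (D s)) ?a \<bullet> k)) (at ?u)"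
    by (simp_all add: f\<^sub>z_def f\<^sub>y_def L\<^sub>z_def L\<^sub>y_def)
  have "((\<lambda>u. (\<lambda>(z, y). f s z y ?a) u \<bullet> p s + (\<lambda>(z, y). L s z y ?a) u) has_derivative
    (\<lambda>u. (\<lambda>(h, k). f\<^sub>z f s (x s) (x (D s)) ?a *v h + f\<^sub>y f s (x s) (x (D s)) ?a *v k) u \<bullet> p s
      + (\<lambda>(h, k). L\<^sub>z L s (x s) (x (D s)) ?a \<bullet> h + L\<^sub>y L s (x s) (x (D s)) ?a \<bullet> k) u)) (at ?u)"
    by (intro has_derivative_add has_derivative_inner_left f' L')
  moreover have "(\<lambda>u. (\<lambda>(z, y). f s z y ?a) u \<bullet> p s + (\<lambda>(z, y). L s z y ?a) u) = (\<lambda>(z, y). \<psi> s z y)"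
    by (auto simp: \<psi>_def)
  moreover have "(\<lambda>u. (\<lambda>(h, k). f\<^sub>z f s (x s) (x (D s)) ?a *v h + f\<^sub>y f s (x s) (x (D s)) ?a *v k) u \<bullet> p s
      + (\<lambda>(h, k). L\<^sub>z L s (x s) (x (D s)) ?a \<bullet> h + L\<^sub>y L s (x s) (x (D s)) ?a \<bullet> k) u)
     = (\<lambda>(h, k). \<Phi>z s \<bullet> h + \<Phi>y s \<bullet> k)"
  proof -
    have "(M *v h) \<bullet> p s = (transpose M *v p s) \<bullet> h" for M :: "real^'n^'n" and h
      by (metis dot_lmul_matrix inner_commute transpose_matrix_vector)
    then show ?thesis
      by (auto simp: fun_eq_iff \<Phi>z_def \<Phi>y_def inner_add_left)
  qed
  ultimately show ?thesis by simp
qed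

section \<open>Bounds and measurability for the costate, \<open>\<psi>\<close> and its
  gradients\<close>

lemma p_bound: obtains B where "B > 0" "\<And>s. s \<in> {ts..T} \<Longrightarrow> norm (p s) \<le> B"
proof -
  obtain C where "C-lipschitz_on {ts..T} p" using p_lipschitz by blast
  then have "bounded (p ` {ts..T})"
    by (intro compact_imp_bounded compact_continuous_image lipschitz_on_continuous_on) auto
  then show thesis using that unfolding bounded_pos by auto
qed

lemma \<psi>_lipschitz:
  assumes "R > 0"
  obtains K where "K > 0" "\<And>s z y z' y'. s \<in> {ts<..<T} \<Longrightarrow> norm z \<le> R \<Longrightarrow> norm y \<le> R \<Longrightarrow> norm z' \<le> R \<Longrightarrow> norm y' \<le> R \<Longrightarrow>
    \<bar>\<psi> s z y - \<psi> s z' y'\<bar> \<le> K * (norm (z - z') + norm (y - y'))"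
proof -
  obtain B where B: "B > 0" "\<And>s. s \<in> {ts..T} \<Longrightarrow> norm (p s) \<le> B" by - (rule p_bound, blast)
  obtain l where l: "l > 0" "\<forall>t\<in>{t0..T}. \<forall>a\<in>A.
          \<forall>z\<in>cball 0 R. \<forall>y\<in>cball 0 R. \<forall>z'\<in>cball 0 R. \<forall>y'\<in>cball 0 R.
          \<bar>L t z y a - L t z' y' a\<bar> \<le> l * (norm (z - z') + norm (y - y'))"
    using L_lipschitz assms by blast
  show thesis
  proof (rule that[of "lf * B + l"])
    show "lf * B + l > 0" using lf(1) B(1) l(1) by (simp add: add_pos_pos)
    fix s and z y z' y' :: "real^'n" assume s: "s \<in> {ts<..<T}" and n: "norm z \<le> R" "norm y \<le> R" "norm z' \<le> R" "norm y' \<le> R"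
    let ?e = "norm (z - z') + norm (y - y')"
    have "\<bar>L s z y (\<alpha> s) - L s z' y' (\<alpha> s)\<bar> \<le> l * ?e"
      using l(2) \<alpha>_in[OF s] n by simp
    moreover have "\<bar>(f s z y (\<alpha> s) - f s z' y' (\<alpha> s)) \<bullet> p s\<bar> \<le> lf * ?e * B"
    proof -
      have "\<bar>(f s z y (\<alpha> s) - f s z' y' (\<alpha> s)) \<bullet> p s\<bar> \<le> norm (f s z y (\<alpha> s) - f s z' y' (\<alpha> s)) * norm (p s)"
        by (rule Cauchy_Schwarz_ineq2)
      also have "\<dots> \<le> lf * ?e * B"
        using s lf(1) \<alpha>_in[OF s] by (intro mult_mono lf(2) B(2)) auto
      finally show ?thesis .
    qed
    ultimately show "\<bar>\<psi> s z y - \<psi> s z' y'\<bar> \<le> (lf * B + l) * ?e"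
      unfolding \<psi>_def by (simp add: inner_diff_left algebra_simps)
  qed
qed

text \<open>Gradients are bounded by a Lipschitz constant of \<open>\<psi>\<close> on a ball; the
  radius \<open>R + 1\<close> leaves a unit ball around every value of \<open>x\<close>, and the
  constant does not depend on \<open>s\<close>.\<close>

lemma \<Phi>_bounded:
  obtains K where "K > 0" "\<And>s. s \<in> {ts<..<T} \<Longrightarrow> norm (\<Phi>z s) \<le> K" "\<And>s. s \<in> {ts<..<T} \<Longrightarrow> norm (\<Phi>y s) \<le> K"
proof -
  obtain R where R: "R > 0" "\<And>s. s \<in> {ts - bd..T} \<Longrightarrow> norm (x s) \<le> R" using x by - (erule traj_bounded, blast)
  then have "R + 1 > 0" by simp
  then obtain K where K: "K > 0" "\<And>s z y z' y'. s \<in> {ts<..<T} \<Longrightarrow> norm z \<le> R + 1 \<Longrightarrow> norm y \<le> R + 1 \<Longrightarrow> norm z' \<le> R + 1 \<Longrightarrow> norm y' \<le> R + 1 \<Longrightarrow>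
    \<bar>\<psi> s z y - \<psi> s z' y'\<bar> \<le> K * (norm (z - z') + norm (y - y'))"
    by (rule \<psi>_lipschitz) blast
  have near: "norm z \<le> R + 1" if "z \<in> cball z0 1" "norm z0 \<le> R" for z z0 :: "real^'n"
    using that norm_triangle_sub[of z z0] by (auto simp: dist_norm norm_minus_commute)
  have "norm (\<Phi>z s) \<le> K \<and> norm (\<Phi>y s) \<le> K" if s: "s \<in> {ts<..<T}" for s
  proof
    have xs: "norm (x s) \<le> R" "norm (x (D s)) \<le> R"
      using R(2)[of s] R(2)[of "D s"] D_in[of s] s bd_nonneg by auto
    have "((\<lambda>z. (\<lambda>(z, y). \<psi> s z y) (z, x (D s))) has_derivative (\<lambda>h. (\<lambda>(h, k). \<Phi>z s \<bullet> h + \<Phi>y s \<bullet> k) (h, 0))) (at (x s))"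
      by (rule has_derivative_compose[of "\<lambda>z. (z, x (D s))" "\<lambda>h. (h, 0)"]) (auto intro!: derivative_eq_intros \<psi>_has_derivative[OF s])
    then have "((\<lambda>z. \<psi> s z (x (D s))) has_derivative (\<lambda>h. \<Phi>z s \<bullet> h)) (at (x s))" by simp
    then show "norm (\<Phi>z s) \<le> K"
    proof (rule gradient_norm_le[of _ _ _ 1])
      show "K \<ge> 0" using K(1) by simp
      fix z' z'' assume "z' \<in> cball (x s) 1" "z'' \<in> cball (x s) 1"
      then show "\<bar>\<psi> s z' (x (D s)) - \<psi> s z'' (x (D s))\<bar> \<le> K * norm (z' - z'')"
        using K(2)[OF s, of z' "x (D s)" z'' "x (D s)"] near xs by auto
    qed simp
    have "((\<lambda>y. (\<lambda>(z, y). \<psi> s z y) (x s, y)) has_derivative (\<lambda>h. (\<lambda>(h, k). \<Phi>z s \<bullet> h + \<Phi>y s \<bullet> k) (0, h))) (at (x (D s)))"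
      by (rule has_derivative_compose[of "\<lambda>y. (x s, y)" "\<lambda>h. (0, h)"]) (auto intro!: derivative_eq_intros \<psi>_has_derivative[OF s])
    then have "((\<lambda>y. \<psi> s (x s) y) has_derivative (\<lambda>h. \<Phi>y s \<bullet> h)) (at (x (D s)))" by simp
    then show "norm (\<Phi>y s) \<le> K"
    proof (rule gradient_norm_le[of _ _ _ 1])
      show "K \<ge> 0" using K(1) by simp
      fix z' z'' assume "z' \<in> cball (x (D s)) 1" "z'' \<in> cball (x (D s)) 1"
      then show "\<bar>\<psi> s (x s) z' - \<psi> s (x s) z''\<bar> \<le> K * norm (z' - z'')"
        using K(2)[OF s, of "x s" z' "x s" z''] near xs by auto
    qed simp
  qed
  then show thesis using K(1) that by blast
qed

lemma \<tau>\<^sub>z_bound: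
  assumes "s \<in> {t0<..<T}"
  shows "norm (\<tau>\<^sub>z \<tau> s z) \<le> l\<tau>"
proof (rule gradient_norm_le[of "\<tau> s" _ z 1])
  have "((\<lambda>z. (\<lambda>(s, z). \<tau> s z) (s, z)) has_derivative (\<lambda>h. (\<lambda>(h, k). h * \<tau>\<^sub>t t0 T \<tau> s z + \<tau>\<^sub>z \<tau> s z \<bullet> k) (0, h))) (at z)"
    by (rule has_derivative_compose[of "\<lambda>y. (s, y)" "\<lambda>h. (0, h)"]) (auto intro!: derivative_eq_intros \<tau>_partials assms)
  then show "(\<tau> s has_derivative (\<lambda>h. \<tau>\<^sub>z \<tau> s z \<bullet> h)) (at z)" by simp
qed (use l\<tau> assms in \<open>auto intro: less_imp_le\<close>)

lemma \<psi>_along: "\<psi> s (y s) (y (s - \<tau> s (y s))) = along \<tau> f \<alpha> y s \<bullet> p s + along \<tau> L \<alpha> y s"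
  by (simp add: \<psi>_def along_def)

lemma x_cont: "continuous_on {ts - bd..T} x"
  using xC by (rule lipschitz_on_continuous_on)

lemma p_cont: "continuous_on {ts..T} p"
  using p_lipschitz lipschitz_on_continuous_on by blast

text \<open>Each component is a pointwise limit of difference quotients of \<open>\<psi>\<close>,
  which are measurable as compositions of continuous data with measurable functions.\<close>

lemma \<Phi>y_measurable: "\<Phi>y \<in> borel_measurable (lebesgue_on {ts<..<T})"
proof -
  let ?M = "lebesgue_on {ts<..<T}"
  have [measurable]: "x \<in> borel_measurable ?M" "p \<in> borel_measurable ?M" "(\<lambda>s. x (D s)) \<in> borel_measurable ?M"
  proof -
    show "x \<in> borel_measurable ?M"
      by (rule continuous_imp_measurable_on_sets_lebesgue, rule continuous_on_subset[OF x_cont]) (use bd_nonneg in auto)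
    show "p \<in> borel_measurable ?M"
      by (rule continuous_imp_measurable_on_sets_lebesgue, rule continuous_on_subset[OF p_cont]) auto
    have "continuous_on {ts..T} (\<lambda>s. x (D s))"
      unfolding D_def using ts by (intro delayed_continuous x_cont) auto
    then show "(\<lambda>s. x (D s)) \<in> borel_measurable ?M"
      by (intro continuous_imp_measurable_on_sets_lebesgue) (auto intro: continuous_on_subset)
  qed
  have \<alpha>m: "\<alpha> \<in> borel_measurable ?M" using \<alpha> by (simp add: controls_def)
  have \<psi>m: "(\<lambda>s. \<psi> s (x s) (x (D s) + c)) \<in> borel_measurable ?M" for c
  proof -
    have "(\<lambda>s. x (D s) + c) \<in> borel_measurable ?M" by (intro borel_measurable_add) measurable
    note * = composite_measurable[where u = x and S = "{ts<..<T}", OF _ _ _ _ this \<alpha>m]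
    have [measurable]: "(\<lambda>s. f s (x s) (x (D s) + c) (\<alpha> s)) \<in> borel_measurable ?M"
      by (rule *[OF f_cont]) (use ts \<alpha>_in in auto)
    have [measurable]: "(\<lambda>s. L s (x s) (x (D s) + c) (\<alpha> s)) \<in> borel_measurable ?M"
      by (rule *[OF L_cont]) (use ts \<alpha>_in in auto)
    show ?thesis unfolding \<psi>_def by measurable
  qed
  have "(\<lambda>s. \<Phi>y s \<bullet> i) \<in> borel_measurable ?M" for i
  proof (rule borel_measurable_LIMSEQ_metric)
    define e where "e n = 1 / real (Suc n)" for n
    have e0: "filterlim e (at 0) sequentially"
      unfolding filterlim_at e_def using LIMSEQ_inverse_real_of_nat by (auto simp: inverse_eq_divide)
    show "(\<lambda>s. (\<psi> s (x s) (x (D s) + e n *\<^sub>R i) - \<psi> s (x s) (x (D s) + 0)) /\<^sub>R e n) \<in> borel_measurable ?M" for n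
      by (intro borel_measurable_scaleR borel_measurable_diff \<psi>m borel_measurable_const)
    fix s assume "s \<in> space ?M"
    then have s: "s \<in> {ts<..<T}" by simp
    have "((\<lambda>q. (\<lambda>(z, y). \<psi> s z y) (x s, x (D s) + q *\<^sub>R i)) has_derivative (\<lambda>h. (\<lambda>(h, k). \<Phi>z s \<bullet> h + \<Phi>y s \<bullet> k) (0, h *\<^sub>R i))) (at 0)"
      by (rule has_derivative_compose[of "\<lambda>q. (x s, x (D s) + q *\<^sub>R i)" "\<lambda>h. (0, h *\<^sub>R i)"])
        (auto intro!: derivative_eq_intros \<psi>_has_derivative[OF s])
    then have "((\<lambda>q. \<psi> s (x s) (x (D s) + q *\<^sub>R i)) has_vector_derivative (\<Phi>y s \<bullet> i)) (at 0)"
      by (simp add: has_vector_derivative_def)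
    from has_vector_derivative_quotient[OF this, THEN filterlim_compose[OF _ e0]]
    show "(\<lambda>n. (\<psi> s (x s) (x (D s) + e n *\<^sub>R i) - \<psi> s (x s) (x (D s) + 0)) /\<^sub>R e n) \<longlonglongrightarrow> \<Phi>y s \<bullet> i"
      by simp
  qed
  then show ?thesis by (subst borel_measurable_euclidean_space) auto
qed

end

section \<open>Perturbed trajectories\<close>

locale perturbation = adjoint_trajectory t0 T A f L g \<tau> ts ws \<alpha> x p gz gw
  for t0 T :: real and A :: "(real^'m) set" and f L and g :: "real^'n \<Rightarrow> (real \<Rightarrow> real^'n) \<Rightarrow> real"
    and \<tau> ts ws \<alpha> x p gz gw +
  fixes t l :: real and \<theta> :: "real^'n"
  assumes t: "t \<in> {ts<..<T}" and l: "l > 0"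
begin

definition e where "e h = t + h * l"
definition v where "v h = polygonal_extension t (segment x t) (t + h * l) (segment x t 0 + h *\<^sub>R \<theta>)"
definition wh where "wh h = segment (v h) (e h)"
text \<open>One function for three phases: the original trajectory, the segment of slope
  \<open>\<theta> /\<^sub>R l\<close> (displacement \<open>h *\<^sub>R \<theta>\<close> in time
  \<open>h * l\<close>), and the trajectory restarted from the polygonal history. Up to
  \<open>e h\<close> it agrees with \<open>v h\<close> when \<open>h\<close> is valid.\<close>

definition Y where "Y h r = (if r \<le> t then x r else if r \<le> e h then x t + ((r - t) / l) *\<^sub>R \<theta> else trj (e h) (wh h) \<alpha> r)"
definition \<delta> where "\<delta> h r = Y h r - x r"
definition valid where "valid h \<longleftrightarrow> 0 < h \<and> e h < T"
text \<open>Factors of \<open>h\<close> in the bounds below, none depending on \<open>h\<close>: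
  \<open>C1\<close> for the deviation up to \<open>e h\<close>, where \<open>x\<close> itself moves
  by at most \<open>xC * l * h\<close>; \<open>C2\<close> for the deviation up to \<open>T\<close>,
  by stability; \<open>C3\<close> for its rate of change after \<open>e h\<close>.\<close>

definition C1 where "C1 = norm \<theta> + xC * l"
definition C2 where "C2 = (1 + stability_const xC) * C1"
definition C3 where "C3 = lf * (2 + xC * l\<tau>) * C2"

lemma e_in: "valid h \<Longrightarrow> e h \<in> {t<..<T}"
  using l by (simp add: valid_def e_def)

lemma e_ts: "valid h \<Longrightarrow> e h \<in> {t0..<T}" "valid h \<Longrightarrow> e h \<in> {ts<..<T}" "valid h \<Longrightarrow> e h \<in> {t0..T}"
  using e_in[of h] t ts by auto

lemma \<alpha>_e: "valid h \<Longrightarrow> \<alpha> \<in> controls A (e h) T"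
  using e_ts(2)[of h] by (intro controls_restrict[OF \<alpha>]) auto

lemma xC_nonneg: "xC \<ge> 0" using xC by (rule lipschitz_on_nonneg)

lemma C_nonneg: "C1 \<ge> 0" "C2 \<ge> 0" "C3 \<ge> 0"
proof -
  show 1: "C1 \<ge> 0" using xC_nonneg l by (simp add: C1_def)
  have "stability_const xC \<ge> 0"
    unfolding stability_const_def using lf(1) time by simp
  then show 2: "C2 \<ge> 0" using 1 by (simp add: C2_def)
  show "C3 \<ge> 0" using 2 lf(1) l\<tau>(1) xC_nonneg by (simp add: C3_def)
qed

lemma v_eq: "valid h \<Longrightarrow> r \<le> e h \<Longrightarrow> v h r = Y h r"
  using l by (auto simp: valid_def v_def Y_def polygonal_extension_def segment_def e_def)

lemma Y_hist: "r \<le> t \<Longrightarrow> Y h r = x r"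
  by (simp add: Y_def)

lemma \<delta>_hist: "r \<le> t \<Longrightarrow> \<delta> h r = 0"
  by (simp add: \<delta>_def Y_hist)

lemma Y_lipschitz_initial:
  assumes h: "valid h"
  shows "(max xC (norm \<theta> / l))-lipschitz_on {ts - bd..e h} (Y h)"
proof -
  have "(norm \<theta> / l)-lipschitz_on {t..e h} (\<lambda>r. x t + ((r - t) / l) *\<^sub>R \<theta>)"
  proof (rule lipschitz_onI)
    fix r s
    have "(x t + ((r - t) / l) *\<^sub>R \<theta>) - (x t + ((s - t) / l) *\<^sub>R \<theta>) = ((r - s) / l) *\<^sub>R \<theta>"
      by (simp add: scaleR_diff_left[symmetric] diff_divide_distrib)
    then show "dist (x t + ((r - t) / l) *\<^sub>R \<theta>) (x t + ((s - t) / l) *\<^sub>R \<theta>) \<le> norm \<theta> / l * dist r s"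
      using l by (simp add: dist_norm mult.commute)
  qed (use l in simp)
  then have "(max xC (norm \<theta> / l))-lipschitz_on {ts - bd..e h} (\<lambda>r. if r \<le> t then x r else x t + ((r - t) / l) *\<^sub>R \<theta>)"
    using t by (intro lipschitz_on_concat_max lipschitz_on_subset[OF xC]) auto
  then show ?thesis by (rule lipschitz_on_transform) (auto simp: Y_def)
qed

lemma wh_Lip: "valid h \<Longrightarrow> wh h \<in> Lip bd"
proof -
  assume h: "valid h"
  have "(max xC (norm \<theta> / l))-lipschitz_on {e h - bd..e h} (Y h)"
    using e_ts(2)[OF h] by (intro lipschitz_on_subset[OF Y_lipschitz_initial[OF h]]) auto
  then have "(max xC (norm \<theta> / l))-lipschitz_on {e h - bd..e h} (v h)"
    by (rule lipschitz_on_transform) (auto simp: v_eq[OF h])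
  then show ?thesis unfolding wh_def by (rule segment_Lip)
qed

lemma Y_traj:
  assumes h: "valid h"
  shows "traj (e h) (wh h) \<alpha> (Y h)"
proof -
  have y: "traj (e h) (wh h) \<alpha> (trj (e h) (wh h) \<alpha>)"
    by (intro trajectory_traj wh_Lip e_ts \<alpha>_e h)
  then have init: "trj (e h) (wh h) \<alpha> (e h + \<theta>') = wh h \<theta>'" if "\<theta>' \<in> {-bd..0}" for \<theta>'
    using that by - (erule trajD, blast)
  show ?thesis
  proof (rule traj_cong[OF y])
    fix s assume s: "s \<in> {e h - bd..T}"
    show "Y h s = trj (e h) (wh h) \<alpha> s"
    proof (cases "s \<le> e h")
      case True
      then have "trj (e h) (wh h) \<alpha> s = wh h (s - e h)" using init[of "s - e h"] s by auto
      then show ?thesis using v_eq[OF h True] by (simp add: wh_def segment_def)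
    next
      case False
      then show ?thesis using e_in[OF h] by (simp add: Y_def)
    qed
  qed (use e_ts[OF h] in auto)
qed

lemma x_traj: "valid h \<Longrightarrow> traj (e h) (segment x (e h)) \<alpha> x"
  using e_ts(2)[of h] by (intro traj_restrict[OF x]) auto

lemma Y_lipschitz_ex:
  assumes h: "valid h"
  shows "\<exists>C. C-lipschitz_on {ts - bd..T} (Y h)"
proof -
  obtain C where C: "C-lipschitz_on {e h - bd..T} (Y h)" using Y_traj[OF h] by - (erule trajD, blast)
  have "(max (max xC (norm \<theta> / l)) C)-lipschitz_on {ts - bd..T} (\<lambda>r. if r \<le> e h then Y h r else Y h r)"
    using bd_nonneg by (intro lipschitz_on_concat_max Y_lipschitz_initial[OF h] lipschitz_on_subset[OF C]) auto
  then show ?thesis by auto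
qed

lemma Y_cont: "valid h \<Longrightarrow> continuous_on {ts - bd..T} (Y h)"
  using Y_lipschitz_ex lipschitz_on_continuous_on by blast

lemma \<delta>_initial_bound:
  assumes h: "valid h" and r: "r \<le> e h" "ts - bd \<le> r"
  shows "norm (\<delta> h r) \<le> C1 * h"
proof (cases "r \<le> t")
  case True
  then show ?thesis using C_nonneg h by (simp add: \<delta>_hist valid_def)
next
  case False
  have "r - t \<le> h * l" using r by (simp add: e_def)
  then have a: "norm (((r - t) / l) *\<^sub>R \<theta>) \<le> h * norm \<theta>"
    using False l mult_right_mono[OF \<open>r - t \<le> h * l\<close> norm_ge_zero[of \<theta>]] by (simp add: divide_le_eq mult_ac)
  have "norm (x t - x r) \<le> xC * (r - t)"
    using lipschitz_onD[OF xC, of t r] False t bd_nonneg r e_in[OF h] by (auto simp: dist_norm)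
  also have "\<dots> \<le> xC * (h * l)" using \<open>r - t \<le> h * l\<close> xC_nonneg by (rule mult_left_mono)
  finally have b: "norm (x t - x r) \<le> xC * (h * l)" .
  have "\<delta> h r = (x t - x r) + ((r - t) / l) *\<^sub>R \<theta>" using False r by (simp add: \<delta>_def Y_def)
  then have "norm (\<delta> h r) \<le> xC * (h * l) + h * norm \<theta>"
    using norm_triangle_le[of "x t - x r"] a b by auto
  then show ?thesis by (simp add: C1_def algebra_simps)
qed

lemma \<delta>_bound:
  assumes h: "valid h" and r: "r \<in> {ts - bd..T}"
  shows "norm (\<delta> h r) \<le> C2 * h"
proof (cases "r \<le> e h")
  case True
  have "norm (\<delta> h r) \<le> C1 * h" using True r by (intro \<delta>_initial_bound h) auto
  also have "\<dots> \<le> C2 * h"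
  proof -
    have "stability_const xC \<ge> 0" unfolding stability_const_def using lf(1) time by simp
    then have "C1 * 1 \<le> C1 * (1 + stability_const xC)" using C_nonneg by (intro mult_left_mono) auto
    then show ?thesis using h by (intro mult_right_mono) (auto simp: C2_def valid_def mult.commute)
  qed
  finally show ?thesis .
next
  case False
  \<comment> \<open>Stability is applied from \<open>e h\<close> on, with \<open>x\<close> restarted
    there as the reference, so that only its Lipschitz constant enters and the factor is the same
    for all \<open>h\<close>.\<close>
  have "norm (Y h r - x r) \<le> stability_const xC * (C1 * h)"
  proof (rule traj_stability[OF x_traj[OF h] Y_traj[OF h] _ e_ts(3)[OF h] \<alpha>_e[OF h]])
    show "xC-lipschitz_on {e h - bd..T} x"
      using e_ts(2)[OF h] by (intro lipschitz_on_subset[OF xC]) auto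
    show "0 \<le> C1 * h" using C_nonneg h by (simp add: valid_def)
    show "r \<in> {e h - bd..T}" using False r bd_nonneg by auto
    fix \<theta>' assume *: "\<theta>' \<in> {-bd..0}"
    then have "wh h \<theta>' = Y h (e h + \<theta>')" using v_eq[OF h, of "e h + \<theta>'"] by (simp add: wh_def segment_def)
    then have "wh h \<theta>' - segment x (e h) \<theta>' = \<delta> h (e h + \<theta>')" by (simp add: \<delta>_def segment_def)
    then show "norm (wh h \<theta>' - segment x (e h) \<theta>') \<le> C1 * h"
      using \<delta>_initial_bound[OF h, of "e h + \<theta>'"] * e_ts(2)[OF h] by auto
  qed
  also have "\<dots> \<le> C2 * h" using C_nonneg h by (simp add: C2_def valid_def algebra_simps)
  finally show ?thesis by (simp add: \<delta>_def)
qed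

lemma along_f_diff_bound:
  assumes h: "valid h" and s: "s \<in> {e h<..<T}"
  shows "norm (along \<tau> f \<alpha> (Y h) s - along \<tau> f \<alpha> x s) \<le> C3 * h"
proof -
  have "norm (along \<tau> f \<alpha> (Y h) s - along \<tau> f \<alpha> x s) \<le> lf * (2 + xC * l\<tau>) * (C2 * h)"
  proof (rule along_diff_le[OF xC])
    show "norm (Y h q - x q) \<le> C2 * h" if "q \<in> {ts - bd..s}" for q
      using \<delta>_bound[OF h, of q] that s by (auto simp: \<delta>_def)
  qed (use s e_ts[OF h] ts \<alpha>_in[of s] in auto)
  then show ?thesis by (simp add: C3_def mult_ac)
qed

text \<open>After \<open>e h\<close> both trajectories follow the same control, so their velocities
  differ by O(h). A Lipschitz constant that is itself of order h is what allows exchanging the two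
  delayed times inside \<open>\<delta>\<close> with an error o(h).\<close>

lemma \<delta>_lipschitz:
  assumes h: "valid h" and rs: "e h \<le> r" "r \<le> s" "s \<le> T"
  shows "norm (\<delta> h s - \<delta> h r) \<le> C3 * h * (s - r)"
proof -
  have "norm ((Y h s - Y h r) - (x s - x r)) \<le> C3 * h * (s - r) + 0 / 2 * exp (2 * 1 * (s - r))"
  proof (rule norm_integral_exp_weight_le)
    show "((\<lambda>q. along \<tau> f \<alpha> (Y h) q - along \<tau> f \<alpha> x q) has_integral ((Y h s - Y h r) - (x s - x r))) {r..s}"
      using rs by (intro has_integral_diff traj_has_integral[OF Y_traj[OF h]] traj_has_integral[OF x_traj[OF h]])
    show "norm (along \<tau> f \<alpha> (Y h) q - along \<tau> f \<alpha> x q) \<le> C3 * h + 1 * (0 * exp (2 * 1 * (q - r)))" if "q \<in> {r<..<s}" for q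
      using along_f_diff_bound[OF h, of q] that rs by auto
  qed (use rs in auto)
  then show ?thesis by (simp add: \<delta>_def algebra_simps)
qed

lemma value_diff_le:
  assumes h: "valid h" and opt: "optimal_control bd T A f L g \<tau> ts ws \<alpha>"
  shows "val (e h) (wh h) - val t (segment x t)
    \<le> (integral {e h..T} (along \<tau> L \<alpha> (Y h)) + g (Y h T) (segment (Y h) T))
      - (integral {t..T} (along \<tau> L \<alpha> x) + g (x T) (segment x T))"
proof -
  have "val (e h) (wh h) \<le> cst (e h) (wh h) \<alpha>"
    by (intro value_le_cost wh_Lip e_ts \<alpha>_e h)
  also have "\<dots> = integral {e h..T} (along \<tau> L \<alpha> (Y h)) + g (Y h T) (segment (Y h) T)"
    by (intro cost_eq Y_traj e_ts \<alpha>_e h)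
  finally have 1: "val (e h) (wh h) \<le> integral {e h..T} (along \<tau> L \<alpha> (Y h)) + g (Y h T) (segment (Y h) T)" .
  have "cst t (segment x t) \<alpha> = integral {t..T} (along \<tau> L \<alpha> x) + g (x T) (segment x T)"
    using t ts by (intro cost_eq traj_restrict[OF x] controls_restrict[OF \<alpha>]) auto
  moreover have "cst t (segment x t) \<alpha> \<le> val t (segment x t)"
    using t ts by (intro optimal_cost_le_value[OF opt ws x]) auto
  ultimately show ?thesis using 1 by linarith
qed

definition \<kappa> where "\<kappa> s = (p s \<bullet> \<theta>) / l - (along \<tau> f \<alpha> x s \<bullet> p s + along \<tau> L \<alpha> x s)"

definition pd where "pd s = - \<Phi>z s + (vector_derivative x (at (D s)) \<bullet> \<Phi>y s) *\<^sub>R \<tau>\<^sub>z \<tau> s (x s)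
           - (if s \<in> {ts..D T} then vector_derivative \<gamma> (at s) *\<^sub>R \<Phi>y (\<gamma> s) else 0)
           - (if s \<in> {T - bd..T} then gw (s - T) else 0)"

text \<open>Depends on \<open>h\<close> through \<open>Y h\<close> and the corner at
  \<open>e h\<close>, so the exceptional null set varies with \<open>h\<close>.\<close>

definition good where "good h = {s \<in> {t<..<T}. s \<in> regular \<and> (p has_vector_derivative pd s) (at s) \<and> s \<noteq> e h
   \<and> (s > e h \<longrightarrow> (Y h has_vector_derivative along \<tau> f \<alpha> (Y h) s) (at s))}"

lemma negligible_not_good:
  assumes h: "valid h"
  shows "negligible ({t<..<T} - good h)"
proof -
  have n1: "negligible {s \<in> {ts<..<T}. \<not> (p has_vector_derivative pd s) (at s)}"
    using adjoint unfolding pd_def by (subst (asm) AE_lebesgue_on_iff_negligible) auto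
  have n2: "negligible {s \<in> {e h<..<T}. \<not> (Y h has_vector_derivative along \<tau> f \<alpha> (Y h) s) (at s)}"
    using Y_traj[OF h] by - (erule trajD, blast)
  have "negligible (({ts<..<T} - regular) \<union> {s \<in> {ts<..<T}. \<not> (p has_vector_derivative pd s) (at s)} \<union>
     {s \<in> {e h<..<T}. \<not> (Y h has_vector_derivative along \<tau> f \<alpha> (Y h) s) (at s)} \<union> {e h})"
    using n1 n2 negligible_irregular by (simp add: negligible_Un)
  then show ?thesis by (rule negligible_subset) (use t in \<open>auto simp: good_def\<close>)
qed

definition d\<delta> where "d\<delta> h s = (if s \<le> e h then \<theta> /\<^sub>R l - along \<tau> f \<alpha> x s else along \<tau> f \<alpha> (Y h) s - along \<tau> f \<alpha> x s)"

text \<open>Both factors are bounded and Lipschitz, hence so is the product, which is then the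
  integral of its derivative. The boundary term at \<open>t\<close> vanishes with
  \<open>\<delta>\<close>; the corner of \<open>\<delta>\<close> at \<open>e h\<close> is not a good
  time.\<close>

lemma p_\<delta>_has_integral:
  assumes h: "valid h"
  shows "((\<lambda>s. pd s \<bullet> \<delta> h s + p s \<bullet> d\<delta> h s) has_integral (p T \<bullet> \<delta> h T)) {t..T}"
proof -
  obtain Cp where Cp: "Cp-lipschitz_on {ts..T} p" using p_lipschitz by blast
  obtain B where B: "B > 0" "\<And>s. s \<in> {ts..T} \<Longrightarrow> norm (p s) \<le> B" by - (rule p_bound, blast)
  obtain CY where CY: "CY-lipschitz_on {ts - bd..T} (Y h)" using Y_lipschitz_ex[OF h] by blast
  have C\<delta>: "(CY + xC)-lipschitz_on {ts - bd..T} (\<delta> h)"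
    unfolding \<delta>_def[abs_def] by (intro lipschitz_on_diff CY xC)
  have C2h: "C2 * h \<ge> 0" using C_nonneg h by (simp add: valid_def)
  have lip: "(Cp * (C2 * h) + B * (CY + xC))-lipschitz_on {t..T} (\<lambda>s. p s \<bullet> \<delta> h s)"
  proof (rule lipschitz_onI)
    fix r s assume rs: "r \<in> {t..T}" "s \<in> {t..T}"
    have "p r \<bullet> \<delta> h r - p s \<bullet> \<delta> h s = (p r - p s) \<bullet> \<delta> h r + p s \<bullet> (\<delta> h r - \<delta> h s)"
      by (simp add: inner_diff_left inner_diff_right)
    moreover have "\<bar>(p r - p s) \<bullet> \<delta> h r\<bar> \<le> (Cp * \<bar>r - s\<bar>) * (C2 * h)"
    proof -
      have "\<bar>(p r - p s) \<bullet> \<delta> h r\<bar> \<le> norm (p r - p s) * norm (\<delta> h r)" by (rule Cauchy_Schwarz_ineq2)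
      also have "\<dots> \<le> (Cp * \<bar>r - s\<bar>) * (C2 * h)"
        using lipschitz_onD[OF Cp, of r s] rs t lipschitz_on_nonneg[OF Cp] bd_nonneg
        by (intro mult_mono \<delta>_bound[OF h]) (auto simp: dist_norm)
      finally show ?thesis .
    qed
    moreover have "\<bar>p s \<bullet> (\<delta> h r - \<delta> h s)\<bar> \<le> B * ((CY + xC) * \<bar>r - s\<bar>)"
    proof -
      have "\<bar>p s \<bullet> (\<delta> h r - \<delta> h s)\<bar> \<le> norm (p s) * norm (\<delta> h r - \<delta> h s)" by (rule Cauchy_Schwarz_ineq2)
      also have "\<dots> \<le> B * ((CY + xC) * \<bar>r - s\<bar>)"
        using lipschitz_onD[OF C\<delta>, of r s] rs t B bd_nonneg
        by (intro mult_mono B(2)) (auto simp: dist_norm)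
      finally show ?thesis .
    qed
    ultimately have "\<bar>p r \<bullet> \<delta> h r - p s \<bullet> \<delta> h s\<bar> \<le> (Cp * \<bar>r - s\<bar>) * (C2 * h) + B * ((CY + xC) * \<bar>r - s\<bar>)"
      by linarith
    then show "dist (p r \<bullet> \<delta> h r) (p s \<bullet> \<delta> h s) \<le> (Cp * (C2 * h) + B * (CY + xC)) * dist r s"
      by (simp add: dist_real_def algebra_simps)
  next
    have "Cp \<ge> 0" "CY \<ge> 0" using Cp CY lipschitz_on_nonneg by auto
    then show "0 \<le> Cp * (C2 * h) + B * (CY + xC)" using C2h B(1) xC_nonneg by simp
  qed
  have "((\<lambda>s. pd s \<bullet> \<delta> h s + p s \<bullet> d\<delta> h s) has_integral (p T \<bullet> \<delta> h T - p t \<bullet> \<delta> h t)) {t..T}"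
  proof (rule lipschitz_on_has_integral[OF lip _ negligible_not_good[OF h]])
    fix s assume "s \<in> {t<..<T} - ({t<..<T} - good h)"
    then have s: "s \<in> good h" by auto
    then have s': "s \<in> {t<..<T}" "s \<noteq> e h" by (auto simp: good_def)
    have p': "(p has_vector_derivative pd s) (at s)" using s by (simp add: good_def)
    have x': "(x has_vector_derivative along \<tau> f \<alpha> x s) (at s)" using s by (simp add: good_def regularD)
    have "(\<delta> h has_vector_derivative d\<delta> h s) (at s)"
    proof (cases "s < e h")
      case True
      have "((\<lambda>r. (x t + ((r - t) / l) *\<^sub>R \<theta>) - x r) has_vector_derivative (\<theta> /\<^sub>R l - along \<tau> f \<alpha> x s)) (at s)"
        using x' by (auto intro!: derivative_eq_intros simp: divide_inverse)
      then have "(\<delta> h has_vector_derivative (\<theta> /\<^sub>R l - along \<tau> f \<alpha> x s)) (at s)"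
        by (rule has_vector_derivative_transform_within_open[of _ _ _ "{t<..<e h}"])
          (use s' True in \<open>auto simp: \<delta>_def Y_def\<close>)
      then show ?thesis using True by (simp add: d\<delta>_def)
    next
      case False
      then have "(Y h has_vector_derivative along \<tau> f \<alpha> (Y h) s) (at s)" using s s' by (auto simp: good_def)
      then show ?thesis using False s' x' by (auto simp: \<delta>_def[abs_def] d\<delta>_def intro!: has_vector_derivative_diff)
    qed
    then have "((\<lambda>s. p s \<bullet> \<delta> h s) has_derivative (\<lambda>q. p s \<bullet> (q *\<^sub>R d\<delta> h s) + (q *\<^sub>R pd s) \<bullet> \<delta> h s)) (at s)"
      using p' unfolding has_vector_derivative_def by (rule has_derivative_inner[rotated])
    then show "((\<lambda>s. p s \<bullet> \<delta> h s) has_vector_derivative pd s \<bullet> \<delta> h s + p s \<bullet> d\<delta> h s) (at s)"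
      by (simp add: has_vector_derivative_def algebra_simps)
  qed (use t in auto)
  then show ?thesis by (simp add: \<delta>_hist)
qed

end

section \<open>Expansion of the cost\<close>

text \<open>The remainder estimate along a sequence of increments of order \<open>h n\<close>, the
  shape needed for pointwise convergence under an integral.\<close>

lemma has_derivative_little_o:
  assumes der: "(\<phi> has_derivative \<phi>') (at u)" and k: "\<And>n. norm (k n) \<le> C * h n" "\<And>n. h n > 0" "h \<longlonglongrightarrow> 0"
  shows "(\<lambda>n. (\<phi> (u + k n) - \<phi> u - \<phi>' (k n)) /\<^sub>R h n) \<longlonglongrightarrow> 0"
proof (rule LIMSEQ_I)
  fix r :: real assume r: "r > 0"
  have C: "C \<ge> 0" using order_trans[OF norm_ge_zero k(1)[of 0]] k(2)[of 0] by (simp add: zero_le_mult_iff)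
  \<comment> \<open>The added \<open>1\<close> keeps the denominator positive and yields the strict
    bound \<open>\<epsilon> * C < r\<close>.\<close>
  define \<epsilon> where "\<epsilon> = r / (C + 1)"
  have \<epsilon>: "\<epsilon> > 0" using r C by (simp add: \<epsilon>_def)
  obtain d where d: "d > 0" "\<And>y. norm (y - u) < d \<Longrightarrow> norm (\<phi> y - \<phi> u - \<phi>' (y - u)) \<le> \<epsilon> * norm (y - u)"
    using der \<epsilon> unfolding has_derivative_at_alt by blast
  have "(\<lambda>n. C * h n) \<longlonglongrightarrow> 0" using k(3) by (rule tendsto_mult_right_zero)
  then have "\<forall>\<^sub>F n in sequentially. C * h n < d" using d(1) by (rule order_tendstoD)
  then obtain N where N: "\<And>n. n \<ge> N \<Longrightarrow> C * h n < d" by (auto simp: eventually_sequentially)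
  show "\<exists>N. \<forall>n\<ge>N. norm ((\<phi> (u + k n) - \<phi> u - \<phi>' (k n)) /\<^sub>R h n - 0) < r"
  proof (intro exI[of _ N] allI impI)
    fix n assume "n \<ge> N"
    then have "norm (u + k n - u) < d" using k(1)[of n] N[of n] by simp
    then have "norm (\<phi> (u + k n) - \<phi> u - \<phi>' (k n)) \<le> \<epsilon> * norm (k n)" using d(2)[of "u + k n"] by simp
    also have "\<dots> \<le> \<epsilon> * (C * h n)" using \<epsilon> k(1) by (intro mult_left_mono) auto
    also have "\<dots> < r * h n"
    proof -
      have "\<epsilon> * C < r" using r C by (simp add: \<epsilon>_def field_simps)
      then show ?thesis using k(2)[of n] by (simp add: mult.assoc[symmetric])
    qed
    finally show "norm ((\<phi> (u + k n) - \<phi> u - \<phi>' (k n)) /\<^sub>R h n - 0) < r"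
      using k(2)[of n] by (simp add: divide_inverse_commute[symmetric] divide_less_eq)
  qed
qed

context perturbation
begin

lemma segment_\<delta>_cont: "valid h \<Longrightarrow> continuous_on {-bd..0} (segment (\<delta> h) T)"
proof -
  assume h: "valid h"
  have "continuous_on {ts - bd..T} (\<delta> h)"
    unfolding \<delta>_def[abs_def] by (intro continuous_intros Y_cont[OF h] x_cont)
  then show ?thesis
    unfolding segment_def using ts by (elim continuous_on_compose2) (auto intro!: continuous_intros)
qed

text \<open>Translation by \<open>T\<close> moves the history integral to
  \<open>[T - bd, T]\<close>. A part of it below \<open>t\<close> contributes nothing because
  \<open>\<delta>\<close> vanishes there, so \<open>[t, T]\<close> serves as the common interval of
  integration.\<close>

lemma gw_has_integral:
  assumes h: "valid h"
  shows "((\<lambda>s. if s \<in> {T - bd..T} then gw (s - T) \<bullet> \<delta> h s else 0) has_integral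
    (LINT \<theta>|lebesgue_on {-bd..0}. gw \<theta> \<bullet> segment (\<delta> h) T \<theta>)) {t..T}"
proof -
  let ?M = "lebesgue_on {-bd..0}" and ?k = "\<lambda>\<theta>. gw \<theta> \<bullet> segment (\<delta> h) T \<theta>"
  have [measurable]: "gw \<in> borel_measurable ?M" using g_diff by (simp add: has_state_derivative_def)
  have [measurable]: "segment (\<delta> h) T \<in> borel_measurable ?M"
    by (intro continuous_imp_measurable_on_sets_lebesgue segment_\<delta>_cont h) auto
  obtain C where C: "AE \<theta> in ?M. norm (gw \<theta>) \<le> C" using g_diff by (auto simp: has_state_derivative_def)
  have seg: "norm (segment (\<delta> h) T \<theta>) \<le> C2 * h" if "\<theta> \<in> {-bd..0}" for \<theta>
    using \<delta>_bound[OF h, of "T + \<theta>"] that ts by (auto simp: segment_def)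
  have "AE \<theta> in ?M. norm (?k \<theta>) \<le> C * (C2 * h)"
    using C AE_space
  proof eventually_elim
    case (elim \<theta>)
    have "\<bar>?k \<theta>\<bar> \<le> norm (gw \<theta>) * norm (segment (\<delta> h) T \<theta>)" by (rule Cauchy_Schwarz_ineq2)
    also have "\<dots> \<le> C * (C2 * h)"
      using elim seg[of \<theta>] by (intro mult_mono) (auto intro: order_trans[OF norm_ge_zero])
    finally show ?case by simp
  qed
  moreover have "finite_measure ?M" by (intro finite_measure_lebesgue_on) auto
  ultimately have int: "integrable ?M ?k"
    by (intro finite_measure.integrable_const_bound) auto
  then have "(?k has_integral (LINT \<theta>|?M. ?k \<theta>)) {-bd..0}"
    by (rule has_integral_integral_lebesgue_on) auto
  moreover have "?k = (\<lambda>s. gw (s - T) \<bullet> \<delta> h s) \<circ> (+) T" by (auto simp: segment_def)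
  ultimately have "((\<lambda>s. gw (s - T) \<bullet> \<delta> h s) has_integral (LINT \<theta>|?M. ?k \<theta>)) {T - bd..T}"
    by (simp add: has_integral_shift_Icc_real)
  then have "((\<lambda>s. if s \<in> {T - bd..T} then gw (s - T) \<bullet> \<delta> h s else 0) has_integral (LINT \<theta>|?M. ?k \<theta>)) UNIV"
    by (simp only: has_integral_restrict_UNIV)
  moreover have "(\<lambda>s. if s \<in> {T - bd..T} then gw (s - T) \<bullet> \<delta> h s else 0)
     = (\<lambda>s. if s \<in> {t..T} then (if s \<in> {T - bd..T} then gw (s - T) \<bullet> \<delta> h s else 0) else 0)"
    using \<delta>_hist[of _ h] by (auto simp: fun_eq_iff)
  ultimately have "((\<lambda>s. if s \<in> {t..T} then (if s \<in> {T - bd..T} then gw (s - T) \<bullet> \<delta> h s else 0) else 0)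
      has_integral (LINT \<theta>|?M. ?k \<theta>)) UNIV"
    by (simp only:)
  then show ?thesis by (subst (asm) has_integral_restrict_UNIV)
qed

definition Gerr where "Gerr h = g (Y h T) (segment (Y h) T) - g (x T) (segment x T)
  - (gz \<bullet> \<delta> h T + (LINT \<theta>|lebesgue_on {-bd..0}. gw \<theta> \<bullet> segment (\<delta> h) T \<theta>))"

lemma Gerr_little_o:
  assumes "\<epsilon> > 0"
  obtains \<eta> where "\<eta> > 0" "\<And>h. valid h \<Longrightarrow> h < \<eta> \<Longrightarrow> \<bar>Gerr h\<bar> \<le> \<epsilon> * h"
proof -
  \<comment> \<open>The state norm of the terminal deviation is at most \<open>c * h\<close>: its
    value contributes \<open>C2\<close>, its integral over the history \<open>C2 * bd\<close>. The
    added \<open>1\<close> keeps \<open>c\<close> positive.\<close>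
  define c where "c = C2 * (1 + bd) + 1"
  have c: "c > 0" using C_nonneg bd_nonneg by (simp add: c_def add_nonneg_pos)
  have "\<epsilon> / c > 0" using assms c by simp
  then obtain d where d: "d > 0" "\<And>dz dw. (dz, dw) \<in> state_space bd \<Longrightarrow> state_norm bd dz dw < d \<Longrightarrow>
        \<bar>g (x T + dz) (\<lambda>\<theta>. segment x T \<theta> + dw \<theta>) - g (x T) (segment x T)
          - (gz \<bullet> dz + (LINT \<theta>|lebesgue_on {-bd..0}. gw \<theta> \<bullet> dw \<theta>))\<bar>
        \<le> \<epsilon> / c * state_norm bd dz dw"
    using g_diff unfolding has_state_derivative_def by (fastforce simp: case_prod_unfold)
  show thesis
  proof (rule that[of "d / c"])
    show "d / c > 0" using d c by simp
    fix h assume h: "valid h" "h < d / c"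
    have seg: "norm (segment (\<delta> h) T \<theta>) \<le> C2 * h" if "\<theta> \<in> {-bd..0}" for \<theta>
      using \<delta>_bound[OF h(1), of "T + \<theta>"] that ts by (auto simp: segment_def)
    have "state_norm bd (\<delta> h T) (segment (\<delta> h) T) \<le> norm (\<delta> h T) + C2 * h * bd"
      by (rule continuous_state_norm_le[OF segment_\<delta>_cont[OF h(1)] seg bd_nonneg])
    also have "\<dots> \<le> C2 * h + C2 * h * bd" using \<delta>_bound[OF h(1), of T] ts bd_nonneg by auto
    also have "\<dots> \<le> c * h" using h by (simp add: c_def valid_def algebra_simps)
    finally have n: "state_norm bd (\<delta> h T) (segment (\<delta> h) T) \<le> c * h" .
    also have "\<dots> < d" using h c by (simp add: field_simps)
    finally have "state_norm bd (\<delta> h T) (segment (\<delta> h) T) < d" .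
    moreover have "(\<delta> h T, segment (\<delta> h) T) \<in> state_space bd"
    proof -
      obtain CY where CY: "CY-lipschitz_on {ts - bd..T} (Y h)" using Y_lipschitz_ex[OF h(1)] by blast
      have "(CY + xC)-lipschitz_on {ts - bd..T} (\<delta> h)"
        unfolding \<delta>_def[abs_def] by (intro lipschitz_on_diff CY xC)
      then have "segment (\<delta> h) T \<in> Lip bd"
        using ts by (intro segment_Lip[OF lipschitz_on_subset]) auto
      then show ?thesis by (simp add: state_space_def segment_def)
    qed
    ultimately have "\<bar>g (x T + \<delta> h T) (\<lambda>\<theta>. segment x T \<theta> + segment (\<delta> h) T \<theta>) - g (x T) (segment x T)
          - (gz \<bullet> \<delta> h T + (LINT \<theta>|lebesgue_on {-bd..0}. gw \<theta> \<bullet> segment (\<delta> h) T \<theta>))\<bar>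
        \<le> \<epsilon> / c * state_norm bd (\<delta> h T) (segment (\<delta> h) T)"
      by (intro d(2))
    moreover have "x T + \<delta> h T = Y h T" "(\<lambda>\<theta>. segment x T \<theta> + segment (\<delta> h) T \<theta>) = segment (Y h) T"
      by (auto simp: \<delta>_def segment_def)
    ultimately have "\<bar>Gerr h\<bar> \<le> \<epsilon> / c * state_norm bd (\<delta> h T) (segment (\<delta> h) T)"
      by (simp add: Gerr_def)
    also have "\<dots> \<le> \<epsilon> / c * (c * h)" using n assms c by (intro mult_left_mono) auto
    finally show "\<bar>Gerr h\<bar> \<le> \<epsilon> * h" using c by simp
  qed
qed

lemma \<delta>_D_absolutely_integrable:
  assumes h: "valid h"
  shows "(\<lambda>s. \<Phi>y s \<bullet> \<delta> h (D s)) absolutely_integrable_on {t<..<T}"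
proof -
  obtain K where K: "K > 0" "\<And>s. s \<in> {ts<..<T} \<Longrightarrow> norm (\<Phi>z s) \<le> K" "\<And>s. s \<in> {ts<..<T} \<Longrightarrow> norm (\<Phi>y s) \<le> K"
    by - (rule \<Phi>_bounded, blast)
  have sub: "{t<..<T} \<subseteq> {ts<..<T}" using t by auto
  have \<Phi>m: "\<Phi>y \<in> borel_measurable (lebesgue_on {t<..<T})"
    by (rule measurable_restrict_mono[OF \<Phi>y_measurable sub])
  have "continuous_on {ts - bd..T} (\<delta> h)"
    unfolding \<delta>_def[abs_def] by (intro continuous_intros Y_cont[OF h] x_cont)
  then have "continuous_on {t<..<T} (\<lambda>s. \<delta> h (D s))"
  proof (rule continuous_on_compose2)
    show "continuous_on {t<..<T} D" using t by (intro continuous_on_subset[OF D_cont]) auto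
    show "D ` {t<..<T} \<subseteq> {ts - bd..T}"
    proof safe
      fix s assume "s \<in> {t<..<T}"
      then show "D s \<in> {ts - bd..T}" using D_in[of s] t by auto
    qed
  qed
  then have \<delta>m: "(\<lambda>s. \<delta> h (D s)) \<in> borel_measurable (lebesgue_on {t<..<T})"
    by (intro continuous_imp_measurable_on_sets_lebesgue) auto
  show ?thesis
  proof (rule bounded_measurable_absolutely_integrable)
    show "(\<lambda>s. \<Phi>y s \<bullet> \<delta> h (D s)) \<in> borel_measurable (lebesgue_on {t<..<T})"
      by (rule borel_measurable_inner[OF \<Phi>m \<delta>m])
    fix s assume s: "s \<in> {t<..<T}"
    then have "D s \<in> {ts - bd..T}" using D_in[of s] t by auto
    then have "norm (\<Phi>y s) * norm (\<delta> h (D s)) \<le> K * (C2 * h)"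
      using s sub K(1) by (intro mult_mono K(3) \<delta>_bound h) auto
    then show "norm (\<Phi>y s \<bullet> \<delta> h (D s)) \<le> K * (C2 * h)"
      using Cauchy_Schwarz_ineq2[of "\<Phi>y s" "\<delta> h (D s)"] by simp
  qed auto
qed

text \<open>The part of \<open>\<kappa>\<close> without running cost, equal to
  \<open>p s \<bullet> d\<delta> h s\<close> before \<open>e h\<close>. The running cost in
  \<open>\<kappa>\<close> arises from the comparison of the two costs instead.\<close>

definition \<kappa>1 where "\<kappa>1 s = (p s \<bullet> \<theta>) / l - along \<tau> f \<alpha> x s \<bullet> p s"

lemma along_x_integrable:
  "along \<tau> L \<alpha> x integrable_on {t..T}" "\<kappa>1 integrable_on {t..T}" "\<kappa> integrable_on {t..T}"
proof -
  obtain R where R: "R > 0" "\<And>s. s \<in> {ts - bd..T} \<Longrightarrow> norm (x s) \<le> R" using x by - (erule traj_bounded, blast)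
  obtain B where B: "B > 0" "\<And>s. s \<in> {ts..T} \<Longrightarrow> norm (p s) \<le> B" by - (rule p_bound, blast)
  have \<alpha>t: "\<alpha> \<in> controls A t T" using t by (intro controls_restrict[OF \<alpha>]) auto
  have tT: "t \<in> {t0..<T}" using t ts by auto
  have xt: "traj t (segment x t) \<alpha> x" using t by (intro traj_restrict[OF x]) auto
  show L: "along \<tau> L \<alpha> x integrable_on {t..T}"
    by (rule along_L_bounds(3)[OF xt tT \<alpha>t, of R]) (use R t in auto)
  let ?M = "lebesgue_on {t<..<T}"
  have [measurable]: "along \<tau> f \<alpha> x \<in> borel_measurable ?M"
    using tT t \<alpha>t by (intro along_measurable[OF f_cont, of t] continuous_on_subset[OF x_cont]) (auto simp: controls_def)
  have [measurable]: "p \<in> borel_measurable ?M"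
    by (rule continuous_imp_measurable_on_sets_lebesgue, rule continuous_on_subset[OF p_cont]) (use t in auto)
  show \<kappa>1: "\<kappa>1 integrable_on {t..T}"
  proof (rule bounded_measurable_integrable_on_Icc)
    show "\<kappa>1 \<in> borel_measurable ?M" unfolding \<kappa>1_def[abs_def] by measurable
    fix s assume s: "s \<in> {t<..<T}"
    have pB: "norm (p s) \<le> B" using s t by (intro B) auto
    have "s - \<tau> s (x s) \<in> {t - bd..s}" using s tT by (intro delayed_in) auto
    then have "norm (x (s - \<tau> s (x s))) \<le> R" "norm (x s) \<le> R" using s t bd_nonneg by (auto intro!: R(2))
    then have "Cf * (1 + norm (x s) + norm (x (s - \<tau> s (x s)))) \<le> Cf * (1 + 2 * R)"
      using Cf(1) by (intro mult_left_mono) auto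
    moreover have "norm (along \<tau> f \<alpha> x s) \<le> Cf * (1 + norm (x s) + norm (x (s - \<tau> s (x s))))"
      unfolding along_def using s t ts \<alpha>_in[of s] by (intro Cf) auto
    ultimately have "norm (along \<tau> f \<alpha> x s) \<le> Cf * (1 + 2 * R)" by linarith
    then have "norm (along \<tau> f \<alpha> x s) * norm (p s) \<le> (Cf * (1 + 2 * R)) * B"
      using pB Cf(1) R(1) by (intro mult_mono) auto
    then have "\<bar>along \<tau> f \<alpha> x s \<bullet> p s\<bar> \<le> (Cf * (1 + 2 * R)) * B"
      using Cauchy_Schwarz_ineq2[of "along \<tau> f \<alpha> x s" "p s"] by linarith
    moreover have "\<bar>(p s \<bullet> \<theta>) / l\<bar> \<le> B * norm \<theta> / l"
      using Cauchy_Schwarz_ineq2[of "p s" \<theta>] mult_right_mono[OF pB norm_ge_zero[of \<theta>]] l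
      by (simp add: divide_right_mono)
    ultimately show "norm (\<kappa>1 s) \<le> B * norm \<theta> / l + (Cf * (1 + 2 * R)) * B"
      unfolding \<kappa>1_def real_norm_def by linarith
  qed
  have "\<kappa> = (\<lambda>s. \<kappa>1 s - along \<tau> L \<alpha> x s)" by (auto simp: \<kappa>_def \<kappa>1_def)
  then show "\<kappa> integrable_on {t..T}" using integrable_diff[OF \<kappa>1 L] by simp
qed

text \<open>
  The terms \<open>\<Phi>y s \<bullet> \<delta> h (D s)\<close> and its image under the substitution \<open>r = D s\<close> have the same integral;
  inserting both makes the integrand of order \<open>o(h)\<close> pointwise by the adjoint equation.
\<close>

definition E where
  "E h s = (if s \<in> {e h..T} then along \<tau> L \<alpha> (Y h) s - along \<tau> L \<alpha> x s else 0)
    + (pd s \<bullet> \<delta> h s + p s \<bullet> d\<delta> h s)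
    - (if s \<in> {t..e h} then \<kappa>1 s else 0)
    + (if s \<in> {T - bd..T} then gw (s - T) \<bullet> \<delta> h s else 0)
    - \<Phi>y s \<bullet> \<delta> h (D s)
    + (if s \<in> {ts..D T} then vector_derivative \<gamma> (at s) *\<^sub>R (\<Phi>y (\<gamma> s) \<bullet> \<delta> h s) else 0)"

definition Q where
  "Q h = (integral {e h..T} (along \<tau> L \<alpha> (Y h)) + g (Y h T) (segment (Y h) T))
      - (integral {t..T} (along \<tau> L \<alpha> x) + g (x T) (segment x T))"

lemma E_has_integral:
  assumes h: "valid h"
  shows "(E h has_integral (Q h - Gerr h - integral {t..e h} \<kappa>)) {t..T}"
proof -
  have eh: "e h \<in> {t<..<T}" by (rule e_in[OF h])
  obtain S where S: "\<And>s. s \<in> {e h - bd..T} \<Longrightarrow> norm (Y h s) \<le> S" using Y_traj[OF h] by - (erule traj_bounded, blast)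
  have LY: "along \<tau> L \<alpha> (Y h) integrable_on {e h..T}"
    by (rule along_L_bounds(3)[OF Y_traj[OF h] e_ts(1)[OF h] \<alpha>_e[OF h] S])
  have Lx: "along \<tau> L \<alpha> x integrable_on {e h..T}" "along \<tau> L \<alpha> x integrable_on {t..e h}"
    using eh by (auto intro!: integrable_subinterval_real[OF along_x_integrable(1)])
  have \<kappa>1: "\<kappa>1 integrable_on {t..e h}"
    using eh by (auto intro!: integrable_subinterval_real[OF along_x_integrable(2)])
  let ?IY = "integral {e h..T} (along \<tau> L \<alpha> (Y h))" and ?Ix = "integral {e h..T} (along \<tau> L \<alpha> x)"
    and ?Gw = "LINT \<theta>|lebesgue_on {-bd..0}. gw \<theta> \<bullet> segment (\<delta> h) T \<theta>"
    and ?I5 = "integral {t..T} (\<lambda>s. \<Phi>y s \<bullet> \<delta> h (D s))"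
  have "((\<lambda>s. along \<tau> L \<alpha> (Y h) s - along \<tau> L \<alpha> x s) has_integral (?IY - ?Ix)) {e h..T}"
    using LY Lx by (intro has_integral_diff) auto
  then have 1: "((\<lambda>s. if s \<in> {e h..T} then along \<tau> L \<alpha> (Y h) s - along \<tau> L \<alpha> x s else 0) has_integral (?IY - ?Ix)) {t..T}"
    using eh by (subst has_integral_restrict) auto
  have 3: "((\<lambda>s. if s \<in> {t..e h} then \<kappa>1 s else 0) has_integral integral {t..e h} \<kappa>1) {t..T}"
    using eh \<kappa>1 by (subst has_integral_restrict) auto
  have t': "t \<in> {ts..T}" using t by auto
  note cov = delayed_change_of_variables[OF t' \<delta>_D_absolutely_integrable[OF h] \<delta>_hist]
  have 5: "((\<lambda>s. \<Phi>y s \<bullet> \<delta> h (D s)) has_integral ?I5) {t..T}"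
    using set_lebesgue_integral_eq_integral(1)[OF \<delta>_D_absolutely_integrable[OF h]]
    by (simp add: integrable_on_open_interval_real integrable_integral)
  have 6: "((\<lambda>s. if s \<in> {ts..D T} then vector_derivative \<gamma> (at s) *\<^sub>R (\<Phi>y (\<gamma> s) \<bullet> \<delta> h s) else 0) has_integral ?I5) {t..T}"
    using set_lebesgue_integral_eq_integral(1)[OF cov(1)] cov(2) by (simp only: has_integral_iff)
  have sum: "(E h has_integral ((?IY - ?Ix) + p T \<bullet> \<delta> h T - integral {t..e h} \<kappa>1 + ?Gw - ?I5 + ?I5)) {t..T}"
    unfolding E_def[abs_def]
    by (intro has_integral_add has_integral_diff 1 3 5 6 p_\<delta>_has_integral gw_has_integral h)
  have "integral {t..T} (along \<tau> L \<alpha> x) = integral {t..e h} (along \<tau> L \<alpha> x) + ?Ix"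
    using eh by (intro Henstock_Kurzweil_Integration.integral_combine[symmetric] along_x_integrable) auto
  moreover have "integral {t..e h} \<kappa> = integral {t..e h} \<kappa>1 - integral {t..e h} (along \<tau> L \<alpha> x)"
  proof -
    have "\<kappa> = (\<lambda>s. \<kappa>1 s - along \<tau> L \<alpha> x s)" by (auto simp: \<kappa>_def \<kappa>1_def)
    then show ?thesis using Henstock_Kurzweil_Integration.integral_diff[OF \<kappa>1 Lx(2)] by simp
  qed
  \<comment> \<open>\<open>Q h\<close> subtracts the running cost of \<open>x\<close> on
    \<open>[t, e h]\<close>, which has no counterpart for \<open>Y h\<close>; joined to
    \<open>\<kappa>1\<close> it gives \<open>\<kappa>\<close>. The linear term at \<open>T\<close>
    matches that in \<open>Gerr\<close> because \<open>p T = gz\<close>.\<close>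
  ultimately have "(?IY - ?Ix) + p T \<bullet> \<delta> h T - integral {t..e h} \<kappa>1 + ?Gw - ?I5 + ?I5 = Q h - Gerr h - integral {t..e h} \<kappa>"
    unfolding Q_def Gerr_def by (simp add: terminal)
  then show ?thesis using sum by simp
qed

text \<open>The advanced term and the \<open>gw\<close> term of \<open>E\<close> cancel those in
  \<open>pd\<close>, and before \<open>e h\<close> the term \<open>\<kappa>1\<close> cancels as
  well. For a fixed \<open>s\<close> the case \<open>s > e h\<close> is the one that remains as
  \<open>h\<close> tends to zero: an increment of \<open>\<psi>\<close> against its linear
  part.\<close>

lemma E_good:
  assumes s: "s \<in> good h"
  shows "E h s = (if s > e h then \<psi> s (Y h s) (Y h (s - \<tau> s (Y h s))) - \<psi> s (x s) (x (D s)) else 0)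
    - \<Phi>z s \<bullet> \<delta> h s + (vector_derivative x (at (D s)) \<bullet> \<Phi>y s) * (\<tau>\<^sub>z \<tau> s (x s) \<bullet> \<delta> h s) - \<Phi>y s \<bullet> \<delta> h (D s)"
proof -
  have pd: "pd s \<bullet> \<delta> h s = - (\<Phi>z s \<bullet> \<delta> h s) + (vector_derivative x (at (D s)) \<bullet> \<Phi>y s) * (\<tau>\<^sub>z \<tau> s (x s) \<bullet> \<delta> h s)
    - (if s \<in> {ts..D T} then vector_derivative \<gamma> (at s) *\<^sub>R (\<Phi>y (\<gamma> s) \<bullet> \<delta> h s) else 0)
    - (if s \<in> {T - bd..T} then gw (s - T) \<bullet> \<delta> h s else 0)"
    unfolding pd_def by (simp add: inner_diff_left inner_add_left)
  have "s \<in> {t<..<T}" "s \<noteq> e h" using s by (auto simp: good_def)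
  then consider "s < e h" "s \<in> {t..e h}" "s \<notin> {e h..T}" | "s > e h" "s \<notin> {t..e h}" "s \<in> {e h..T}" by fastforce
  then show ?thesis
  proof cases
    case 1
    then have "p s \<bullet> d\<delta> h s = \<kappa>1 s"
      by (simp add: d\<delta>_def \<kappa>1_def inner_diff_right divide_inverse inner_commute)
    then show ?thesis using 1 pd unfolding E_def by simp
  next
    case 2
    then have "p s \<bullet> d\<delta> h s = along \<tau> f \<alpha> (Y h) s \<bullet> p s - along \<tau> f \<alpha> x s \<bullet> p s"
      by (simp add: d\<delta>_def inner_diff_right inner_commute)
    then show ?thesis using 2 pd \<psi>_along[of s "Y h"] \<psi>_along[of s x] unfolding E_def D_def by simp
  qed
qed

text \<open>The condition \<open>D s \<noteq> t\<close> decides the phase of the delayed deviation: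
  it vanishes near \<open>D s\<close> if \<open>D s < t\<close>, and \<open>D s\<close> lies beyond
  \<open>e h\<close> for small \<open>h\<close> if \<open>D s > t\<close>.\<close>

definition good0 where "good0 = {s \<in> {t<..<T}. D s \<noteq> t \<and> x differentiable (at (D s))}"

lemma negligible_not_good0: "negligible ({t<..<T} - good0)"
proof -
  let ?N = "{t} \<union> {r \<in> {ts - bd<..<T}. \<not> x differentiable (at r)}"
  have "negligible ?N" using lipschitz_on_differentiable_ae[OF xC] by (simp add: negligible_Un)
  then have "negligible {s \<in> {ts..T}. D s \<in> ?N}" by (rule negligible_D_vimage)
  then show ?thesis
  proof (rule negligible_subset, intro subsetI)
    fix s assume s: "s \<in> {t<..<T} - good0"
    \<comment> \<open>Since \<open>ts < t\<close>, the delayed time stays strictly inside the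
      interval on which \<open>x\<close> is Lipschitz, where almost every point is a point of
      differentiability.\<close>
    have "s - \<tau> s (x s) \<in> {t - bd..s}" using s t ts \<tau>_le[of s "x s"] by (intro delayed_in) auto
    then have "D s \<in> {ts - bd<..<T}" using s t by (auto simp: D_def)
    then show "s \<in> {s \<in> {ts..T}. D s \<in> ?N}" using s t by (auto simp: good0_def)
  qed
qed

lemma good0D:
  assumes "s \<in> good0"
  shows "s \<in> {t<..<T}" "s \<in> {ts<..<T}" "s \<in> {t0<..<T}" "D s \<noteq> t" "D s \<in> {ts - bd<..<T}" "D s \<in> {ts - bd..T}"
    "(x has_vector_derivative vector_derivative x (at (D s))) (at (D s))"
    "norm (vector_derivative x (at (D s))) \<le> xC"
proof -
  show s: "s \<in> {t<..<T}" "D s \<noteq> t" using assms by (auto simp: good0_def)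
  show "s \<in> {ts<..<T}" "s \<in> {t0<..<T}" using s t ts by auto
  have "s - \<tau> s (x s) \<in> {t - bd..s}" using s t ts by (intro delayed_in) auto
  then show D: "D s \<in> {ts - bd<..<T}" using s t by (auto simp: D_def)
  then show "D s \<in> {ts - bd..T}" by auto
  show d: "(x has_vector_derivative vector_derivative x (at (D s))) (at (D s))"
    using assms by (simp add: good0_def vector_derivative_works[symmetric])
  show "norm (vector_derivative x (at (D s))) \<le> xC"
    by (rule lipschitz_on_derivative_bound[OF xC D d])
qed

section \<open>Size and pointwise limit of \<open>E h\<close>\<close>

lemma delayed_Y_diff:
  assumes h: "valid h" and s: "s \<in> {ts..T}"
  shows "norm (Y h (s - \<tau> s (Y h s)) - x (D s)) \<le> (1 + xC * l\<tau>) * C2 * h"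
proof -
  have "s - \<tau> s (Y h s) \<in> {ts - bd..s}" using s ts by (intro delayed_in) auto
  then have "norm (\<delta> h (s - \<tau> s (Y h s))) \<le> C2 * h" using s by (intro \<delta>_bound[OF h]) auto
  moreover have "norm (\<delta> h s) \<le> C2 * h" using s bd_nonneg by (intro \<delta>_bound[OF h]) auto
  then have "xC * l\<tau> * norm (\<delta> h s) \<le> xC * l\<tau> * (C2 * h)"
    using xC_nonneg l\<tau>(1) by (intro mult_left_mono) auto
  ultimately show ?thesis
    using delayed_diff_le[OF xC _ s, of "Y h"] ts by (simp add: D_def \<delta>_def algebra_simps)
qed

text \<open>The constant for dominated convergence: each term is estimated linearly in
  \<open>\<delta>\<close>. The restriction \<open>h \<le> 1\<close> keeps \<open>Y h\<close> in the
  ball of radius \<open>R + C2\<close>, where one Lipschitz constant of \<open>\<psi>\<close>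
  serves.\<close>

lemma E_bound:
  obtains C where "\<And>h s. valid h \<Longrightarrow> h \<le> 1 \<Longrightarrow> s \<in> good h \<Longrightarrow> s \<in> good0 \<Longrightarrow> \<bar>E h s\<bar> \<le> C * h"
proof -
  obtain R where R: "R > 0" "\<And>s. s \<in> {ts - bd..T} \<Longrightarrow> norm (x s) \<le> R" using x by - (erule traj_bounded, blast)
  have RC: "R + C2 > 0" using R(1) C_nonneg by simp
  obtain K where K: "K > 0" "\<And>s z y z' y'. s \<in> {ts<..<T} \<Longrightarrow> norm z \<le> R + C2 \<Longrightarrow> norm y \<le> R + C2 \<Longrightarrow> norm z' \<le> R + C2 \<Longrightarrow> norm y' \<le> R + C2 \<Longrightarrow>
    \<bar>\<psi> s z y - \<psi> s z' y'\<bar> \<le> K * (norm (z - z') + norm (y - y'))"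
    using RC by (rule \<psi>_lipschitz) blast
  obtain K' where K': "K' > 0" "\<And>s. s \<in> {ts<..<T} \<Longrightarrow> norm (\<Phi>z s) \<le> K'" "\<And>s. s \<in> {ts<..<T} \<Longrightarrow> norm (\<Phi>y s) \<le> K'"
    by - (rule \<Phi>_bounded, blast)
  show thesis
  proof (rule that[of "K * (C2 + (1 + xC * l\<tau>) * C2) + K' * C2 + (xC * K') * (l\<tau> * C2) + K' * C2"])
    fix h s assume h: "valid h" "h \<le> 1" and s: "s \<in> good h" "s \<in> good0"
    note s' = good0D[OF s(2)]
    have h0: "h \<ge> 0" using h by (simp add: valid_def)
    have sT: "s \<in> {ts..T}" "s \<in> {ts - bd..T}" using s'(2) bd_nonneg by auto
    have Yb: "norm (Y h r) \<le> R + C2" if "r \<in> {ts - bd..T}" for r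
    proof -
      have "norm (Y h r) \<le> norm (x r) + norm (\<delta> h r)" unfolding \<delta>_def by norm
      moreover have "C2 * h \<le> C2 * 1" using h C_nonneg by (intro mult_left_mono) auto
      ultimately show ?thesis using R(2)[OF that] \<delta>_bound[OF h(1) that] by linarith
    qed
    have xb: "norm (x r) \<le> R + C2" if "r \<in> {ts - bd..T}" for r
      using R(2)[OF that] C_nonneg by simp
    have dY: "s - \<tau> s (Y h s) \<in> {ts - bd..T}" using delayed_in[of ts s "Y h s"] sT ts by auto
    have d: "norm (\<delta> h s) \<le> C2 * h" "norm (\<delta> h (D s)) \<le> C2 * h"
      using sT s'(6) by (auto intro!: \<delta>_bound[OF h(1)])
    have cs: "\<bar>u \<bullet> v\<bar> \<le> a * b" if "norm u \<le> a" "norm v \<le> b" for u v :: "real^'n" and a b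
    proof -
      have "\<bar>u \<bullet> v\<bar> \<le> norm u * norm v" by (rule Cauchy_Schwarz_ineq2)
      also have "\<dots> \<le> a * b" using that by (intro mult_mono) (auto intro: order_trans[OF norm_ge_zero])
      finally show ?thesis .
    qed
    have b1: "\<bar>\<psi> s (Y h s) (Y h (s - \<tau> s (Y h s))) - \<psi> s (x s) (x (D s))\<bar> \<le> K * (C2 * h + (1 + xC * l\<tau>) * C2 * h)"
    proof -
      have "\<bar>\<psi> s (Y h s) (Y h (s - \<tau> s (Y h s))) - \<psi> s (x s) (x (D s))\<bar>
        \<le> K * (norm (Y h s - x s) + norm (Y h (s - \<tau> s (Y h s)) - x (D s)))"
        using sT s' dY by (intro K(2) Yb xb)
      also have "\<dots> \<le> K * (C2 * h + (1 + xC * l\<tau>) * C2 * h)"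
        using K(1) d(1) delayed_Y_diff[OF h(1) sT(1)] by (intro mult_left_mono add_mono) (auto simp: \<delta>_def)
      finally show ?thesis .
    qed
    have "0 \<le> K * (C2 * h + (1 + xC * l\<tau>) * C2 * h)"
      using b1 by linarith
    with b1 have b1': "\<bar>if s > e h then \<psi> s (Y h s) (Y h (s - \<tau> s (Y h s))) - \<psi> s (x s) (x (D s)) else 0\<bar>
      \<le> K * (C2 * h + (1 + xC * l\<tau>) * C2 * h)" by simp
    have b2: "\<bar>\<Phi>z s \<bullet> \<delta> h s\<bar> \<le> K' * (C2 * h)" using K'(2)[OF s'(2)] d(1) by (rule cs)
    have b3: "\<bar>\<Phi>y s \<bullet> \<delta> h (D s)\<bar> \<le> K' * (C2 * h)" using K'(3)[OF s'(2)] d(2) by (rule cs)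
    have "\<bar>(vector_derivative x (at (D s)) \<bullet> \<Phi>y s) * (\<tau>\<^sub>z \<tau> s (x s) \<bullet> \<delta> h s)\<bar> \<le> (xC * K') * (l\<tau> * (C2 * h))"
      unfolding abs_mult using s'(8) K'(1) K'(3)[OF s'(2)] \<tau>\<^sub>z_bound[OF s'(3), of "x s"] d(1) xC_nonneg
      by (intro mult_mono cs) auto
    then have "\<bar>E h s\<bar> \<le> K * (C2 * h + (1 + xC * l\<tau>) * C2 * h) + K' * (C2 * h) + (xC * K') * (l\<tau> * (C2 * h)) + K' * (C2 * h)"
      unfolding E_good[OF s(1)] using b1' b2 b3 by linarith
    then show "\<bar>E h s\<bar> \<le> (K * (C2 + (1 + xC * l\<tau>) * C2) + K' * C2 + (xC * K') * (l\<tau> * C2) + K' * C2) * h"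
      by (simp add: algebra_simps)
  qed
qed

text \<open>Splitting \<open>\<Delta> n\<close> into the deviation at \<open>dY n\<close> and the
  displacement of \<open>x\<close> from \<open>D s\<close> to \<open>dY n\<close> isolates four
  remainders: of \<open>\<psi>\<close>, of \<open>\<tau>\<close>, of \<open>x\<close> at
  \<open>D s\<close>, and of \<open>\<delta>\<close> under the change of delayed time. To first
  order the displacement is \<open>x'\<close> times minus the inner product of
  \<open>\<tau>\<^sub>z\<close> with \<open>a n\<close>, which cancels the
  \<open>\<tau>\<^sub>z\<close> term of the adjoint equation.\<close>

lemma E_limit:
  assumes h: "\<And>n. valid (h n)" "h \<longlonglongrightarrow> 0" and s: "s \<in> good0" "\<And>n. s \<in> good (h n)"
  shows "(\<lambda>n. E (h n) s / h n) \<longlonglongrightarrow> 0"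
proof -
  note s' = good0D[OF s(1)]
  have hpos: "h n > 0" for n using h(1)[of n] by (simp add: valid_def)
  have sT: "s \<in> {ts..T}" "s \<in> {ts - bd..T}" using s'(2) bd_nonneg by auto
  define a where "a n = \<delta> (h n) s" for n
  define dY where "dY n = s - \<tau> s (Y (h n) s)" for n
  define q where "q n = dY n - D s" for n
  define \<Delta> where "\<Delta> n = Y (h n) (dY n) - x (D s)" for n
  define x' where "x' = vector_derivative x (at (D s))"
  have Ya: "Y (h n) s = x s + a n" for n by (simp add: a_def \<delta>_def)
  have a: "norm (a n) \<le> C2 * h n" for n unfolding a_def using sT by (intro \<delta>_bound h)
  have q_eq: "q n = - (\<tau> s (x s + a n) - \<tau> s (x s))" for n by (simp add: q_def dY_def Ya D_def)
  have q: "norm (q n) \<le> (l\<tau> * C2) * h n" for n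
  proof -
    have "\<bar>\<tau> s (x s + a n) - \<tau> s (x s)\<bar> \<le> l\<tau> * norm (x s + a n - x s)" using s'(3) by (intro l\<tau>) auto
    also have "\<dots> \<le> l\<tau> * (C2 * h n)" using a[of n] l\<tau>(1) by (intro mult_left_mono) auto
    finally show ?thesis by (simp add: q_eq abs_minus_commute)
  qed
  have \<Delta>: "norm (\<Delta> n) \<le> ((1 + xC * l\<tau>) * C2) * h n" for n
    unfolding \<Delta>_def dY_def using delayed_Y_diff[OF h(1) sT(1)] by simp
  have dY_in: "dY n \<in> {ts - bd..T}" for n
    using delayed_in[of ts s "Y (h n) s"] sT ts by (auto simp: dY_def)
  have q0: "q \<longlonglongrightarrow> 0"
    using q by (intro Lim_null_comparison[OF always_eventually tendsto_mult_right_zero[OF h(2)]]) blast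
  have e0: "(\<lambda>n. e (h n)) \<longlonglongrightarrow> t + 0 * l" unfolding e_def by (intro tendsto_intros h)
  have T1: "(\<lambda>n. (\<psi> s (x s + a n) (x (D s) + \<Delta> n) - \<psi> s (x s) (x (D s)) - (\<Phi>z s \<bullet> a n + \<Phi>y s \<bullet> \<Delta> n)) /\<^sub>R h n) \<longlonglongrightarrow> 0"
  proof -
    have "norm (a n, \<Delta> n) \<le> (C2 + (1 + xC * l\<tau>) * C2) * h n" for n
      using norm_Pair_le[of "a n" "\<Delta> n"] a[of n] \<Delta>[of n] by (simp add: algebra_simps)
    from has_derivative_little_o[OF \<psi>_has_derivative[OF s'(2)] this hpos h(2)]
    show ?thesis by simp
  qed
  have T2: "(\<lambda>n. (\<tau> s (x s + a n) - \<tau> s (x s) - \<tau>\<^sub>z \<tau> s (x s) \<bullet> a n) /\<^sub>R h n) \<longlonglongrightarrow> 0"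
  proof -
    have "norm (0::real, a n) \<le> C2 * h n" for n using a[of n] by simp
    from has_derivative_little_o[OF \<tau>_partials[OF s'(3)] this hpos h(2)]
    show ?thesis by simp
  qed
  have T3: "(\<lambda>n. (x (dY n) - x (D s) - q n *\<^sub>R x') /\<^sub>R h n) \<longlonglongrightarrow> 0"
    using has_derivative_little_o[OF s'(7)[unfolded has_vector_derivative_def] q hpos h(2)]
    by (simp add: q_def x'_def)
  \<comment> \<open>If \<open>D s < t\<close>, both arguments eventually lie where
    \<open>\<delta>\<close> vanishes. If \<open>D s > t\<close>, both eventually lie beyond
    \<open>e (h n)\<close>, and \<open>\<delta>_lipschitz\<close> leaves the factor
    \<open>\<bar>q n\<bar>\<close>, which tends to zero.\<close>
  have T4: "(\<lambda>n. (\<delta> (h n) (dY n) - \<delta> (h n) (D s)) /\<^sub>R h n) \<longlonglongrightarrow> 0"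
  proof (cases "D s < t")
    case True
    then have "\<forall>\<^sub>F n in sequentially. q n < t - D s" using q0 by (intro order_tendstoD) auto
    then have "\<forall>\<^sub>F n in sequentially. (\<delta> (h n) (dY n) - \<delta> (h n) (D s)) /\<^sub>R h n = 0"
      by (rule eventually_mono) (use True in \<open>simp add: \<delta>_hist q_def\<close>)
    then show ?thesis by (rule tendsto_eventually)
  next
    case False
    then have Dt: "D s > t" using s'(4) by simp
    have "\<forall>\<^sub>F n in sequentially. e (h n) - q n < D s"
      using tendsto_diff[OF e0 q0] Dt by (intro order_tendstoD) auto
    moreover have "\<forall>\<^sub>F n in sequentially. e (h n) < D s"
      using e0 Dt by (intro order_tendstoD) auto
    ultimately have "\<forall>\<^sub>F n in sequentially. norm ((\<delta> (h n) (dY n) - \<delta> (h n) (D s)) /\<^sub>R h n) \<le> C3 * \<bar>q n\<bar>"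
    proof eventually_elim
      case (elim n)
      have "norm (\<delta> (h n) (dY n) - \<delta> (h n) (D s)) \<le> C3 * h n * \<bar>q n\<bar>"
      proof (cases "dY n \<le> D s")
        case True
        then show ?thesis using \<delta>_lipschitz[OF h(1), of n "dY n" "D s"] elim s'(5)
          by (auto simp: q_def norm_minus_commute)
      next
        case False
        then show ?thesis using \<delta>_lipschitz[OF h(1), of n "D s" "dY n"] elim dY_in[of n]
          by (auto simp: q_def)
      qed
      then show ?case using hpos[of n] by (simp add: divide_inverse_commute[symmetric] divide_le_eq mult_ac)
    qed
    then show ?thesis
      using tendsto_mult_right_zero[OF tendsto_rabs_zero[OF q0]] by (rule Lim_null_comparison)
  qed
  define lim where "lim n = (\<psi> s (x s + a n) (x (D s) + \<Delta> n) - \<psi> s (x s) (x (D s)) - (\<Phi>z s \<bullet> a n + \<Phi>y s \<bullet> \<Delta> n)) /\<^sub>R h n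
    + (\<Phi>y s \<bullet> ((\<delta> (h n) (dY n) - \<delta> (h n) (D s)) /\<^sub>R h n) + \<Phi>y s \<bullet> ((x (dY n) - x (D s) - q n *\<^sub>R x') /\<^sub>R h n)
    - (\<tau> s (x s + a n) - \<tau> s (x s) - \<tau>\<^sub>z \<tau> s (x s) \<bullet> a n) /\<^sub>R h n * (x' \<bullet> \<Phi>y s))" for n
  have "lim \<longlonglongrightarrow> 0 + (\<Phi>y s \<bullet> 0 + \<Phi>y s \<bullet> 0 - 0 * (x' \<bullet> \<Phi>y s))"
    unfolding lim_def[abs_def] by (intro tendsto_intros T1 T2 T3 T4)
  then have "lim \<longlonglongrightarrow> 0" by simp
  moreover have "\<forall>\<^sub>F n in sequentially. lim n = E (h n) s / h n"
  proof -
    have "\<forall>\<^sub>F n in sequentially. e (h n) < s"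
      using e0 s'(1) by (intro order_tendstoD) auto
    then show ?thesis
    proof (rule eventually_mono)
      fix n assume en: "e (h n) < s"
      have Yd: "Y (h n) (dY n) = x (D s) + \<Delta> n" by (simp add: \<Delta>_def)
      have \<Delta>': "\<Delta> n = \<delta> (h n) (dY n) + (x (dY n) - x (D s))" by (simp add: \<Delta>_def \<delta>_def)
      have "E (h n) s = (\<psi> s (x s + a n) (x (D s) + \<Delta> n) - \<psi> s (x s) (x (D s)))
        - \<Phi>z s \<bullet> a n + (x' \<bullet> \<Phi>y s) * (\<tau>\<^sub>z \<tau> s (x s) \<bullet> a n) - \<Phi>y s \<bullet> \<delta> (h n) (D s)"
        unfolding E_good[OF s(2)] using en by (simp add: Yd[symmetric] dY_def Ya a_def[symmetric] x'_def)
      also have "\<dots> = (\<psi> s (x s + a n) (x (D s) + \<Delta> n) - \<psi> s (x s) (x (D s)) - (\<Phi>z s \<bullet> a n + \<Phi>y s \<bullet> \<Delta> n))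
        + (\<Phi>y s \<bullet> (\<delta> (h n) (dY n) - \<delta> (h n) (D s)) + \<Phi>y s \<bullet> (x (dY n) - x (D s) - q n *\<^sub>R x')
        - (\<tau> s (x s + a n) - \<tau> s (x s) - \<tau>\<^sub>z \<tau> s (x s) \<bullet> a n) * (x' \<bullet> \<Phi>y s))"
        unfolding \<Delta>' q_eq by (simp add: algebra_simps inner_diff_right inner_add_right inner_commute[of x'])
      finally show "lim n = E (h n) s / h n"
        by (simp add: lim_def divide_inverse_commute distrib_left right_diff_distrib)
    qed
  qed
  ultimately show ?thesis by (rule Lim_transform_eventually)
qed

text \<open>Along a sequence the exceptional sets of all \<open>E (h n)\<close> have a null union,
  so a single set \<open>S\<close> of full measure carries the dominated convergence.\<close>

lemma integral_E_limit:
  assumes h: "\<And>n. valid (h n)" "\<And>n. h n \<le> 1" "h \<longlonglongrightarrow> 0"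
  shows "(\<lambda>n. integral {t..T} (E (h n)) / h n) \<longlonglongrightarrow> 0"
proof -
  obtain C where C: "\<And>h s. valid h \<Longrightarrow> h \<le> 1 \<Longrightarrow> s \<in> good h \<Longrightarrow> s \<in> good0 \<Longrightarrow> \<bar>E h s\<bar> \<le> C * h"
    by - (rule E_bound, blast)
  have hpos: "h n > 0" for n using h(1)[of n] by (simp add: valid_def)
  define S where "S = {t<..<T} \<inter> good0 \<inter> (\<Inter>n. good (h n))"
  have "negligible (\<Union>n. {t<..<T} - good (h n))"
    using negligible_not_good[OF h(1)] by (intro negligible_countable_Union) auto
  then have "negligible ({t, T} \<union> ({t<..<T} - good0) \<union> (\<Union>n. {t<..<T} - good (h n)))"
    using negligible_not_good0 by (simp add: negligible_Un)
  then have neg: "negligible ({t..T} - S)"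
    by (rule negligible_subset) (auto simp: S_def)
  have sym: "negligible {s \<in> {t..T} - S. F s \<noteq> 0}" "negligible {s \<in> S - {t..T}. F s \<noteq> 0}" for F :: "real \<Rightarrow> real"
  proof -
    show "negligible {s \<in> {t..T} - S. F s \<noteq> 0}" by (rule negligible_subset[OF neg]) auto
    have "{s \<in> S - {t..T}. F s \<noteq> 0} = {}" by (auto simp: S_def)
    then show "negligible {s \<in> S - {t..T}. F s \<noteq> 0}" by (metis negligible_empty)
  qed
  have Ei: "E (h n) integrable_on {t..T}" for n using E_has_integral[OF h(1)] by (rule has_integral_integrable)
  have "(\<lambda>n. integral S (\<lambda>s. E (h n) s / h n)) \<longlonglongrightarrow> integral S (\<lambda>s. 0)"
  proof (rule dominated_convergence(2)[where h = "\<lambda>_. C"])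
    show "(\<lambda>s. E (h n) s / h n) integrable_on S" for n
      by (rule integrable_spike_set[OF integrable_on_divide[OF Ei] sym])
    show "(\<lambda>_. C) integrable_on S"
      by (rule integrable_spike_set[OF integrable_const_ivl sym])
    show "norm (E (h n) s / h n) \<le> C" if "s \<in> S" for n s
      using C[OF h(1,2), of s n] that hpos[of n] by (simp add: S_def divide_le_eq)
    show "(\<lambda>n. E (h n) s / h n) \<longlonglongrightarrow> 0" if "s \<in> S" for s
      using that by (intro E_limit h) (auto simp: S_def)
  qed
  moreover have "integral S (\<lambda>s. E (h n) s / h n) = integral {t..T} (E (h n)) / h n" for n
    using integral_spike_set[OF sym(2,1), of "\<lambda>s. E (h n) s / h n"] by simp
  ultimately show ?thesis by (simp only: integral_0)
qed

end

section \<open>The superdifferential\<close>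

context perturbation
begin

text \<open>This is where continuity of \<open>\<alpha>\<close> at \<open>t\<close> enters. The
  limit from the right suffices, as the integrals of \<open>\<kappa>\<close> run over
  \<open>[t, e h]\<close>.\<close>

lemma \<kappa>_continuous:
  assumes "isCont \<alpha> t"
  shows "continuous (at t within {t..T}) \<kappa>"
proof -
  let ?F = "at t within {t..T}"
  have tT: "t \<in> {t..T}" and tT': "t \<in> {t0..T}" using t ts by auto
  have x_lim: "(x \<longlongrightarrow> x t) ?F"
  proof -
    have "continuous_on {t..T} x" using t bd_nonneg by (intro continuous_on_subset[OF x_cont]) auto
    then show ?thesis using tT by (simp add: continuous_on_def)
  qed
  have xD_lim: "((\<lambda>s. x (s - \<tau> s (x s))) \<longlongrightarrow> x (t - \<tau> t (x t))) ?F"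
  proof -
    have "continuous_on {t..T} (\<lambda>s. x (s - \<tau> s (x s)))"
      using t ts by (intro delayed_continuous continuous_on_subset[OF x_cont]) auto
    then show ?thesis using tT by (simp add: continuous_on_def)
  qed
  have p_lim: "(p \<longlongrightarrow> p t) ?F"
  proof -
    have "continuous_on {t..T} p" using t by (intro continuous_on_subset[OF p_cont]) auto
    then show ?thesis using tT by (simp add: continuous_on_def)
  qed
  have \<alpha>_lim: "(\<alpha> \<longlongrightarrow> \<alpha> t) ?F"
    using assms unfolding isCont_def by (rule tendsto_within_subset) auto
  have ev: "\<forall>\<^sub>F s in ?F. s \<in> {ts<..<T}"
  proof -
    have "\<forall>\<^sub>F s in at t. s \<in> {ts<..<T}" using t by (intro eventually_at_in_open') auto
    then show ?thesis by (rule filter_leD[rotated]) (simp add: at_le)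
  qed
  have lim: "((\<lambda>s. (s, x s, x (s - \<tau> s (x s)), \<alpha> s)) \<longlongrightarrow> (t, x t, x (t - \<tau> t (x t)), \<alpha> t)) ?F"
    by (intro tendsto_Pair tendsto_ident_at x_lim xD_lim \<alpha>_lim)
  have mem: "(t, x t, x (t - \<tau> t (x t)), \<alpha> t) \<in> {t0..T} \<times> UNIV \<times> UNIV \<times> A"
    "\<forall>\<^sub>F s in ?F. (s, x s, x (s - \<tau> s (x s)), \<alpha> s) \<in> {t0..T} \<times> UNIV \<times> UNIV \<times> A"
  proof -
    show "(t, x t, x (t - \<tau> t (x t)), \<alpha> t) \<in> {t0..T} \<times> UNIV \<times> UNIV \<times> A"
      using \<alpha>_in[of t] t by auto
    show "\<forall>\<^sub>F s in ?F. (s, x s, x (s - \<tau> s (x s)), \<alpha> s) \<in> {t0..T} \<times> UNIV \<times> UNIV \<times> A"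
      using ev by (rule eventually_mono) (simp add: \<alpha>_in[simplified] ts[simplified])
  qed
  have "(along \<tau> f \<alpha> x \<longlongrightarrow> along \<tau> f \<alpha> x t) ?F" "(along \<tau> L \<alpha> x \<longlongrightarrow> along \<tau> L \<alpha> x t) ?F"
    using continuous_on_tendsto_compose[OF f_cont lim mem] continuous_on_tendsto_compose[OF L_cont lim mem]
    by (simp_all add: along_def[abs_def])
  then show ?thesis
    unfolding continuous_within \<kappa>_def[abs_def] by (intro tendsto_intros p_lim) (use l in auto)
qed

lemma integral_\<kappa>_limit:
  assumes cont: "isCont \<alpha> t" and h: "\<And>n. valid (h n)" "h \<longlonglongrightarrow> 0"
  shows "(\<lambda>n. integral {t..e (h n)} \<kappa> / h n) \<longlonglongrightarrow> l * \<kappa> t"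
proof -
  have hpos: "h n > 0" for n using h(1)[of n] by (simp add: valid_def)
  have "((\<lambda>u. integral {t..u} \<kappa>) has_vector_derivative \<kappa> t) (at t within ({t..T} - {}))"
    using t \<kappa>_continuous[OF cont] by (intro integral_has_vector_derivative_continuous_at along_x_integrable) auto
  then have "((\<lambda>u. (integral {t..u} \<kappa> - integral {t..t} \<kappa>) / (u - t)) \<longlongrightarrow> \<kappa> t) (at t within {t..T})"
    by (simp add: has_real_derivative_iff_has_vector_derivative[symmetric] has_field_derivative_iff)
  moreover have "filterlim (\<lambda>n. e (h n)) (at t within {t..T}) sequentially"
    unfolding filterlim_at
  proof
    show "\<forall>\<^sub>F n in sequentially. e (h n) \<in> {t..T} \<and> e (h n) \<noteq> t"
    proof (intro always_eventually allI)
      fix n show "e (h n) \<in> {t..T} \<and> e (h n) \<noteq> t" using e_in[OF h(1)[of n]] by auto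
    qed
    have "(\<lambda>n. e (h n)) \<longlonglongrightarrow> t + 0 * l" unfolding e_def by (intro tendsto_intros h)
    then show "(\<lambda>n. e (h n)) \<longlonglongrightarrow> t" by simp
  qed
  ultimately have "(\<lambda>n. (integral {t..e (h n)} \<kappa> - integral {t..t} \<kappa>) / (e (h n) - t)) \<longlonglongrightarrow> \<kappa> t"
    by (rule filterlim_compose)
  \<comment> \<open>The interval \<open>[t, e h]\<close> has length \<open>h * l\<close>, so the
    quotient by \<open>h\<close> is \<open>l\<close> times the average.\<close>
  then have "(\<lambda>n. l * ((integral {t..e (h n)} \<kappa> - integral {t..t} \<kappa>) / (e (h n) - t))) \<longlonglongrightarrow> l * \<kappa> t"
    by (rule tendsto_mult_left)
  then show ?thesis using l by (simp add: e_def)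
qed

lemma Q_limit:
  assumes cont: "isCont \<alpha> t"
  shows "((\<lambda>h. Q h / h) \<longlongrightarrow> l * \<kappa> t) (at_right 0)"
proof (rule tendsto_at_right_sequentially)
  \<comment> \<open>Below this bound every positive \<open>h\<close> is valid and at most
    \<open>1\<close>.\<close>
  show "0 < min 1 ((T - t) / l)" using t l by simp
  fix h :: "nat \<Rightarrow> real" assume hpos: "\<And>n. 0 < h n" and le: "\<And>n. h n < min 1 ((T - t) / l)" and h0: "h \<longlonglongrightarrow> 0"
  have h: "valid (h n)" "h n \<le> 1" for n
    using hpos[of n] le[of n] l by (auto simp: valid_def e_def less_divide_eq)
  have "(\<lambda>n. Gerr (h n) / h n) \<longlonglongrightarrow> 0"
  proof (rule LIMSEQ_I)
    fix r :: real assume "r > 0"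
    then obtain \<eta> where \<eta>: "\<eta> > 0" "\<And>h. valid h \<Longrightarrow> h < \<eta> \<Longrightarrow> \<bar>Gerr h\<bar> \<le> r / 2 * h"
      using Gerr_little_o[of "r / 2"] by (metis half_gt_zero)
    have "\<forall>\<^sub>F n in sequentially. h n < \<eta>" using h0 \<eta>(1) by (rule order_tendstoD)
    then obtain N where N: "\<And>n. n \<ge> N \<Longrightarrow> h n < \<eta>" by (auto simp: eventually_sequentially)
    have "norm (Gerr (h n) / h n - 0) < r" if "n \<ge> N" for n
    proof -
      have "\<bar>Gerr (h n)\<bar> \<le> r / 2 * h n" using \<eta>(2)[OF h(1) N[OF that]] .
      also have "\<dots> < r * h n" using \<open>r > 0\<close> hpos[of n] by simp
      finally show ?thesis using hpos[of n] by (simp add: divide_less_eq)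
    qed
    then show "\<exists>N. \<forall>n\<ge>N. norm (Gerr (h n) / h n - 0) < r" by blast
  qed
  then have "(\<lambda>n. Gerr (h n) / h n + integral {t..e (h n)} \<kappa> / h n + integral {t..T} (E (h n)) / h n) \<longlonglongrightarrow> 0 + l * \<kappa> t + 0"
    by (intro tendsto_add integral_\<kappa>_limit[OF cont] integral_E_limit h h0)
  moreover have "Q (h n) / h n = Gerr (h n) / h n + integral {t..e (h n)} \<kappa> / h n + integral {t..T} (E (h n)) / h n" for n
    using integral_unique[OF E_has_integral[OF h(1)[of n]]] by (simp add: diff_divide_distrib)
  ultimately show "(\<lambda>n. Q (h n) / h n) \<longlonglongrightarrow> l * \<kappa> t" by simp
qed

lemma upper_delay_derivative_le:
  assumes opt: "optimal_control bd T A f L g \<tau> ts ws \<alpha>" and cont: "isCont \<alpha> t"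
  shows "upper_delay_derivative val t (segment x t) l \<theta>
    \<le> ereal (- hamiltonian A f L t (x t) (x (D t)) (p t) * l + p t \<bullet> \<theta>)"
proof -
  have "upper_delay_derivative val t (segment x t) l \<theta>
    = Limsup (at_right 0) (\<lambda>h. ereal ((val (e h) (wh h) - val t (segment x t)) / h))"
    by (simp add: upper_delay_derivative_def Let_def e_def wh_def v_def)
  also have "\<dots> \<le> Limsup (at_right 0) (\<lambda>h. ereal (Q h / h))"
  proof (rule Limsup_mono)
    have "\<forall>\<^sub>F h in at_right 0. h \<in> {0<..<(T - t) / l}"
      using t l by (intro eventually_at_right_real) simp
    then show "\<forall>\<^sub>F h in at_right 0. ereal ((val (e h) (wh h) - val t (segment x t)) / h) \<le> ereal (Q h / h)"
    proof (rule eventually_mono)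
      fix h assume "h \<in> {0<..<(T - t) / l}"
      then have h: "valid h" "h > 0" using l by (auto simp: valid_def e_def less_divide_eq)
      show "ereal ((val (e h) (wh h) - val t (segment x t)) / h) \<le> ereal (Q h / h)"
        using value_diff_le[OF h(1) opt] h(2) by (simp add: Q_def divide_right_mono)
    qed
  qed
  also have "\<dots> = ereal (l * \<kappa> t)"
    using Q_limit[OF cont] by (intro lim_imp_Limsup) auto
  also have "l * \<kappa> t \<le> - hamiltonian A f L t (x t) (x (D t)) (p t) * l + p t \<bullet> \<theta>"
  proof -
    have tt: "t \<in> {t0..T}" "\<alpha> t \<in> A" using \<alpha>_in[of t] t by auto
    let ?H = "\<lambda>a. f t (x t) (x (D t)) a \<bullet> p t + L t (x t) (x (D t)) a"
    \<comment> \<open>Compactness of \<open>A\<close> makes the infimum in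
      \<open>hamiltonian\<close> one over a bounded set, so it lies below the value at
      \<open>\<alpha> t\<close>.\<close>
    have "continuous_on A (\<lambda>a. (\<lambda>(t, z, y, a). f t z y a) (t, x t, x (D t), a))"
      "continuous_on A (\<lambda>a. (\<lambda>(t, z, y, a). L t z y a) (t, x t, x (D t), a))"
      by (rule continuous_on_compose2[OF f_cont] continuous_on_compose2[OF L_cont],
        (intro continuous_intros)[1], use tt in force)+
    then have "continuous_on A ?H" by (simp only: prod.case) (intro continuous_intros)
    then have "bounded (?H ` A)" using A_compact by (intro compact_imp_bounded compact_continuous_image)
    then have "hamiltonian A f L t (x t) (x (D t)) (p t) \<le> ?H (\<alpha> t)"
      unfolding hamiltonian_def by (intro cINF_lower bounded_imp_bdd_below tt)
    also have "\<dots> = along \<tau> f \<alpha> x t \<bullet> p t + along \<tau> L \<alpha> x t" by (simp add: along_def D_def)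
    finally have "l * hamiltonian A f L t (x t) (x (D t)) (p t) \<le> l * (along \<tau> f \<alpha> x t \<bullet> p t + along \<tau> L \<alpha> x t)"
      using l by simp
    moreover have "l * \<kappa> t = p t \<bullet> \<theta> - l * (along \<tau> f \<alpha> x t \<bullet> p t + along \<tau> L \<alpha> x t)"
      using l by (simp add: \<kappa>_def right_diff_distrib)
    ultimately show ?thesis by (simp add: mult.commute)
  qed
  finally show ?thesis by simp
qed

end

theorem theorem5p4:
  fixes t0 T b ts t :: real
    and A :: "(real^'m) set"
    and f :: "real \<Rightarrow> real^'n \<Rightarrow> real^'n \<Rightarrow> real^'m \<Rightarrow> real^'n"
    and L :: "real \<Rightarrow> real^'n \<Rightarrow> real^'n \<Rightarrow> real^'m \<Rightarrow> real"
    and g :: "real^'n \<Rightarrow> (real \<Rightarrow> real^'n) \<Rightarrow> real"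
    and \<tau> :: "real \<Rightarrow> real^'n \<Rightarrow> real"
    and ws x p g\<^sub>w :: "real \<Rightarrow> real^'n"
    and g\<^sub>z :: "real^'n"
    and \<alpha> :: "real \<Rightarrow> real^'m"
    and D \<gamma> :: "real \<Rightarrow> real"
  assumes problem: "delay_control_problem t0 T A f L g \<tau>"
    and b_eq: "b = max_delay t0 T \<tau>"
    and initial: "ts \<in> {t0..<T}" "ws \<in> Lip b"
    and optimal: "optimal_control b T A f L g \<tau> ts ws \<alpha>"
    and x_eq: "x = trajectory b T f \<tau> ts ws \<alpha>"
    and g_diff: "has_state_derivative b g (x T) (segment x T) g\<^sub>z g\<^sub>w"
    and D_eq: "D = (\<lambda>s. s - \<tau> s (x s))"
    and \<gamma>_eq: "\<gamma> = the_inv_into {ts..T} D"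
    and p_lipschitz: "\<exists>C. C-lipschitz_on {ts..T} p"
    and adjoint: "AE s in lebesgue_on {ts<..<T}. (p has_vector_derivative
          (- (transpose (f\<^sub>z f s (x s) (x (D s)) (\<alpha> s)) *v p s)
           - L\<^sub>z L s (x s) (x (D s)) (\<alpha> s)
           + (vector_derivative x (at (D s))
                \<bullet> (transpose (f\<^sub>y f s (x s) (x (D s)) (\<alpha> s)) *v p s)) *\<^sub>R \<tau>\<^sub>z \<tau> s (x s)
           + (vector_derivative x (at (D s))
                \<bullet> L\<^sub>y L s (x s) (x (D s)) (\<alpha> s)) *\<^sub>R \<tau>\<^sub>z \<tau> s (x s)
           - (if s \<in> {ts..D T}
              then vector_derivative \<gamma> (at s) *\<^sub>R
                     (transpose (f\<^sub>y f (\<gamma> s) (x (\<gamma> s)) (x s) (\<alpha> (\<gamma> s))) *v p (\<gamma> s))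
              else 0)
           - (if s \<in> {ts..D T}
              then vector_derivative \<gamma> (at s) *\<^sub>R L\<^sub>y L (\<gamma> s) (x (\<gamma> s)) (x s) (\<alpha> (\<gamma> s))
              else 0)
           - (if s \<in> {T - b..T} then g\<^sub>w (s - T) else 0))) (at s)"
    and terminal: "p T = g\<^sub>z"
    and t: "t \<in> {ts<..<T}" "isCont \<alpha> t"
  shows "(- hamiltonian A f L t (x t) (x (D t)) (p t), p t)
           \<in> delay_superdifferential (value_function b T A f L g \<tau>) t (segment x t)"
proof -
  note t_in = t(1) and t_cont = t(2)
  interpret delay_control_problem t0 T A f L g \<tau> by (rule problem)
  have \<alpha>: "\<alpha> \<in> controls A ts T" using optimal by (simp add: optimal_control_def)
  have x: "is_trajectory (max_delay t0 T \<tau>) T f \<tau> ts ws \<alpha> x"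
    unfolding x_eq b_eq using initial \<alpha> b_eq by (intro trajectory_traj) auto
  interpret C: costate t0 T A f L g \<tau> ts ws \<alpha> x p
    by unfold_locales (use initial \<alpha> x b_eq in auto)
  have D: "D = C.D" by (simp add: D_eq C.D_def fun_eq_iff)
  have \<gamma>: "\<gamma> = C.\<gamma>" by (simp add: \<gamma>_eq D C.\<gamma>_def)
  \<comment> \<open>The advanced term of the adjoint equation contains \<open>x s\<close>, while
    \<open>\<Phi>y\<close> at \<open>\<gamma> s\<close> contains \<open>x (D (\<gamma> s))\<close>.
    They agree on \<open>{ts..D T}\<close>, which lies in the image of \<open>D\<close> because
    \<open>D ts \<le> ts\<close>.\<close>
  have D_\<gamma>: "C.D (C.\<gamma> s) = s" if s: "s \<in> {ts..C.D T}" for s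
  proof -
    have "C.D ts \<le> ts" using C.D_in[of ts] initial by auto
    moreover have "C.D ` {ts..T} = {C.D ts..C.D T}" using initial by (intro C.D_image) auto
    ultimately have "s \<in> C.D ` {ts..T}" using s by auto
    then show ?thesis using C.\<gamma>_D by auto
  qed
  interpret adjoint_trajectory t0 T A f L g \<tau> ts ws \<alpha> x p g\<^sub>z g\<^sub>w
  proof unfold_locales
    show "AE s in lebesgue_on {ts<..<T}. (p has_vector_derivative
          (- C.\<Phi>z s + (vector_derivative x (at (C.D s)) \<bullet> C.\<Phi>y s) *\<^sub>R \<tau>\<^sub>z \<tau> s (x s)
           - (if s \<in> {ts..C.D T} then vector_derivative C.\<gamma> (at s) *\<^sub>R C.\<Phi>y (C.\<gamma> s) else 0)
           - (if s \<in> {T - bd..T} then g\<^sub>w (s - T) else 0))) (at s)"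
      using adjoint
    proof (rule eventually_mono)
      fix s assume "(p has_vector_derivative
          (- (transpose (f\<^sub>z f s (x s) (x (D s)) (\<alpha> s)) *v p s)
           - L\<^sub>z L s (x s) (x (D s)) (\<alpha> s)
           + (vector_derivative x (at (D s))
                \<bullet> (transpose (f\<^sub>y f s (x s) (x (D s)) (\<alpha> s)) *v p s)) *\<^sub>R \<tau>\<^sub>z \<tau> s (x s)
           + (vector_derivative x (at (D s))
                \<bullet> L\<^sub>y L s (x s) (x (D s)) (\<alpha> s)) *\<^sub>R \<tau>\<^sub>z \<tau> s (x s)
           - (if s \<in> {ts..D T}
              then vector_derivative \<gamma> (at s) *\<^sub>R
                     (transpose (f\<^sub>y f (\<gamma> s) (x (\<gamma> s)) (x s) (\<alpha> (\<gamma> s))) *v p (\<gamma> s))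
              else 0)
           - (if s \<in> {ts..D T}
              then vector_derivative \<gamma> (at s) *\<^sub>R L\<^sub>y L (\<gamma> s) (x (\<gamma> s)) (x s) (\<alpha> (\<gamma> s))
              else 0)
           - (if s \<in> {T - b..T} then g\<^sub>w (s - T) else 0))) (at s)" (is "(p has_vector_derivative ?r) _")
      moreover have "?r = - C.\<Phi>z s + (vector_derivative x (at (C.D s)) \<bullet> C.\<Phi>y s) *\<^sub>R \<tau>\<^sub>z \<tau> s (x s)
           - (if s \<in> {ts..C.D T} then vector_derivative C.\<gamma> (at s) *\<^sub>R C.\<Phi>y (C.\<gamma> s) else 0)
           - (if s \<in> {T - bd..T} then g\<^sub>w (s - T) else 0)"
        unfolding D \<gamma> C.\<Phi>z_def C.\<Phi>y_def b_eq using D_\<gamma>[of s]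
        by (auto simp del: transpose_matrix_vector simp: inner_add_right scaleR_add_left scaleR_add_right)
      ultimately show "(p has_vector_derivative (- C.\<Phi>z s + (vector_derivative x (at (C.D s)) \<bullet> C.\<Phi>y s) *\<^sub>R \<tau>\<^sub>z \<tau> s (x s)
           - (if s \<in> {ts..C.D T} then vector_derivative C.\<gamma> (at s) *\<^sub>R C.\<Phi>y (C.\<gamma> s) else 0)
           - (if s \<in> {T - bd..T} then g\<^sub>w (s - T) else 0))) (at s)" by simp
    qed
  qed (use g_diff p_lipschitz terminal b_eq in auto)
  have "upper_delay_derivative val t (segment x t) l \<theta>
      \<le> ereal (- hamiltonian A f L t (x t) (x (D t)) (p t) * l + p t \<bullet> \<theta>)" if "l > 0" for l \<theta>
  proof -
    \<comment> \<open>The pair in the superdifferential is fixed while \<open>l\<close> and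
      \<open>\<theta>\<close> range freely, so a perturbation is set up for each choice.\<close>
    interpret perturbation t0 T A f L g \<tau> ts ws \<alpha> x p g\<^sub>z g\<^sub>w t l \<theta>
      by unfold_locales (use t_in that in auto)
    show ?thesis
      using upper_delay_derivative_le[OF optimal[unfolded b_eq] t_cont] unfolding D .
  qed
  then show ?thesis unfolding delay_superdifferential_def b_eq by simp
qed

end
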